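(* Assume the setting of the context; in particular $h$ is $(x,z)$-twisted, $g$ is $(z,y)$-twisted, both $g$ and $h$ are non-degenerate, and $\mu$ assigns zero mass to every set of Hausdorff dimension less than or equal to $n-1$. Assuming that the support of $\mu$ has Hausdorff dimension $n$, the distribution $\mu_Z$ of signed contracts has $n$-dimensional support.
   Context: $X,Y,Z$ are smooth manifolds of the same dimension $n$, smoothly embedded in larger manifolds so that their closures $\overline X,\overline Y,\overline Z$ are compact; $h\in C^2(\overline X\times\overline Z)$ and $g\in C^2(\overline Y\times\overline Z)$. Put $b(x,y)=\sup_{z\in Z}\big(h(x,z)+g(y,z)\big)$. Standing assumptions: for each $(x,y)$ the supremum is attained by a unique $z(x,y)\in Z$; and for all $(x,y)$ the $n\times n$ matrix $D^2_{zz}h(x,z(x,y))+D^2_{zz}g(y,z(x,y))$ is non-singular. $h$ is $(x,z)$-twisted if for all $x\in\overline X$ the map $z\mapsto D_xh(x,z)$ is injective on $\overline Z$. $g$ is $(z,y)$-twisted if for all $z\in\overline Z$ the map $y\mapsto D_zg(y,z)$ is injective on $\overline Y$. $h$ (resp. $g$) is non-degenerate if the $n\times n$ matrix of mixed second partials $D^2_{xz}h(x,z)$ (resp. $D^2_{zy}g(y,z)$) is non-singular for all $(x,z)$ (resp. all $(y,z)$). $\mu$ and $\nu$ are Borel probability measures on $X$ and $Y$. $F:X\to Y$ is the unique map solving Monge's optimal transportation problem, i.e. maximizing $\int_Xb(x,F(x))\,d\mu(x)$ among maps pushing $\mu$ forward to $\nu$. The distribution of signed contracts $\mu_Z$ is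 the push-forward of $\mu$ by the map $x\mapsto z(x,F(x))$. *)

theory Defs
  imports "HOL-Probability.Probability"
begin

section \<open>Smooth manifolds\<close>

text \<open>
  \<open>Ck_on k f S T\<close>: for an open \<open>S\<close> and \<open>S \<subseteq> T \<subseteq> closure S\<close>, the function \<open>f\<close> is \<open>C\<^sup>k\<close> on \<open>S\<close> and
  its derivatives of order \<open>\<le> k\<close> extend continuously from \<open>S\<close> to \<open>T\<close>. The values of \<open>f'\<close> on \<open>T - S\<close>
  are those of the continuous extension. For \<open>T = S\<close> this is the usual notion on an open set.
\<close>

primrec Ck_on ::
  "nat \<Rightarrow> ('a::euclidean_space \<Rightarrow> 'b::real_normed_vector) \<Rightarrow> 'a set \<Rightarrow> 'a set \<Rightarrow> bool" where
  "Ck_on 0 f S T \<longleftrightarrow> continuous_on T f"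
| "Ck_on (Suc k) f S T \<longleftrightarrow> continuous_on T f \<and>
     (\<exists>f'. (\<forall>x\<in>S. (f has_derivative f' x) (at x)) \<and> (\<forall>v. Ck_on k (\<lambda>x. f' x v) S T))"

text \<open>A chart is a pair of its domain and its coordinate map (of which only the values on the
  domain matter).\<close>

type_synonym ('m, 'n) chart = "'m set \<times> ('m \<Rightarrow> real ^ 'n)"

definition chart_inv :: "('m, 'n::finite) chart \<Rightarrow> real ^ 'n \<Rightarrow> 'm" where
  "chart_inv c = inv_into (fst c) (snd c)"

text \<open>The whole type carries the manifold. Hausdorffness and second countability come from the type
  classes of \<open>'m\<close> wherever this is used; the dimension is \<open>CARD('n)\<close>.\<close>

definition smooth_atlas :: "('m::topological_space, 'n::finite) chart set \<Rightarrow> bool" where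
  "smooth_atlas A \<longleftrightarrow>
     (\<Union>c\<in>A. fst c) = UNIV \<and>
     (\<forall>c\<in>A. open (fst c) \<and> open (snd c ` fst c) \<and>
        homeomorphism (fst c) (snd c ` fst c) (snd c) (chart_inv c)) \<and>
     (\<forall>c\<in>A. \<forall>d\<in>A. \<forall>k.
        Ck_on k (snd d \<circ> chart_inv c) (snd c ` (fst c \<inter> fst d)) (snd c ` (fst c \<inter> fst d)))"


section \<open>Functions of two points, twice differentiable up to the closure\<close>

definition C2_closure ::
  "('p::topological_space, 'n::finite) chart set \<Rightarrow> ('q::topological_space, 'n) chart set \<Rightarrow>
   'p set \<Rightarrow> 'q set \<Rightarrow> ('p \<Rightarrow> 'q \<Rightarrow> real) \<Rightarrow> bool" where
  "C2_closure A B P Q h \<longleftrightarrow>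
     (\<forall>c\<in>A. \<forall>d\<in>B.
        Ck_on 2 (\<lambda>(u, w). h (chart_inv c u) (chart_inv d w))
          (snd c ` (fst c \<inter> P) \<times> snd d ` (fst d \<inter> Q))
          (snd c ` (fst c \<inter> closure P) \<times> snd d ` (fst d \<inter> closure Q)))"

text \<open>The \<open>i\<close>-th partial derivative of \<open>f\<close> at \<open>p\<close> in the coordinates of the chart \<open>c\<close>.\<close>

definition pd :: "('m, 'n::finite) chart \<Rightarrow> 'n \<Rightarrow> ('m \<Rightarrow> real) \<Rightarrow> 'm \<Rightarrow> real" where
  "pd c i f p = frechet_derivative (f \<circ> chart_inv c) (at (snd c p)) (axis i 1)"

text \<open>
  Derivatives at points of \<open>closure P \<times> closure Q\<close> are limits of derivatives at points of the open
  set \<open>P \<times> Q\<close>. For \<open>C2_closure\<close> functions and points in the chart domains the limits below exist,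
  are unique (an open subset of a manifold of positive dimension has no isolated points), and on
  \<open>P \<times> Q\<close> itself they are the ordinary derivatives.
\<close>

definition ext_to_closure ::
  "'p::topological_space set \<Rightarrow> 'q::topological_space set \<Rightarrow> ('p \<Rightarrow> 'q \<Rightarrow> real) \<Rightarrow> 'p \<Rightarrow> 'q \<Rightarrow> real" where
  "ext_to_closure P Q k p q = Lim (at (p, q) within P \<times> Q) (\<lambda>(s, t). k s t)"

definition D_first ::
  "('p::topological_space, 'n::finite) chart \<Rightarrow> 'p set \<Rightarrow> 'q::topological_space set \<Rightarrow>
   ('p \<Rightarrow> 'q \<Rightarrow> real) \<Rightarrow> 'p \<Rightarrow> 'q \<Rightarrow> real ^ 'n" where
  "D_first c P Q h p q = (\<chi> i. ext_to_closure P Q (\<lambda>s t. pd c i (\<lambda>s'. h s' t) s) p q)"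

definition D_second ::
  "('q::topological_space, 'n::finite) chart \<Rightarrow> 'p::topological_space set \<Rightarrow> 'q set \<Rightarrow>
   ('p \<Rightarrow> 'q \<Rightarrow> real) \<Rightarrow> 'p \<Rightarrow> 'q \<Rightarrow> real ^ 'n" where
  "D_second d P Q h p q = (\<chi> j. ext_to_closure P Q (\<lambda>s t. pd d j (h s) t) p q)"

definition D2_mixed ::
  "('p::topological_space, 'n::finite) chart \<Rightarrow> ('q::topological_space, 'n) chart \<Rightarrow> 'p set \<Rightarrow> 'q set \<Rightarrow>
   ('p \<Rightarrow> 'q \<Rightarrow> real) \<Rightarrow> 'p \<Rightarrow> 'q \<Rightarrow> real ^ 'n ^ 'n" where
  "D2_mixed c d P Q h p q =
     (\<chi> i j. ext_to_closure P Q (\<lambda>s t. pd c i (\<lambda>s'. pd d j (h s') t) s) p q)"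

definition D2_second ::
  "('q::topological_space, 'n::finite) chart \<Rightarrow> 'p::topological_space set \<Rightarrow> 'q set \<Rightarrow>
   ('p \<Rightarrow> 'q \<Rightarrow> real) \<Rightarrow> 'p \<Rightarrow> 'q \<Rightarrow> real ^ 'n ^ 'n" where
  "D2_second d P Q h p q =
     (\<chi> i j. ext_to_closure P Q (\<lambda>s t. pd d i (\<lambda>t'. pd d j (h s) t') t) p q)"

text \<open>Injectivity of the covector \<open>D\<^sub>xh(x,\<sqdot>)\<close> may be tested on its components in any chart at \<open>x\<close>.\<close>

definition twisted_first_second ::
  "('p::topological_space, 'n::finite) chart set \<Rightarrow> 'p set \<Rightarrow> 'q::topological_space set \<Rightarrow>
   ('p \<Rightarrow> 'q \<Rightarrow> real) \<Rightarrow> bool" where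
  "twisted_first_second A P Q h \<longleftrightarrow>
     (\<forall>c\<in>A. \<forall>p\<in>closure P \<inter> fst c. inj_on (\<lambda>q. D_first c P Q h p q) (closure Q))"

definition twisted_second_first ::
  "('q::topological_space, 'n::finite) chart set \<Rightarrow> 'p::topological_space set \<Rightarrow> 'q set \<Rightarrow>
   ('p \<Rightarrow> 'q \<Rightarrow> real) \<Rightarrow> bool" where
  "twisted_second_first B P Q g \<longleftrightarrow>
     (\<forall>d\<in>B. \<forall>q\<in>closure Q \<inter> fst d. inj_on (\<lambda>p. D_second d P Q g p q) (closure P))"

definition nondegenerate ::
  "('p::topological_space, 'n::finite) chart set \<Rightarrow> ('q::topological_space, 'n) chart set \<Rightarrow>
   'p set \<Rightarrow> 'q set \<Rightarrow> ('p \<Rightarrow> 'q \<Rightarrow> real) \<Rightarrow> bool" where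
  "nondegenerate A B P Q h \<longleftrightarrow>
     (\<forall>c\<in>A. \<forall>d\<in>B. \<forall>p\<in>closure P \<inter> fst c. \<forall>q\<in>closure Q \<inter> fst d.
        invertible (D2_mixed c d P Q h p q))"


section \<open>Surplus and contracts\<close>

definition surplus ::
  "('x \<Rightarrow> 'z \<Rightarrow> real) \<Rightarrow> ('y \<Rightarrow> 'z \<Rightarrow> real) \<Rightarrow> 'z set \<Rightarrow> 'x \<Rightarrow> 'y \<Rightarrow> real" where
  "surplus h g Z x y = (SUP z\<in>Z. h x z + g y z)"

definition contract ::
  "('x \<Rightarrow> 'z \<Rightarrow> real) \<Rightarrow> ('y \<Rightarrow> 'z \<Rightarrow> real) \<Rightarrow> 'z set \<Rightarrow> 'x \<Rightarrow> 'y \<Rightarrow> 'z" where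
  "contract h g Z x y = (THE z. z \<in> Z \<and> h x z + g y z = surplus h g Z x y)"


section \<open>Monge's problem\<close>

definition transport_map :: "'x measure \<Rightarrow> 'y measure \<Rightarrow> ('x \<Rightarrow> 'y) \<Rightarrow> bool" where
  "transport_map \<mu> \<nu> F \<longleftrightarrow> F \<in> measurable \<mu> \<nu> \<and> distr \<mu> \<nu> F = \<nu>"

definition monge_solution ::
  "('x \<Rightarrow> 'y \<Rightarrow> real) \<Rightarrow> 'x measure \<Rightarrow> 'y measure \<Rightarrow> ('x \<Rightarrow> 'y) \<Rightarrow> bool" where
  "monge_solution b \<mu> \<nu> F \<longleftrightarrow> transport_map \<mu> \<nu> F \<and>
     (\<forall>G. transport_map \<mu> \<nu> G \<longrightarrow> (\<integral>x. b x (G x) \<partial>\<mu>) \<le> (\<integral>x. b x (F x) \<partial>\<mu>))"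

definition unique_monge_solution ::
  "('x \<Rightarrow> 'y \<Rightarrow> real) \<Rightarrow> 'x measure \<Rightarrow> 'y measure \<Rightarrow> ('x \<Rightarrow> 'y) \<Rightarrow> bool" where
  "unique_monge_solution b \<mu> \<nu> F \<longleftrightarrow> monge_solution b \<mu> \<nu> F \<and>
     (\<forall>G. monge_solution b \<mu> \<nu> G \<longrightarrow> (AE x in \<mu>. G x = F x))"


section \<open>Borel probability measures, support, Hausdorff dimension\<close>

definition borel_prob_on :: "'m::topological_space set \<Rightarrow> 'm measure \<Rightarrow> bool" where
  "borel_prob_on X \<mu> \<longleftrightarrow> prob_space \<mu> \<and> sets \<mu> = sets (restrict_space borel X)"

text \<open>The support is taken relative to the space on which the measure lives.\<close>

definition msupport :: "'m::topological_space measure \<Rightarrow> 'm set" where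
  "msupport \<mu> = {x \<in> space \<mu>. \<forall>U. open U \<and> x \<in> U \<longrightarrow> emeasure \<mu> (U \<inter> space \<mu>) \<noteq> 0}"

definition hausdorff_premeasure :: "real \<Rightarrow> real \<Rightarrow> 'a::metric_space set \<Rightarrow> ennreal" where
  "hausdorff_premeasure s \<delta> S =
     (INF C \<in> {C :: nat \<Rightarrow> 'a set. S \<subseteq> (\<Union>i. C i) \<and> (\<forall>i. bounded (C i) \<and> diameter (C i) \<le> \<delta>)}.
        (\<Sum>i. ennreal (diameter (C i) powr s)))"

definition hausdorff_measure :: "real \<Rightarrow> 'a::metric_space set \<Rightarrow> ennreal" where
  "hausdorff_measure s S = (SUP \<delta> \<in> {0<..}. hausdorff_premeasure s \<delta> S)"

text \<open>Only exponents \<open>s > 0\<close> are used (\<open>0 powr 0 = 0\<close> would spoil the counting measure at \<open>s = 0\<close>);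
  this does not affect the infimum. The empty set gets dimension \<open>0\<close>.\<close>

definition hausdorff_dim :: "'a::metric_space set \<Rightarrow> ereal" where
  "hausdorff_dim S = (INF s \<in> {s. 0 < s \<and> hausdorff_measure s S = 0}. ereal s)"

text \<open>Smooth changes of coordinates are locally bi-Lipschitz, so on a manifold Hausdorff dimension
  is measured in charts. It agrees with the dimension for the distance of any Riemannian metric.\<close>

definition manifold_hausdorff_dim ::
  "('m, 'n::finite) chart set \<Rightarrow> 'm set \<Rightarrow> ereal" where
  "manifold_hausdorff_dim A S = (SUP c\<in>A. hausdorff_dim (snd c ` (S \<inter> fst c)))"

end

theory Submission
  imports Defs
begin

text \<open>
  Monotonicity: the support of the graph of \<open>F\<close> is \<open>b\<close>-monotone, since otherwise one could exchange
  the images of two small sets of equal mass and increase the total surplus; this needs only that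
  \<open>\<mu>\<close> has no atoms.

  Let \<open>(x, y)\<close> be in that support and let \<open>z\<close> maximise \<open>h(x, \<sqdot>) + g(y, \<sqdot>)\<close> over \<open>closure Z\<close>. If \<open>z\<close> is the
  only maximiser, then it lies in the support of \<open>\<mu>\<^sub>Z\<close>, and a second-order estimate in the manner of
  Mather's shortening lemma shows that locally \<open>x\<close> is a Lipschitz function of \<open>z\<close>. If there are two
  maximisers (one of them possibly on the boundary of \<open>Z\<close>), then by the twist condition \<open>x\<close> is a kink,
  and the kinks are contained in countably many Lipschitz graphs of dimension \<open>n - 1\<close>. So the
  dimension of the support of \<open>\<mu>\<close> is at most the maximum of \<open>n - 1\<close> and that of the support of \<open>\<mu>\<^sub>Z\<close>.
\<close>

section \<open>Hausdorff dimension\<close>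

text \<open>Uniqueness of the maximiser is given in the open set \<open>Z\<close> only; over
  \<open>closure Z\<close> a second one may sit on the boundary, and near such a pair the contract
  may jump. This is what splits the support of \<open>\<mu>\<close> in two. At a unique maximiser
  \<open>z\<close> is interior, so \<open>h\<close> can be expanded to second order in
  \<open>z\<close>. With two maximisers only first derivatives in \<open>x\<close> enter, and these
  extend continuously to boundary points \<open>z\<close>. Every estimate compares just two points
  of the graph support, without dual potentials. A competitor in Monge's problem must again be a
  map, so exchanging images requires measure preserving maps between the two small sets. They are
  built on the real line: chart coordinates are coded as reals, and a distribution function is
  composed with a quantile function. \<open>F\<close> is only measurable and its values may
  accumulate on the boundary of \<open>Y\<close>. Hence its graph is replaced by a support inside
  \<open>X\<close> times \<open>closure Y\<close>, where compactness provides a partner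
  \<open>y\<close> for each point of the support of \<open>\<mu>\<close>.\<close>

lemma hausdorff_measure_eq_0_iff:
  fixes S :: "'a::metric_space set"
  shows "hausdorff_measure s S = 0 \<longleftrightarrow>
    (\<forall>\<delta>>0. \<forall>\<epsilon>>0. \<exists>C :: nat \<Rightarrow> 'a set. S \<subseteq> (\<Union>i. C i) \<and>
       (\<forall>i. bounded (C i) \<and> diameter (C i) \<le> \<delta>) \<and>
       (\<Sum>i. ennreal (diameter (C i) powr s)) < \<epsilon>)"
proof -
  have "hausdorff_measure s S = 0 \<longleftrightarrow> (\<forall>\<delta>>0. hausdorff_premeasure s \<delta> S = 0)"
    unfolding hausdorff_measure_def by (auto simp: SUP_eq_iff bot_ennreal[symmetric] SUP_bot_conv)
  also have "\<dots> \<longleftrightarrow> (\<forall>\<delta>>0. \<forall>\<epsilon>>0. hausdorff_premeasure s \<delta> S < \<epsilon>)"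
    by (metis gr_zeroI less_irrefl)
  also have "\<dots> \<longleftrightarrow> (\<forall>\<delta>>0. \<forall>\<epsilon>>0. \<exists>C :: nat \<Rightarrow> 'a set. S \<subseteq> (\<Union>i. C i) \<and>
       (\<forall>i. bounded (C i) \<and> diameter (C i) \<le> \<delta>) \<and>
       (\<Sum>i. ennreal (diameter (C i) powr s)) < \<epsilon>)"
    unfolding hausdorff_premeasure_def INF_less_iff by (simp add: Bex_def conj_assoc)
  finally show ?thesis .
qed

lemma hausdorff_measure_mono_exponent:
  assumes "hausdorff_measure s S = 0" and "s \<le> t"
  shows "hausdorff_measure t S = 0"
  unfolding hausdorff_measure_eq_0_iff
proof (intro allI impI)
  fix \<delta> :: real and \<epsilon> :: ennreal assume "0 < \<delta>" "0 < \<epsilon>"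
  \<comment> \<open>Capping the scale at 1 keeps the diameters in the range where a larger exponent
    gives a smaller power.\<close>
  then obtain C where C: "S \<subseteq> (\<Union>i. C i)" "\<And>i. bounded (C i)" "\<And>i. diameter (C i) \<le> min \<delta> 1"
    "(\<Sum>i. ennreal (diameter (C i) powr s)) < \<epsilon>"
    using assms(1) unfolding hausdorff_measure_eq_0_iff by (metis min_less_iff_conj zero_less_one)
  have "diameter (C i) powr t \<le> diameter (C i) powr s" for i
    using C(3)[of i] diameter_ge_0[OF C(2)] \<open>s \<le> t\<close> by (intro powr_mono') auto
  then have "(\<Sum>i. ennreal (diameter (C i) powr t)) \<le> (\<Sum>i. ennreal (diameter (C i) powr s))"
    by (intro suminf_le ennreal_leI) auto
  then show "\<exists>C. S \<subseteq> (\<Union>i. C i) \<and> (\<forall>i. bounded (C i) \<and> diameter (C i) \<le> \<delta>) \<and>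
       (\<Sum>i. ennreal (diameter (C i) powr t)) < \<epsilon>"
    using C by (intro exI[of _ C]) auto
qed

lemma hausdorff_dim_less_imp_null:
  assumes "hausdorff_dim S < ereal s"
  shows "hausdorff_measure s S = 0"
proof -
  obtain s' where "0 < s'" "hausdorff_measure s' S = 0" "s' < s"
    using assms unfolding hausdorff_dim_def INF_less_iff by auto
  then show ?thesis using hausdorff_measure_mono_exponent[of s' S s] by auto
qed

text \<open>The infimum in \<open>hausdorff_dim\<close> need not be attained, so an upper bound is
  tested on all exponents strictly above it. The condition \<open>0 \<le> t\<close> makes these
  exponents positive, hence admissible in the infimum.\<close>

lemma hausdorff_dim_leI:
  assumes "0 \<le> t" and "\<And>s. t < ereal s \<Longrightarrow> hausdorff_measure s S = 0"
  shows "hausdorff_dim S \<le> t"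
proof (rule dense_ge)
  fix r assume r: "t < r"
  then obtain s where s: "t < ereal s" "ereal s < r"
    using ereal_dense2 by blast
  then have "0 < s" using assms(1) by (metis ereal_less(2) le_less_trans)
  then have "hausdorff_dim S \<le> ereal s"
    unfolding hausdorff_dim_def using assms(2)[OF s(1)] by (intro INF_lower) auto
  then show "hausdorff_dim S \<le> r" using s(2) by auto
qed

lemma hausdorff_dim_nonneg: "0 \<le> hausdorff_dim S"
  unfolding hausdorff_dim_def by (intro INF_greatest) auto

text \<open>A cover of the second projection is pulled back through \<open>R\<close>, which
  multiplies diameters by at most a constant. A relation is used because the contact points come as
  pairs; that \<open>w\<close> determines \<open>u\<close> is itself a consequence of
  \<open>lip\<close>.\<close>

lemma hausdorff_dim_Lipschitz_relation:
  fixes R :: "('a::metric_space \<times> 'b::metric_space) set"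
  assumes lip: "\<And>u u' w w'. (u, w) \<in> R \<Longrightarrow> (u', w') \<in> R \<Longrightarrow> dist u u' \<le> L * dist w w'"
  shows "hausdorff_dim (fst ` R) \<le> hausdorff_dim (snd ` R)"
proof (rule hausdorff_dim_leI[OF hausdorff_dim_nonneg])
  fix s assume "hausdorff_dim (snd ` R) < ereal s"
  then have null: "hausdorff_measure s (snd ` R) = 0" by (rule hausdorff_dim_less_imp_null)
  have "0 < s" using \<open>hausdorff_dim (snd ` R) < ereal s\<close> hausdorff_dim_nonneg
    by (metis ereal_less(2) le_less_trans)
  \<comment> \<open>\<open>L\<close> may be zero or negative; \<open>K\<close> is a constant by
    which one can divide.\<close>
  define K where "K = max L 1"
  have K: "1 \<le> K" "L \<le> K" by (auto simp: K_def)
  show "hausdorff_measure s (fst ` R) = 0"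
    unfolding hausdorff_measure_eq_0_iff
  proof (intro allI impI)
    fix \<delta> :: real and \<epsilon> :: ennreal assume "0 < \<delta>" "0 < \<epsilon>"
    have "0 < K powr s" using K by simp
    then have e: "0 < \<epsilon> / ennreal (K powr s)"
      using \<open>0 < \<epsilon>\<close> by (simp add: ennreal_zero_less_divide)
    have d: "0 < \<delta> / K" using \<open>0 < \<delta>\<close> K by simp
    obtain C where C: "snd ` R \<subseteq> (\<Union>i. C i)" "\<And>i. bounded (C i)" "\<And>i. diameter (C i) \<le> \<delta> / K"
      "(\<Sum>i. ennreal (diameter (C i) powr s)) < \<epsilon> / ennreal (K powr s)"
      using null[unfolded hausdorff_measure_eq_0_iff, rule_format, OF d e] by blast
    define D where "D i = {u. \<exists>w\<in>C i. (u, w) \<in> R}" for i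
    have dist: "dist u u' \<le> K * diameter (C i)" if uu: "u \<in> D i" "u' \<in> D i" for u u' i
    proof -
      obtain w w' where w: "w \<in> C i" "(u, w) \<in> R" "w' \<in> C i" "(u', w') \<in> R"
        using uu unfolding D_def by auto
      have "dist u u' \<le> L * dist w w'" using lip w by auto
      also have "\<dots> \<le> K * dist w w'" using K by (intro mult_right_mono) auto
      also have "\<dots> \<le> K * diameter (C i)"
        using K w diameter_bounded_bound[OF C(2)] by (intro mult_left_mono) auto
      finally show ?thesis .
    qed
    have bnd: "bounded (D i)" for i
      unfolding bounded_def using dist by blast
    have Kd: "0 \<le> K * diameter (C i)" for i using K diameter_ge_0[OF C(2)] by auto
    have dia: "diameter (D i) \<le> K * diameter (C i)" for i
    proof -
      have "diameter A \<le> M" if "0 \<le> M" "\<And>u u'. u \<in> A \<Longrightarrow> u' \<in> A \<Longrightarrow> dist u u' \<le> M" for A :: "'a set" and M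
        using that by (auto simp: diameter_def intro!: cSUP_least)
      then show ?thesis using Kd dist by blast
    qed
    have "diameter (D i) powr s \<le> K powr s * diameter (C i) powr s" for i
    proof -
      have "diameter (D i) powr s \<le> (K * diameter (C i)) powr s"
        using dia \<open>0 < s\<close> diameter_ge_0[OF bnd] by (intro powr_mono2) auto
      then show ?thesis using K diameter_ge_0[OF C(2)] by (simp add: powr_mult)
    qed
    then have "(\<Sum>i. ennreal (diameter (D i) powr s)) \<le>
               (\<Sum>i. ennreal (K powr s) * ennreal (diameter (C i) powr s))"
      by (intro suminf_le) (auto simp flip: ennreal_mult')
    also have "\<dots> = ennreal (K powr s) * (\<Sum>i. ennreal (diameter (C i) powr s))" by simp
    also have "\<dots> < \<epsilon>"
    proof (cases "\<epsilon> = top")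
      case True
      then have "(\<Sum>i. ennreal (diameter (C i) powr s)) < top" using C(4) by (simp add: ennreal_top_divide)
      then show ?thesis using True by (simp add: ennreal_mult_less_top)
    next
      case False
      have "ennreal (K powr s) * (\<Sum>i. ennreal (diameter (C i) powr s)) <
            ennreal (K powr s) * (\<epsilon> / ennreal (K powr s))"
        using C(4) \<open>0 < K powr s\<close> by (intro ennreal_mult_strict_left_mono) auto
      also have "\<dots> = \<epsilon>"
        using \<open>0 < K powr s\<close> by (simp add: ennreal_mult_divide_eq ennreal_times_divide mult.commute)
      finally show ?thesis .
    qed
    finally have lt: "(\<Sum>i. ennreal (diameter (D i) powr s)) < \<epsilon>" .
    have "fst ` R \<subseteq> (\<Union>i. D i)" using C(1) unfolding D_def by force
    moreover have "diameter (D i) \<le> \<delta>" for i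
      using dia[of i] C(3)[of i] K by (simp add: field_simps)
    ultimately show "\<exists>C. fst ` R \<subseteq> (\<Union>i. C i) \<and> (\<forall>i. bounded (C i) \<and> diameter (C i) \<le> \<delta>) \<and>
       (\<Sum>i. ennreal (diameter (C i) powr s)) < \<epsilon>"
      using lt bnd by blast
  qed
qed

lemma hausdorff_dim_mono:
  assumes "S \<subseteq> S'" shows "hausdorff_dim S \<le> hausdorff_dim S'"
proof (rule hausdorff_dim_leI[OF hausdorff_dim_nonneg])
  fix s assume "hausdorff_dim S' < ereal s"
  then show "hausdorff_measure s S = 0"
    using hausdorff_dim_less_imp_null[of S' s] assms
    unfolding hausdorff_measure_eq_0_iff by (meson subset_trans)
qed

lemma hausdorff_measure_UN_null:
  fixes S :: "nat \<Rightarrow> 'a::metric_space set"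
  assumes "\<And>k. hausdorff_measure s (S k) = 0"
  shows "hausdorff_measure s (\<Union>k. S k) = 0"
  unfolding hausdorff_measure_eq_0_iff
proof (intro allI impI)
  fix \<delta> :: real and \<epsilon> :: ennreal assume d: "0 < \<delta>" and "0 < \<epsilon>"
  \<comment> \<open>The budget \<open>\<epsilon>\<close> may be infinite; a real \<open>e\<close>
    below it can be split geometrically over the sets \<open>S k\<close>.\<close>
  obtain e :: real where e: "0 < e" "ennreal e < \<epsilon>"
  proof -
    obtain e' where "0 < e'" "e' < \<epsilon>" using \<open>0 < \<epsilon>\<close> dense by blast
    then show ?thesis using that[of "enn2real e'"]
      by (cases e') (auto simp: enn2real_positive_iff top_unique)
  qed
  have "\<exists>C. S k \<subseteq> (\<Union>i. C i) \<and> (\<forall>i. bounded (C i) \<and> diameter (C i) \<le> \<delta>) \<and>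
       (\<Sum>i. ennreal (diameter (C i) powr s)) < ennreal (e * (1/2)^Suc k)" for k :: nat
  proof -
    have "0 < ennreal (e * (1/2)^Suc k)"
      unfolding ennreal_less_zero_iff using e by (intro mult_pos_pos zero_less_power) auto
    then show ?thesis
      using assms[of k] d unfolding hausdorff_measure_eq_0_iff by blast
  qed
  then obtain C where C: "\<And>k. S k \<subseteq> (\<Union>i. C k i)" "\<And>k i. bounded (C k i)"
      "\<And>k i. diameter (C k i) \<le> \<delta>"
      "\<And>k. (\<Sum>i. ennreal (diameter (C k i) powr s)) < ennreal (e * (1/2)^Suc k)"
    by metis
  define D where "D n = (case prod_decode n of (k, i) \<Rightarrow> C k i)" for n
  have "(\<Sum>n. ennreal (diameter (D n) powr s)) = (\<Sum>k. \<Sum>i. ennreal (diameter (C k i) powr s))"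
    using suminf_ennreal_2dimen[where f="\<lambda>(k, i). ennreal (diameter (C k i) powr s)"
      and g="\<lambda>k. \<Sum>i. ennreal (diameter (C k i) powr s)"]
    by (simp only: D_def case_prod_beta fst_conv snd_conv)
  also have "\<dots> \<le> (\<Sum>k. ennreal (e * (1/2)^Suc k))"
    by (rule suminf_le[OF less_imp_le[OF C(4)] summableI summableI])
  also have "\<dots> = ennreal e"
  proof -
    have "(\<lambda>k. e * (1/2)^Suc k) sums (e * 1)" by (intro sums_mult power_half_series)
    moreover have "0 \<le> e * (1/2)^Suc k" for k
      using e(1) by (intro mult_nonneg_nonneg zero_le_power) auto
    ultimately show ?thesis using suminf_ennreal_eq by (metis mult.right_neutral)
  qed
  also have "\<dots> < \<epsilon>" by fact
  finally have "(\<Sum>n. ennreal (diameter (D n) powr s)) < \<epsilon>" .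
  moreover have "(\<Union>k. S k) \<subseteq> (\<Union>n. D n)"
  proof
    fix x assume "x \<in> (\<Union>k. S k)"
    then obtain k i where "x \<in> C k i" using C(1) by blast
    then have "x \<in> D (prod_encode (k, i))" by (simp add: D_def)
    then show "x \<in> (\<Union>n. D n)" by blast
  qed
  moreover have "bounded (D n)" "diameter (D n) \<le> \<delta>" for n
    using C by (auto simp: D_def split: prod.splits)
  ultimately show "\<exists>C. (\<Union>k. S k) \<subseteq> (\<Union>i. C i) \<and> (\<forall>i. bounded (C i) \<and> diameter (C i) \<le> \<delta>) \<and>
       (\<Sum>i. ennreal (diameter (C i) powr s)) < \<epsilon>" by blast
qed

lemma hausdorff_dim_countable_UN_le:
  assumes "countable I" and "0 \<le> t" and "\<And>i. i \<in> I \<Longrightarrow> hausdorff_dim (S i) \<le> t"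
  shows "hausdorff_dim (\<Union>i\<in>I. S i) \<le> t"
proof (rule hausdorff_dim_leI[OF \<open>0 \<le> t\<close>])
  fix s assume s: "t < ereal s"
  then have nl: "hausdorff_measure s (S i) = 0" if "i \<in> I" for i
    using assms(3)[OF that] by (intro hausdorff_dim_less_imp_null) auto
  have em: "hausdorff_measure s {} = 0"
    unfolding hausdorff_measure_eq_0_iff by (auto intro!: exI[of _ "\<lambda>_. {}"])
  show "hausdorff_measure s (\<Union>i\<in>I. S i) = 0"
  proof (cases "I = {}")
    case False
    then have "(\<Union>i\<in>I. S i) = (\<Union>k. S (from_nat_into I k))"
      using range_from_nat_into[OF False assms(1)] by (metis image_image)
    then show ?thesis
      using hausdorff_measure_UN_null[of s "\<lambda>k. S (from_nat_into I k)"] nl from_nat_into[OF False]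
      by simp
  qed (simp add: em)
qed

section \<open>Dimension bounds by counting grid cells\<close>

text \<open>A mesh of width \<open>\<eta>\<close> in the coordinates \<open>J\<close> has of order
  \<open>(1/\<eta>) ^ card J\<close> cells, and \<open>lip\<close> bounds the diameter of the part
  of \<open>S\<close> in each cell by a multiple of \<open>\<eta>\<close>. The covering sum is of
  order \<open>\<eta> powr (s - card J)\<close>, which tends to 0 for \<open>s\<close> above
  \<open>card J\<close>.\<close>

lemma hausdorff_dim_grid:
  fixes S :: "(real ^ 'n::finite) set" and J :: "'n set"
  assumes bnd: "\<And>x j. x \<in> S \<Longrightarrow> \<bar>x $ j\<bar> \<le> R"
    and lip: "\<And>x x'. x \<in> S \<Longrightarrow> x' \<in> S \<Longrightarrow> norm (x - x') \<le> C * (\<Sum>j\<in>J. \<bar>x $ j - x' $ j\<bar>)"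
  shows "hausdorff_dim S \<le> ereal (real (card J))"
proof (rule hausdorff_dim_leI)
  fix s assume "ereal (real (card J)) < ereal s"
  then have s: "real (card J) < s" by simp
  then have "0 < s" by linarith
  define m where "m = card J"
  \<comment> \<open>The summand 1 keeps \<open>K\<close> positive when \<open>J\<close> is empty,
    the maximum when \<open>C\<close> is not positive.\<close>
  define K where "K = max C 1 * (m + 1)"
  have K: "0 < K" by (auto simp: K_def)
  define R' where "R' = max R 1"
  have R': "1 \<le> R'" "\<And>x j. x \<in> S \<Longrightarrow> \<bar>x $ j\<bar> \<le> R'" using bnd by (auto simp: R'_def max_def intro: order_trans)
  show "hausdorff_measure s S = 0"
    unfolding hausdorff_measure_eq_0_iff
  proof (intro allI impI)
    fix \<delta> :: real and \<epsilon> :: ennreal assume d: "0 < \<delta>" and "0 < \<epsilon>"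
    obtain e :: real where e: "0 < e" "ennreal e < \<epsilon>"
    proof -
      obtain e' where "0 < e'" "e' < \<epsilon>" using \<open>0 < \<epsilon>\<close> dense by blast
      then show ?thesis using that[of "enn2real e'"]
        by (cases e') (auto simp: enn2real_positive_iff top_unique)
    qed
    have lim: "((\<lambda>\<eta>. (4 * R') ^ m * K powr s * \<eta> powr (s - m)) \<longlongrightarrow> (4 * R') ^ m * K powr s * 0 powr (s - m)) (at_right 0)"
      using s by (intro tendsto_intros tendsto_powr') (auto simp: m_def eventually_at_filter)
    have ev1: "eventually (\<lambda>\<eta>. (4 * R') ^ m * K powr s * \<eta> powr (s - m) < e) (at_right 0)"
      using lim e s by (intro order_tendstoD(2)[OF lim]) auto
    have ev2: "eventually (\<lambda>\<eta>. \<eta> \<in> {0<..<min 1 (\<delta> / K)}) (at_right 0)"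
      using d K by (intro eventually_at_right_real) auto
    obtain \<eta> where \<eta>: "0 < \<eta>" "\<eta> < 1" "\<eta> < \<delta> / K"
        "(4 * R') ^ m * K powr s * \<eta> powr (s - m) < e"
      using eventually_happens'[OF trivial_limit_at_right_real eventually_conj[OF ev1 ev2]] by auto
    \<comment> \<open>On \<open>S\<close> every cell index lies between \<open>- N\<close> and
      \<open>N - 1\<close>. Since \<open>R'\<close> is at least 1 and \<open>\<eta>\<close> is below
      1, \<open>N\<close> is at most \<open>2 * R' / \<eta>\<close>; hence the factor
      \<open>4 * R'\<close> per coordinate in the count.\<close>
    define N where "N = \<lfloor>R' / \<eta>\<rfloor> + 1"
    define cell where "cell x = (\<lambda>j\<in>J. \<lfloor>x $ j / \<eta>\<rfloor>)" for x :: "real ^ 'n"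
    define I where "I = PiE J (\<lambda>_. {-N..<N})"
    have finI: "finite I" unfolding I_def by (intro finite_PiE) auto
    have cellI: "cell x \<in> I" if "x \<in> S" for x
    proof -
      have "-N \<le> \<lfloor>x $ j / \<eta>\<rfloor> \<and> \<lfloor>x $ j / \<eta>\<rfloor> < N" for j
      proof -
        have "\<bar>x $ j / \<eta>\<bar> \<le> R' / \<eta>" using R'(2)[OF that, of j] \<eta>(1) by (simp add: divide_right_mono)
        then show ?thesis unfolding N_def by linarith
      qed
      then show ?thesis by (auto simp: cell_def I_def)
    qed
    define D where "D c = {x \<in> S. cell x = c}" for c
    have dist: "dist x x' \<le> K * \<eta>" if xx: "x \<in> D c" "x' \<in> D c" for x x' c
    proof -
      have "\<bar>x $ j - x' $ j\<bar> \<le> \<eta>" if "j \<in> J" for j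
      proof -
        have "cell x j = cell x' j" using xx by (simp add: D_def)
        then have "\<lfloor>x $ j / \<eta>\<rfloor> = \<lfloor>x' $ j / \<eta>\<rfloor>" using that by (simp add: cell_def)
        then have "\<bar>x $ j / \<eta> - x' $ j / \<eta>\<bar> \<le> 1" by linarith
        then have "\<bar>(x $ j - x' $ j) / \<eta>\<bar> \<le> 1" by (simp add: diff_divide_distrib)
        then show ?thesis using \<eta>(1) by (simp add: divide_le_eq)
      qed
      then have "(\<Sum>j\<in>J. \<bar>x $ j - x' $ j\<bar>) \<le> m * \<eta>" unfolding m_def by (rule sum_bounded_above)
      moreover have "0 \<le> (\<Sum>j\<in>J. \<bar>x $ j - x' $ j\<bar>)" by (intro sum_nonneg) auto
      moreover have "norm (x - x') \<le> C * (\<Sum>j\<in>J. \<bar>x $ j - x' $ j\<bar>)" using lip xx by (auto simp: D_def)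
      ultimately have "norm (x - x') \<le> max C 1 * (m * \<eta>)"
        by (smt (verit) mult_left_mono mult_right_mono)
      also have "\<dots> \<le> K * \<eta>" unfolding K_def using \<eta>(1) by (simp add: algebra_simps)
      finally show ?thesis by (simp add: dist_norm)
    qed
    have bndD: "bounded (D c)" for c
      unfolding bounded_def using dist by blast
    have dia: "diameter (D c) \<le> K * \<eta>" for c
      using dist[of _ c] K \<eta>(1) by (intro diameter_le) (auto simp: dist_norm)
    obtain f where f: "bij_betw f {..<card I} I"
      using ex_bij_betw_nat_finite[OF finI] by (auto simp: atLeast0LessThan)
    define E where "E i = (if i < card I then D (f i) else {})" for i
    have cardI: "real (card I) \<le> (4 * R') ^ m * (1/\<eta>) ^ m"
    proof -
      have N: "0 \<le> N" "real_of_int N \<le> 2 * R' / \<eta>"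
      proof -
        have "1 \<le> R' / \<eta>" using R'(1) \<eta> by (simp add: le_divide_eq)
        then show "0 \<le> N" "real_of_int N \<le> 2 * R' / \<eta>" unfolding N_def by linarith+
      qed
      have "card I = (nat (2 * N)) ^ m" by (simp add: I_def card_PiE m_def)
      then have "real (card I) = (2 * real_of_int N) ^ m" using N(1) by simp
      also have "\<dots> \<le> (4 * R' / \<eta>) ^ m" using N by (intro power_mono) auto
      finally show ?thesis by (simp add: power_divide)
    qed
    have "(\<Sum>i. ennreal (diameter (E i) powr s)) = (\<Sum>i<card I. ennreal (diameter (E i) powr s))"
      by (intro suminf_finite) (auto simp: E_def)
    also have "\<dots> \<le> (\<Sum>i<card I. ennreal ((K * \<eta>) powr s))"
      using dia diameter_ge_0[OF bndD] \<open>0 < s\<close> by (intro sum_mono ennreal_leI powr_mono2) (auto simp: E_def)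
    also have "\<dots> = ennreal (card I * (K * \<eta>) powr s)"
      by (simp add: ennreal_mult' ennreal_of_nat_eq_real_of_nat)
    also have "\<dots> \<le> ennreal ((4 * R') ^ m * K powr s * \<eta> powr (s - m))"
    proof (intro ennreal_leI)
      have "card I * (K * \<eta>) powr s \<le> (4 * R') ^ m * (1/\<eta>) ^ m * (K * \<eta>) powr s"
        using cardI by (intro mult_right_mono) auto
      also have "\<dots> = (4 * R') ^ m * K powr s * \<eta> powr (s - m)"
        using K \<eta>(1) by (simp add: powr_mult powr_diff powr_realpow power_divide)
      finally show "card I * (K * \<eta>) powr s \<le> (4 * R') ^ m * K powr s * \<eta> powr (s - m)" .
    qed
    also have "\<dots> < ennreal e" using \<eta>(4) e by (intro ennreal_lessI) auto
    also have "\<dots> < \<epsilon>" by fact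
    finally have lt: "(\<Sum>i. ennreal (diameter (E i) powr s)) < \<epsilon>" .
    have "S \<subseteq> (\<Union>i. E i)"
    proof
      fix x assume "x \<in> S"
      then obtain i where "i < card I" "f i = cell x" using cellI f unfolding bij_betw_def by (metis imageE lessThan_iff)
      then show "x \<in> (\<Union>i. E i)" using \<open>x \<in> S\<close> by (auto simp: E_def D_def intro!: exI[of _ i])
    qed
    moreover have "K * \<eta> \<le> \<delta>" using \<eta>(3) K by (simp add: field_simps)
    then have "bounded (E i)" "diameter (E i) \<le> \<delta>" for i
      using bndD dia[of "f i"] d by (auto simp: E_def)
    ultimately show "\<exists>C. S \<subseteq> (\<Union>i. C i) \<and> (\<forall>i. bounded (C i) \<and> diameter (C i) \<le> \<delta>) \<and>
       (\<Sum>i. ennreal (diameter (C i) powr s)) < \<epsilon>" using lt by blast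
  qed
qed simp

text \<open>The grid bound with no coordinates at all. It is used to see that the hypothesis on
  small sets rules out atoms of \<open>\<mu>\<close>.\<close>

lemma hausdorff_dim_singleton_le:
  fixes S :: "(real ^ 'n::finite) set"
  assumes "S \<subseteq> {u}" shows "hausdorff_dim S \<le> 0"
proof -
  have "hausdorff_dim S \<le> ereal (real (card ({} :: 'n set)))"
  proof (rule hausdorff_dim_grid[where C=0])
    show "\<bar>x $ j\<bar> \<le> norm u" if "x \<in> S" for x j
      using that assms component_le_norm_cart[of u j] by auto
    show "norm (x - x') \<le> 0 * (\<Sum>j\<in>{}. \<bar>x $ j - x' $ j\<bar>)" if "x \<in> S" "x' \<in> S" for x x'
      using that assms by auto
  qed
  then show ?thesis by (simp add: zero_ereal_def)
qed

lemma hausdorff_dim_vec_le: "hausdorff_dim (S :: (real ^ 'n::finite) set) \<le> ereal (real CARD('n))"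
proof -
  \<comment> \<open>The grid bound needs bounded sets, so the set is exhausted by cubes.\<close>
  have "hausdorff_dim (\<Union>k::nat. S \<inter> {x. \<forall>j. \<bar>x $ j\<bar> \<le> real k}) \<le> ereal (real CARD('n))"
  proof (rule hausdorff_dim_countable_UN_le)
    fix k :: nat
    show "hausdorff_dim (S \<inter> {x. \<forall>j. \<bar>x $ j\<bar> \<le> real k}) \<le> ereal (real CARD('n))"
    proof (rule hausdorff_dim_grid[where J=UNIV])
      fix x x' :: "real ^ 'n"
      show "norm (x - x') \<le> 1 * (\<Sum>j\<in>UNIV. \<bar>x $ j - x' $ j\<bar>)"
        using norm_le_l1_cart[of "x - x'"] by simp
    qed auto
  qed auto
  moreover have "(\<Union>k::nat. S \<inter> {x. \<forall>j. \<bar>x $ j\<bar> \<le> real k}) = S"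
  proof -
    have "\<exists>k::nat. \<forall>j. \<bar>x $ j\<bar> \<le> real k" for x :: "real ^ 'n"
      using component_le_norm_cart[of x] real_arch_simple[of "norm x"] by (meson order_trans)
    then show ?thesis by auto
  qed
  ultimately show ?thesis by simp
qed

text \<open>The cone condition makes the set a Lipschitz graph over the hyperplane \<open>x\<^sub>k = 0\<close>, where \<open>k\<close>
  is a coordinate with \<open>\<bar>q\<^sub>k\<bar>\<close> maximal.\<close>

lemma hausdorff_dim_cone:
  fixes S :: "(real ^ 'n::finite) set"
  assumes "bounded S" and "q \<noteq> 0"
    and cone: "\<And>x x'. x \<in> S \<Longrightarrow> x' \<in> S \<Longrightarrow> q \<bullet> (x' - x) \<le> norm q / (2 * real CARD('n)) * norm (x' - x)"
  shows "hausdorff_dim S \<le> ereal (real CARD('n) - 1)"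
proof -
  obtain R where R: "\<And>x. x \<in> S \<Longrightarrow> norm x \<le> R" using \<open>bounded S\<close> by (auto simp: bounded_iff)
  define M where "M = Max (range (\<lambda>j. \<bar>q $ j\<bar>))"
  have "M \<in> range (\<lambda>j. \<bar>q $ j\<bar>)" unfolding M_def by (intro Max_in) auto
  then obtain k where "M = \<bar>q $ k\<bar>" by auto
  moreover have "\<bar>q $ j\<bar> \<le> M" for j unfolding M_def by (intro Max_ge) auto
  ultimately have k: "\<bar>q $ j\<bar> \<le> \<bar>q $ k\<bar>" for j by simp
  have nq: "norm q \<le> real CARD('n) * \<bar>q $ k\<bar>"
    using norm_le_l1_cart[of q] sum_bounded_above[of UNIV "\<lambda>j. \<bar>q $ j\<bar>" "\<bar>q $ k\<bar>"] k by simp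
  then have qk: "0 < \<bar>q $ k\<bar>" using \<open>q \<noteq> 0\<close> by (cases "q $ k = 0") auto
  have "hausdorff_dim S \<le> ereal (real (card (UNIV - {k})))"
  proof (rule hausdorff_dim_grid)
    show "\<bar>x $ j\<bar> \<le> R" if "x \<in> S" for x j
      using component_le_norm_cart[of x j] R[OF that] by linarith
    fix x x' assume xx: "x \<in> S" "x' \<in> S"
    define v where "v = x - x'"
    define A where "A = (\<Sum>j\<in>UNIV - {k}. \<bar>v $ j\<bar>)"
    \<comment> \<open>By the choice of \<open>k\<close> the cone constant is at most half of
      \<open>\<bar>q $ k\<bar>\<close>. The half matters: the term \<open>norm v / 2\<close> that it
      produces below is absorbed by \<open>norm v\<close>, which leaves \<open>4 * A\<close>. Using
      the cone condition for both orders of the points gives the absolute value.\<close>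
    have c0: "norm q / (2 * real CARD('n)) \<le> \<bar>q $ k\<bar> / 2" using nq by (simp add: field_simps)
    have "\<bar>q \<bullet> v\<bar> \<le> norm q / (2 * real CARD('n)) * norm v"
      using cone[OF xx] cone[OF xx(2,1)] by (simp add: v_def inner_diff_right norm_minus_commute abs_le_iff)
    also have "\<dots> \<le> \<bar>q $ k\<bar> / 2 * norm v" using c0 by (intro mult_right_mono) auto
    finally have ineq: "\<bar>q \<bullet> v\<bar> \<le> \<bar>q $ k\<bar> / 2 * norm v" .
    have "q \<bullet> v = q $ k * v $ k + (\<Sum>j\<in>UNIV - {k}. q $ j * v $ j)"
      by (simp add: inner_vec_def sum.remove[of UNIV k])
    moreover have "\<bar>\<Sum>j\<in>UNIV - {k}. q $ j * v $ j\<bar> \<le> \<bar>q $ k\<bar> * A"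
    proof -
      have "\<bar>\<Sum>j\<in>UNIV - {k}. q $ j * v $ j\<bar> \<le> (\<Sum>j\<in>UNIV - {k}. \<bar>q $ k\<bar> * \<bar>v $ j\<bar>)"
        by (intro order_trans[OF sum_abs] sum_mono) (auto simp: abs_mult intro!: mult_right_mono k)
      then show ?thesis by (simp add: A_def sum_distrib_left)
    qed
    ultimately have "\<bar>q $ k * v $ k\<bar> \<le> \<bar>q $ k\<bar> * A + \<bar>q $ k\<bar> / 2 * norm v"
      using ineq by linarith
    then have "\<bar>q $ k\<bar> * \<bar>v $ k\<bar> \<le> \<bar>q $ k\<bar> * (A + norm v / 2)"
      by (simp add: abs_mult algebra_simps)
    then have "\<bar>v $ k\<bar> \<le> A + norm v / 2" using qk by simp
    moreover have "norm v \<le> \<bar>v $ k\<bar> + A"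
      using norm_le_l1_cart[of v] by (simp add: A_def sum.remove[of UNIV k])
    ultimately show "norm (x - x') \<le> 4 * (\<Sum>j\<in>UNIV - {k}. \<bar>x $ j - x' $ j\<bar>)"
      by (simp add: v_def A_def)
  qed
  then show ?thesis by (simp add: card_Diff_singleton of_nat_diff)
qed

section \<open>Measure preserving maps between sets of equal mass\<close>

text \<open>An expansion in base 3 with digits 0 and 1 only, as for the Cantor set. The tail after
  any digit is at most half a unit of that digit, so the digits can be read off by a floor; base 2
  would identify different sequences.\<close>

definition code_bits :: "(nat \<Rightarrow> bool) \<Rightarrow> real" where
  "code_bits s = (\<Sum>k. of_bool (s k) / 3 ^ Suc k)"

definition bit_of :: "nat \<Rightarrow> real \<Rightarrow> bool" where
  "bit_of k t \<longleftrightarrow> \<lfloor>3 ^ Suc k * t\<rfloor> mod 3 = 1"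

lemma summable_code_bits: "summable (\<lambda>k. of_bool (s k) / 3 ^ Suc k :: real)"
proof (rule summable_comparison_test)
  show "\<exists>N. \<forall>k\<ge>N. norm (of_bool (s k) / 3 ^ Suc k :: real) \<le> (1/3) ^ k"
    by (intro exI[of _ 0]) (auto simp: power_divide field_simps)
qed (intro summable_geometric, simp)

lemma bit_of_code_bits: "bit_of k (code_bits s) \<longleftrightarrow> s k"
proof -
  let ?f = "\<lambda>k. of_bool (s k) / 3 ^ Suc k :: real"
  define N where "N = (\<Sum>i<k. of_bool (s i) * 3 ^ (k - Suc i) :: int)"
  define r where "r = (\<Sum>i. ?f (i + Suc k))"
  have split: "code_bits s = (\<Sum>i<Suc k. ?f i) + r"
    unfolding code_bits_def r_def using suminf_split_initial_segment[OF summable_code_bits, of s "Suc k"]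
    by simp
  have eq: "3 ^ Suc k * (\<Sum>i<Suc k. ?f i) = real_of_int (3 * N + of_bool (s k))"
  proof -
    have "3 ^ Suc k * ?f i = real_of_int (3 * (of_bool (s i) * 3 ^ (k - Suc i)))" if "i < k" for i
    proof -
      have "(3::real) ^ k = 3 ^ Suc i * 3 ^ (k - Suc i)"
        using that unfolding power_add[symmetric] by simp
      then show ?thesis by simp
    qed
    then have "3 ^ Suc k * (\<Sum>i<k. ?f i) = real_of_int (3 * N)"
      unfolding N_def sum_distrib_left of_int_sum by (intro sum.cong) auto
    then show ?thesis by (simp add: distrib_left)
  qed
  have sr: "summable (\<lambda>i. ?f (i + Suc k))" by (rule summable_ignore_initial_segment[OF summable_code_bits])
  have r0: "0 \<le> r" unfolding r_def by (intro suminf_nonneg[OF sr]) auto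
  have geo: "(\<lambda>i. (1/3) ^ i * (1 / (3 * 3 ^ Suc k)) :: real) sums (1 / (1 - 1/3) * (1 / (3 * 3 ^ Suc k)))"
    by (intro sums_mult2 geometric_sums) auto
  have "?f (i + Suc k) \<le> (1/3) ^ i * (1 / (3 * 3 ^ Suc k))" for i
  proof -
    have "?f (i + Suc k) \<le> 1 / 3 ^ Suc (i + Suc k)" by (intro divide_right_mono) auto
    also have "\<dots> = (1/3) ^ i * (1 / (3 * 3 ^ Suc k))" by (simp add: power_add power_divide)
    finally show ?thesis .
  qed
  from suminf_le[OF this sr sums_summable[OF geo]]
  have "r \<le> 1 / (1 - 1/3) * (1 / (3 * 3 ^ Suc k))"
    unfolding r_def sums_unique[OF geo, symmetric] .
  \<comment> \<open>A tail of ones amounts to one half after scaling; being below 1, it does not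
    disturb the floor.\<close>
  then have r1: "3 ^ Suc k * r \<le> 1/2" by (simp add: field_simps)
  have "3 ^ Suc k * code_bits s = real_of_int (3 * N + of_bool (s k)) + 3 ^ Suc k * r"
    unfolding split distrib_left eq ..
  moreover have "0 \<le> 3 ^ Suc k * r" using r0 by simp
  ultimately have "\<lfloor>3 ^ Suc k * code_bits s\<rfloor> = 3 * N + of_bool (s k)"
    using r1 by (intro floor_unique) auto
  then show ?thesis unfolding bit_of_def by (simp add: mod_eq_0_iff_dvd)
qed

lemma measurable_bit_of [measurable]: "Measurable.pred borel (bit_of k)"
  unfolding bit_of_def[abs_def] by measurable

text \<open>The bits record which points \<open>d j\<close> of a dense sequence lie within
  \<open>(1/2) ^ k\<close> of \<open>x\<close>. Decoding takes for each \<open>k\<close> the first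
  such point and passes to the limit. A Borel left inverse is all that is asked for; the range of
  \<open>code\<close> is never described.\<close>

lemma ex_Borel_code:
  "\<exists>(code :: 'a::{banach, second_countable_topology} \<Rightarrow> real) decode.
     code \<in> borel_measurable borel \<and> decode \<in> borel_measurable borel \<and> (\<forall>x. decode (code x) = x)"
proof -
  obtain D :: "'a set" where D: "countable D" "\<And>X. open X \<Longrightarrow> X \<noteq> {} \<Longrightarrow> \<exists>d\<in>D. d \<in> X"
    using countable_dense_setE by blast
  then have "D \<noteq> {}" by (metis open_UNIV UNIV_not_empty empty_iff)
  define d where "d = from_nat_into D"
  have d: "\<exists>j. dist x (d j) < e" if "0 < e" for x e
  proof -
    obtain y where "y \<in> D" "y \<in> ball x e" using D(2)[of "ball x e"] \<open>0 < e\<close> by auto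
    moreover obtain j where "d j = y"
      unfolding d_def using from_nat_into_surj[OF D(1) \<open>y \<in> D\<close>] by auto
    ultimately show ?thesis by auto
  qed
  define bits where "bits x m = (case prod_decode m of (j, k) \<Rightarrow> dist x (d j) < (1/2) ^ k)" for x :: 'a and m
  define code where "code x = code_bits (bits x)" for x
  define decode where "decode t = lim (\<lambda>k. d (LEAST j. bit_of (prod_encode (j, k)) t))" for t
  have "decode (code x) = x" for x
  proof -
    have b: "bit_of (prod_encode (j, k)) (code x) \<longleftrightarrow> dist x (d j) < (1/2) ^ k" for j k
      by (simp add: code_def bit_of_code_bits bits_def)
    define u where "u k = d (LEAST j. bit_of (prod_encode (j, k)) (code x))" for k
    have "dist x (u k) < (1/2) ^ k" for k
      unfolding u_def b using LeastI_ex[OF d[of "(1/2)^k" x]] by simp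
    then have "norm (dist (u k) x) \<le> (1/2) ^ k" for k by (simp add: dist_commute less_imp_le)
    then have "(\<lambda>k. dist (u k) x) \<longlonglongrightarrow> 0"
      by (rule Lim_null_comparison[OF always_eventually[OF allI]]) (intro LIMSEQ_power_zero, simp)
    then have "u \<longlonglongrightarrow> x" by (rule tendsto_dist_iff[THEN iffD2])
    then show ?thesis unfolding decode_def u_def[symmetric, abs_def] by (rule limI)
  qed
  moreover have "code \<in> borel_measurable borel"
  proof -
    have [measurable]: "Measurable.pred borel (\<lambda>x. bits x m)" for m
      unfolding bits_def by (cases "prod_decode m") simp
    have "(\<lambda>x. of_bool (bits x m) / 3 ^ Suc m :: real) \<in> borel_measurable borel" for m
      unfolding of_bool_def by measurable
    then show ?thesis unfolding code_def code_bits_def by (intro borel_measurable_suminf)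
  qed
  moreover have "decode \<in> borel_measurable borel"
  proof -
    have "(\<lambda>t. d (LEAST j. bit_of (prod_encode (j, k)) t)) \<in> borel_measurable borel" for k
      by measurable
    then show ?thesis unfolding decode_def by (intro borel_measurable_lim_metric)
  qed
  ultimately show ?thesis by blast
qed

section \<open>Rearrangement through distribution functions\<close>

text \<open>The probability integral transform: the distribution function carries an atomless law to
  the uniform law on the unit interval. Without atoms \<open>cdf M\<close> is continuous, so its
  sublevel set at \<open>u\<close> is a half-line at whose endpoint the value is exactly
  \<open>u\<close>.\<close>

lemma (in real_distribution) measure_cdf_le:
  assumes "\<And>t. measure M {t} = 0" and "0 \<le> u" "u \<le> 1"
  shows "measure M {t. cdf M t \<le> u} = u"
proof -
  have cont: "isCont (cdf M) t" for t using assms(1) isCont_cdf by blast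
  \<comment> \<open>At \<open>u = 1\<close> the sublevel set is the whole line and has no supremum;
    an empty one occurs only for \<open>u = 0\<close>.\<close>
  consider "u = 1" | "u < 1" "{t. cdf M t \<le> u} = {}" | "u < 1" "{t. cdf M t \<le> u} \<noteq> {}"
    using \<open>u \<le> 1\<close> by fastforce
  then show ?thesis
  proof cases
    case 1
    then have "{t. cdf M t \<le> u} = space M" using cdf_bounded_prob by auto
    then show ?thesis using 1 prob_space by simp
  next
    case 2
    have "u = 0"
    proof (rule ccontr)
      assume "u \<noteq> 0"
      then have "0 < u" using assms by simp
      then obtain t where "cdf M t < u"
        using order_tendstoD(2)[OF cdf_lim_at_bot, of u] eventually_happens'[OF trivial_limit_at_bot_linorder] by blast
      then show False using 2 by (auto dest: less_imp_le)
    qed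
    then show ?thesis using 2 by simp
  next
    case 3
    let ?A = "{t. cdf M t \<le> u}"
    obtain b where b: "u < cdf M b"
      using order_tendstoD(1)[OF cdf_lim_at_top_prob 3(1)] eventually_happens'[OF trivial_limit_at_top_linorder] by blast
    have bdd: "bdd_above ?A"
    proof (rule bdd_aboveI[of _ b])
      fix t assume "t \<in> ?A"
      then show "t \<le> b" using b cdf_nondecreasing[of b t] by (cases "b \<le> t") auto
    qed
    have "closed ?A" using cont by (intro closed_Collect_le continuous_at_imp_continuous_on) auto
    define s where "s = Sup ?A"
    have sA: "cdf M s \<le> u" using closed_contains_Sup[OF 3(2) bdd \<open>closed ?A\<close>] by (simp add: s_def)
    have A: "?A = {..s}"
      using cSup_upper[OF _ bdd] sA cdf_nondecreasing[of _ s] by (auto simp: s_def intro: order_trans)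
    have "cdf M s = u"
    proof (rule ccontr)
      assume "cdf M s \<noteq> u"
      then have "cdf M s < u" using sA by simp
      have "s \<le> b" using b sA cdf_nondecreasing[of b s] by (cases "s \<le> b") auto
      then obtain t where t: "s \<le> t" "t \<le> b" "cdf M t = u"
        using IVT[of "cdf M" s u b] \<open>cdf M s < u\<close> b cont by auto
      have "t \<in> {..s}" unfolding A[symmetric] using t(3) by simp
      then have "t = s" using t(1) by simp
      then show False using t(3) \<open>cdf M s < u\<close> by simp
    qed
    then show ?thesis unfolding A by (simp add: cdf_def2)
  qed
qed

text \<open>Monotone rearrangement: \<open>cdf M\<close> makes the law uniform, and the quantile
  function \<open>N.I\<close> of the target turns the uniform law into \<open>N\<close>. Atoms of
  \<open>N\<close> do no harm.\<close>

lemma distr_pseudoinverse_cdf: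
  fixes M N :: "real measure"
  assumes M: "real_distribution M" and N: "real_distribution N" and atomless: "\<And>t. measure M {t} = 0"
  shows "\<exists>K\<in>borel_measurable borel. distr M borel K = N"
proof -
  interpret M: cdf_distribution M using M by (simp add: cdf_distribution_def)
  interpret N: cdf_distribution N using N by (simp add: cdf_distribution_def)
  \<comment> \<open>The equivalence of \<open>N.I u \<le> s\<close> and
    \<open>u \<le> cdf N s\<close> is used for \<open>u\<close> strictly between 0 and 1. The
    default 0 is taken on a null set, as shown under \<open>ae\<close>.\<close>
  define K where "K t = (if cdf M t \<in> {0<..<1} then N.I (cdf M t) else 0)" for t
  have meas: "K \<in> borel_measurable borel"
  proof -
    have "(\<lambda>u. if u \<in> {0<..<1} then N.I u else 0) \<in> borel_measurable borel"
      using N.measurable_CI by (subst measurable_If_restrict_space_iff) (auto simp: greaterThanLessThan_def greaterThan_def lessThan_def Int_def)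
    then have "(\<lambda>u. if u \<in> {0<..<1} then N.I u else 0) \<circ> cdf M \<in> borel_measurable borel"
      by (intro measurable_comp[OF M.measurable_C])
    then show ?thesis by (simp add: comp_def K_def[abs_def])
  qed
  then have measM: "K \<in> borel_measurable M" by simp
  have "distr M borel K = N"
  proof (intro cdf_unique ext)
    show "real_distribution (distr M borel K)" using measM by (rule M.real_distribution_distr)
    fix s
    have ae: "AE t in M. cdf M t \<in> {0<..<1}"
    proof -
      have "measure M {t. cdf M t \<le> 0} = 0" using M.measure_cdf_le[OF atomless, of 0] by simp
      moreover have "measure M {t. 1 \<le> cdf M t} = 0"
      proof -
        have le: "measure M {t. 1 \<le> cdf M t} \<le> e" if e: "0 < e" "e < 1" for e
        proof -
          have "measure M {t. 1 \<le> cdf M t} \<le> measure M (space M - {t. cdf M t \<le> 1 - e})"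
            using e by (intro M.finite_measure_mono) auto
          also have "\<dots> = 1 - measure M {t. cdf M t \<le> 1 - e}"
            by (intro M.prob_compl) auto
          also have "\<dots> = e" using e M.measure_cdf_le[OF atomless, of "1 - e"] by simp
          finally show ?thesis .
        qed
        show ?thesis
        proof (rule ccontr)
          define a where "a = measure M {t. 1 \<le> cdf M t}"
          assume "measure M {t. 1 \<le> cdf M t} \<noteq> 0"
          then have "0 < a" by (simp add: a_def zero_less_measure_iff)
          moreover have "a \<le> 1" by (simp add: a_def)
          moreover have "a \<le> a / 2" using le[of "a / 2"] \<open>0 < a\<close> \<open>a \<le> 1\<close> unfolding a_def[symmetric] by simp
          ultimately show False by simp
        qed
      qed
      ultimately have "AE t in M. \<not> cdf M t \<le> 0" "AE t in M. \<not> 1 \<le> cdf M t"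
        by (auto simp: AE_iff_measurable[OF _ refl] M.emeasure_eq_measure)
      then show ?thesis by eventually_elim auto
    qed
    have "cdf (distr M borel K) s = measure M {t. K t \<le> s}"
      by (simp add: cdf_def measure_distr[OF measM] vimage_def)
    also have "\<dots> = measure M {t. cdf M t \<le> cdf N s}"
    proof (rule M.finite_measure_eq_AE)
      show "AE t in M. (t \<in> {t. K t \<le> s}) = (t \<in> {t. cdf M t \<le> cdf N s})"
        using ae by eventually_elim (simp add: K_def N.pseudoinverse[symmetric])
      have "{t \<in> space M. K t \<le> s} \<in> sets M" using measM by measurable
      then show "{t. K t \<le> s} \<in> sets M" by simp
      have "{t \<in> space M. cdf M t \<le> cdf N s} \<in> sets M" by measurable
      then show "{t. cdf M t \<le> cdf N s} \<in> sets M" by simp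
    qed
    also have "\<dots> = cdf N s" using N.cdf_bounded_prob N.cdf_nonneg by (intro M.measure_cdf_le atomless)
    finally show "cdf (distr M borel K) s = cdf N s" .
  qed (rule N)
  then show ?thesis using meas by blast
qed

text \<open>The normalised restrictions to \<open>A\<close> and \<open>B\<close> are transported to
  the line by \<open>f\<close> and \<open>g\<close>. There monotone rearrangement links them, and
  the decoder \<open>p\<close> brings the result back to \<open>B\<close>. Atoms matter only on the
  source side \<open>A\<close>.\<close>

lemma (in finite_measure) ex_measure_preserving:
  fixes f g :: "'a \<Rightarrow> real"
  assumes A: "A \<in> sets M" and B: "B \<in> sets M" and AB: "measure M A = measure M B" "0 < measure M A"
    and f [measurable]: "f \<in> borel_measurable M" and atomless: "\<And>t. measure M {x \<in> A. f x = t} = 0"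
    and g [measurable]: "g \<in> borel_measurable M" and p: "p \<in> measurable borel M"
    and pg: "\<And>x. x \<in> B \<Longrightarrow> p (g x) = x"
  shows "\<exists>\<phi>\<in>measurable M M. (\<forall>x. \<phi> x \<in> B) \<and>
    (\<forall>C\<in>sets M. emeasure M {x \<in> A. \<phi> x \<in> C} = emeasure M (B \<inter> C))"
proof -
  note [measurable] = A B p
  have AB': "emeasure M A \<noteq> 0" "emeasure M B \<noteq> 0" "emeasure M A = emeasure M B"
    using AB by (auto simp: emeasure_eq_measure)
  interpret UA: prob_space "uniform_measure M A"
    using AB' by (intro prob_space_uniform_measure) (auto simp: less_top[symmetric])
  interpret UB: prob_space "uniform_measure M B"
    using AB' by (intro prob_space_uniform_measure) (auto simp: less_top[symmetric])
  let ?MA = "distr (uniform_measure M A) borel f" and ?MB = "distr (uniform_measure M B) borel g"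
  have MA: "real_distribution ?MA" by (intro UA.real_distribution_distr) simp
  have MB: "real_distribution ?MB" by (intro UB.real_distribution_distr) simp
  have "measure ?MA {t} = 0" for t
  proof -
    have "emeasure M (A \<inter> (f -` {t} \<inter> space M)) = emeasure M {x \<in> A. f x = t}"
      using sets.sets_into_space[OF A] by (intro arg_cong[where f="emeasure M"]) auto
    also have "\<dots> = 0" using atomless[of t] by (simp add: emeasure_eq_measure)
    finally have "emeasure ?MA {t} = 0" by (simp add: emeasure_distr)
    then show ?thesis by (simp add: measure_def)
  qed
  then obtain K where K [measurable]: "K \<in> borel_measurable borel" and dK: "distr ?MA borel K = ?MB"
    using distr_pseudoinverse_cdf[OF MA MB] by blast
  define \<psi> where "\<psi> x = p (K (f x))" for x
  have psi [measurable]: "\<psi> \<in> measurable M M" unfolding \<psi>_def by measurable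
  have pres: "emeasure M {x \<in> A. \<psi> x \<in> C} = emeasure M (B \<inter> C)" if C [measurable]: "C \<in> sets M" for C
  proof -
    have pC [measurable]: "p -` C \<in> sets borel" using measurable_sets[OF p C] by simp
    have "emeasure (distr ?MA borel K) (p -` C) = emeasure (uniform_measure M A) {x \<in> space M. \<psi> x \<in> C}"
      by (simp add: emeasure_distr vimage_def Int_def \<psi>_def conj_commute)
    also have "\<dots> = emeasure M (A \<inter> {x \<in> space M. \<psi> x \<in> C}) / emeasure M A"
      by (intro emeasure_uniform_measure) auto
    also have "A \<inter> {x \<in> space M. \<psi> x \<in> C} = {x \<in> A. \<psi> x \<in> C}" using sets.sets_into_space[OF A] by auto
    finally have 1: "emeasure (distr ?MA borel K) (p -` C) = emeasure M {x \<in> A. \<psi> x \<in> C} / emeasure M A" .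
    have "emeasure ?MB (p -` C) = emeasure (uniform_measure M B) {x \<in> space M. p (g x) \<in> C}"
      by (simp add: emeasure_distr vimage_def Int_def conj_commute)
    also have "\<dots> = emeasure M (B \<inter> {x \<in> space M. p (g x) \<in> C}) / emeasure M B"
      by (intro emeasure_uniform_measure) (auto intro!: measurable_sets_Collect[OF measurable_compose[OF g p]])
    also have "B \<inter> {x \<in> space M. p (g x) \<in> C} = B \<inter> C" using sets.sets_into_space[OF B] pg by auto
    finally have "emeasure ?MB (p -` C) = emeasure M (B \<inter> C) / emeasure M B" .
    then have "emeasure M {x \<in> A. \<psi> x \<in> C} / emeasure M A = emeasure M (B \<inter> C) / emeasure M A"
      using 1 dK AB' by simp
    then show ?thesis
      using AB(2) by (simp add: emeasure_eq_measure divide_ennreal)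
  qed
  \<comment> \<open>So far \<open>\<psi>\<close> lands in \<open>B\<close> only almost everywhere.
    Sending the exceptional points to a fixed point of \<open>B\<close> makes this hold everywhere,
    so that the later comparison of surpluses can be pointwise.\<close>
  obtain b where b: "b \<in> B" using AB'(2) by fastforce
  define \<phi> where "\<phi> x = (if \<psi> x \<in> B then \<psi> x else b)" for x
  have "b \<in> space M" using b sets.sets_into_space[OF B] by auto
  then have "\<phi> \<in> measurable M M" unfolding \<phi>_def by measurable
  moreover have "\<phi> x \<in> B" for x using b by (simp add: \<phi>_def)
  moreover have "emeasure M {x \<in> A. \<phi> x \<in> C} = emeasure M (B \<inter> C)" if C [measurable]: "C \<in> sets M" for C
  proof -
    have AI: "{x \<in> A. P x} = {x \<in> space M. x \<in> A \<and> P x}" for P using sets.sets_into_space[OF A] by auto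
    have "measure M {x \<in> A. \<psi> x \<in> B} = measure M A"
      using pres[OF B] AB by (simp add: emeasure_eq_measure)
    then have "measure M (A - {x \<in> A. \<psi> x \<in> B}) = 0"
      by (subst finite_measure_Diff) (auto simp: AI)
    then have "AE x in M. x \<notin> A - {x \<in> A. \<psi> x \<in> B}"
      by (subst AE_iff_measurable[OF _ refl])
        (auto simp: emeasure_eq_measure AI Diff_eq Int_def intro!: arg_cong[where f="measure M"] elim: back_subst)
    then have "emeasure M {x \<in> A. \<phi> x \<in> C} = emeasure M {x \<in> A. \<psi> x \<in> C}"
    proof (intro emeasure_eq_AE)
      have [measurable]: "\<phi> \<in> measurable M M" by fact
      show "{x \<in> A. \<phi> x \<in> C} \<in> sets M" "{x \<in> A. \<psi> x \<in> C} \<in> sets M" unfolding AI by measurable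
    qed (auto simp: \<phi>_def elim!: eventually_mono)
    then show ?thesis using pres[OF C] by simp
  qed
  ultimately show ?thesis by blast
qed

text \<open>Cutting \<open>A\<close> at a level of the distribution function of \<open>f\<close>
  yields any prescribed fraction of its mass. This trims two sets of positive mass to equal
  mass.\<close>

lemma (in finite_measure) ex_subset_of_measure:
  fixes f :: "'a \<Rightarrow> real"
  assumes A [measurable]: "A \<in> sets M" and m: "0 \<le> m" "m \<le> measure M A"
    and f [measurable]: "f \<in> borel_measurable M" and atomless: "\<And>t. measure M {x \<in> A. f x = t} = 0"
  shows "\<exists>A'\<in>sets M. A' \<subseteq> A \<and> measure M A' = m"
proof (cases "measure M A = 0")
  case True
  then show ?thesis using m by (intro bexI[of _ "{}"]) auto
next
  case False
  then have AB': "emeasure M A \<noteq> 0" "0 < measure M A" by (auto simp: emeasure_eq_measure zero_less_measure_iff)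
  interpret UA: prob_space "uniform_measure M A"
    using AB' by (intro prob_space_uniform_measure) (auto simp: less_top[symmetric])
  let ?MA = "distr (uniform_measure M A) borel f"
  have MA: "real_distribution ?MA" by (intro UA.real_distribution_distr) simp
  interpret MA: cdf_distribution ?MA using MA by (simp add: cdf_distribution_def)
  have AI: "{x \<in> A. P x} = A \<inter> {x \<in> space M. P x}" for P using sets.sets_into_space[OF A] by auto
  have meas: "measure ?MA {t. P t} = measure M {x \<in> A. P (f x)} / measure M A" if P [measurable]: "Measurable.pred borel P" for P
  proof -
    have "measure ?MA {t. P t} = measure (uniform_measure M A) {x \<in> space M. P (f x)}"
      by (simp add: measure_distr vimage_def Int_def conj_commute)
    also have "\<dots> = measure M (A \<inter> {x \<in> space M. P (f x)}) / measure M A"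
      using AB' by (intro measure_uniform_measure) auto
    finally show ?thesis by (simp only: AI)
  qed
  have "measure ?MA {t} = 0" for t
    using meas[of "\<lambda>x. x = t"] atomless[of t] by simp
  then have "measure ?MA {t. cdf ?MA t \<le> m / measure M A} = m / measure M A"
    using m AB' by (intro MA.measure_cdf_le) auto
  then have "measure M {x \<in> A. cdf ?MA (f x) \<le> m / measure M A} = m"
    using AB' by (subst (asm) meas) auto
  then show ?thesis by (intro bexI[of _ "{x \<in> A. cdf ?MA (f x) \<le> m / measure M A}"]) (auto simp: AI)
qed

section \<open>Second-order estimates\<close>

text \<open>Names for the witnesses hidden in \<open>Ck_on 2\<close>: \<open>f1 x v\<close> is the
  derivative in the direction \<open>v\<close>, and \<open>f2 v x w\<close> differentiates
  \<open>\<lambda>x. f1 x v\<close> in the direction \<open>w\<close>. At points of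
  \<open>T - S\<close> only continuity is recorded, for each direction separately; linearity in the
  direction is derived on \<open>S\<close>.\<close>

locale C2_function =
  fixes f :: "'a::euclidean_space \<Rightarrow> real" and S T :: "'a set"
    and f1 :: "'a \<Rightarrow> 'a \<Rightarrow> real" and f2 :: "'a \<Rightarrow> 'a \<Rightarrow> 'a \<Rightarrow> real"
  assumes S_T: "S \<subseteq> T"
    and cont: "continuous_on T f"
    and deriv: "\<And>x. x \<in> S \<Longrightarrow> (f has_derivative f1 x) (at x)"
    and cont1: "\<And>v. continuous_on T (\<lambda>x. f1 x v)"
    and deriv1: "\<And>x v. x \<in> S \<Longrightarrow> ((\<lambda>x. f1 x v) has_derivative f2 v x) (at x)"
    and cont2: "\<And>v w. continuous_on T (\<lambda>x. f2 v x w)"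

lemma Ck_on_2_imp_C2_function:
  fixes f :: "'a::euclidean_space \<Rightarrow> real"
  assumes "Ck_on 2 f S T" and "S \<subseteq> T"
  obtains f1 f2 where "C2_function f S T f1 f2"
proof -
  obtain f1 where f1: "continuous_on T f" "\<And>x. x \<in> S \<Longrightarrow> (f has_derivative f1 x) (at x)"
     "\<And>v. Ck_on 1 (\<lambda>x. f1 x v) S T"
    using assms(1) by (auto simp: numeral_2_eq_2)
  have "\<exists>g. (\<forall>x\<in>S. ((\<lambda>x. f1 x v) has_derivative g x) (at x)) \<and> (\<forall>w. continuous_on T (\<lambda>x. g x w))" for v
    using f1(3)[of v] by auto
  then obtain f2 where "\<And>v x. x \<in> S \<Longrightarrow> ((\<lambda>x. f1 x v) has_derivative f2 v x) (at x)"
     "\<And>v w. continuous_on T (\<lambda>x. f2 v x w)" by metis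
  moreover have "continuous_on T (\<lambda>x. f1 x v)" for v using f1(3)[of v] by auto
  ultimately have "C2_function f S T f1 f2" using f1(1,2) assms(2) by unfold_locales
  then show ?thesis by (rule that)
qed

context C2_function
begin

lemma linear1: "x \<in> S \<Longrightarrow> linear (f1 x)"
  using deriv has_derivative_linear by blast

lemma linear2: "x \<in> S \<Longrightarrow> linear (f2 v x)"
  using deriv1 has_derivative_linear by blast

text \<open>The base point may be a boundary point in \<open>T - S\<close>: the second derivatives
  are bounded near it by continuity, while the mean value theorem runs along segments inside
  \<open>S\<close>. Bounds in the finitely many basis directions control the linear map
  \<open>f2 v x\<close>.\<close>

lemma gradient_Lipschitz_basis:
  assumes "p0 \<in> T"
  shows "\<exists>r>0. \<exists>C\<ge>0. \<forall>p q. closed_segment p q \<subseteq> S \<inter> ball p0 r \<longrightarrow> \<bar>f1 p v - f1 q v\<bar> \<le> C * norm (p - q)"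
proof -
  have "\<exists>r>0. \<forall>x\<in>T \<inter> ball p0 r. \<bar>f2 v x j\<bar> \<le> \<bar>f2 v p0 j\<bar> + 1" for j
  proof -
    obtain r where "0 < r" "\<And>x. x \<in> T \<Longrightarrow> dist x p0 < r \<Longrightarrow> dist (f2 v x j) (f2 v p0 j) < 1"
      using cont2[of v j] assms unfolding continuous_on_iff by (metis zero_less_one)
    then show ?thesis by (intro exI[of _ r]) (force simp: dist_real_def dist_commute)
  qed
  then obtain r where r: "\<And>j. 0 < r j" "\<And>j x. x \<in> T \<Longrightarrow> dist p0 x < r j \<Longrightarrow> \<bar>f2 v x j\<bar> \<le> \<bar>f2 v p0 j\<bar> + 1"
    by (metis IntI mem_ball)
  define R where "R = Min (r ` Basis)"
  define C where "C = (\<Sum>j\<in>Basis. \<bar>f2 v p0 j\<bar> + 1)"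
  have "0 < R" unfolding R_def using r(1) by (subst Min_gr_iff) auto
  have "0 \<le> C" unfolding C_def by (intro sum_nonneg) auto
  have bound: "\<bar>f2 v x w\<bar> \<le> C * norm w" if "x \<in> S" "dist p0 x < R" for x w
  proof -
    have "f2 v x w = (\<Sum>j\<in>Basis. (w \<bullet> j) * f2 v x j)"
      using linear2[OF that(1), of v] by (subst euclidean_representation[symmetric, of w])
        (simp only: linear_sum linear_scale real_scaleR_def)
    also have "\<bar>\<dots>\<bar> \<le> (\<Sum>j\<in>Basis. norm w * (\<bar>f2 v p0 j\<bar> + 1))"
    proof (intro order_trans[OF sum_abs] sum_mono)
      fix j :: 'a assume "j \<in> Basis"
      then have "dist p0 x < r j" using that(2) unfolding R_def by auto
      then have "\<bar>f2 v x j\<bar> \<le> \<bar>f2 v p0 j\<bar> + 1" using r(2) S_T that(1) by auto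
      then show "\<bar>(w \<bullet> j) * f2 v x j\<bar> \<le> norm w * (\<bar>f2 v p0 j\<bar> + 1)"
        using Basis_le_norm[OF \<open>j \<in> Basis\<close>, of w] by (auto simp: abs_mult intro!: mult_mono)
    qed
    also have "\<dots> = C * norm w" by (simp add: C_def sum_distrib_left mult.commute)
    finally show ?thesis .
  qed
  have "\<bar>f1 p v - f1 q v\<bar> \<le> C * norm (p - q)" if seg: "closed_segment p q \<subseteq> S \<inter> ball p0 R" for p q
  proof -
    have "norm (f1 p v - f1 q v) \<le> C * norm (p - q)"
    proof (rule differentiable_bound[OF convex_closed_segment[of p q]])
      fix x assume "x \<in> closed_segment p q"
      then have x: "x \<in> S" "dist p0 x < R" using seg by auto
      show "((\<lambda>x. f1 x v) has_derivative f2 v x) (at x within closed_segment p q)"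
        using deriv1[OF x(1)] has_derivative_at_withinI by blast
      show "onorm (f2 v x) \<le> C" using bound[OF x] \<open>0 \<le> C\<close> by (intro onorm_bound) auto
    qed auto
    then show ?thesis by simp
  qed
  then show ?thesis using \<open>0 < R\<close> \<open>0 \<le> C\<close> by blast
qed

lemma gradient_Lipschitz:
  assumes "p0 \<in> T"
  shows "\<exists>r>0. \<exists>C>0. \<forall>p q v. closed_segment p q \<subseteq> S \<inter> ball p0 r \<longrightarrow>
     \<bar>f1 p v - f1 q v\<bar> \<le> C * norm v * norm (p - q)"
proof -
  obtain r C where rC: "\<And>j. 0 < r j" "\<And>j. 0 \<le> C j"
     "\<And>j p q. closed_segment p q \<subseteq> S \<inter> ball p0 (r j) \<Longrightarrow> \<bar>f1 p j - f1 q j\<bar> \<le> C j * norm (p - q)"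
    using gradient_Lipschitz_basis[OF assms] by metis
  define R where "R = Min (r ` Basis)"
  define K where "K = (\<Sum>j\<in>Basis. C j) + 1"
  have "0 < R" unfolding R_def using rC(1) by (subst Min_gr_iff) auto
  have "0 < K" unfolding K_def using rC(2) by (intro add_nonneg_pos sum_nonneg) auto
  have "\<bar>f1 p v - f1 q v\<bar> \<le> K * norm v * norm (p - q)" if seg: "closed_segment p q \<subseteq> S \<inter> ball p0 R" for p q v
  proof -
    have pq: "p \<in> S" "q \<in> S" using seg by auto
    have rep: "f1 x v = (\<Sum>j\<in>Basis. (v \<bullet> j) * f1 x j)" if "x \<in> S" for x
      using linear1[OF that] by (subst euclidean_representation[symmetric, of v])
        (simp only: linear_sum linear_scale real_scaleR_def)
    have "f1 p v - f1 q v = (\<Sum>j\<in>Basis. (v \<bullet> j) * (f1 p j - f1 q j))"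
      by (simp add: rep pq right_diff_distrib sum_subtractf)
    also have "\<bar>\<dots>\<bar> \<le> (\<Sum>j\<in>Basis. norm v * (C j * norm (p - q)))"
    proof (intro order_trans[OF sum_abs] sum_mono)
      fix j :: 'a assume j: "j \<in> Basis"
      then have "R \<le> r j" unfolding R_def by auto
      then have "closed_segment p q \<subseteq> S \<inter> ball p0 (r j)" using seg by auto
      then show "\<bar>(v \<bullet> j) * (f1 p j - f1 q j)\<bar> \<le> norm v * (C j * norm (p - q))"
        using Basis_le_norm[OF j, of v] rC(3) by (auto simp: abs_mult intro!: mult_mono)
    qed
    also have "\<dots> = (\<Sum>j\<in>Basis. C j) * (norm v * norm (p - q))"
      by (simp add: sum_distrib_right sum_distrib_left mult_ac)
    also have "\<dots> \<le> K * (norm v * norm (p - q))" unfolding K_def by (intro mult_right_mono) auto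
    finally show ?thesis by (simp add: mult_ac)
  qed
  then show ?thesis using \<open>0 < R\<close> \<open>0 < K\<close> by blast
qed

lemma Taylor_bound:
  assumes lip: "\<And>p q v. closed_segment p q \<subseteq> S \<inter> ball p0 r \<Longrightarrow> \<bar>f1 p v - f1 q v\<bar> \<le> C * norm v * norm (p - q)"
    and "0 \<le> C" and seg: "closed_segment p q \<subseteq> S \<inter> ball p0 r"
  shows "\<bar>f q - f p - f1 p (q - p)\<bar> \<le> C * (norm (q - p))\<^sup>2"
proof -
  have "norm (f q - f p - f1 p (q - p)) \<le> norm (q - p) * (C * norm (q - p))"
  proof (rule differentiable_bound_linearization[where S="closed_segment p q" and f'=f1])
    show "p + t *\<^sub>R (q - p) \<in> closed_segment p q" if "t \<in> {0..1}" for t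
      using that by (auto simp: in_segment algebra_simps intro!: exI[of _ t])
    fix x assume x: "x \<in> closed_segment p q"
    then have "x \<in> S" using seg by auto
    then show "(f has_derivative f1 x) (at x within closed_segment p q)"
      using deriv has_derivative_at_withinI by blast
    have "closed_segment x p \<subseteq> S \<inter> ball p0 r"
      using x seg by (metis closed_segment_subset convex_closed_segment ends_in_segment(1) order_trans)
    then have "norm (f1 x v - f1 p v) \<le> C * norm (q - p) * norm v" for v
    proof -
      have "\<bar>f1 x v - f1 p v\<bar> \<le> C * norm v * norm (x - p)" using lip \<open>closed_segment x p \<subseteq> _\<close> by blast
      also have "\<dots> \<le> C * norm v * norm (q - p)"
        using segment_bound1[OF x] \<open>0 \<le> C\<close> by (intro mult_left_mono) auto
      finally show ?thesis by (simp add: mult_ac)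
    qed
    then show "onorm (f1 x - f1 p) \<le> C * norm (q - p)"
      using \<open>0 \<le> C\<close> by (intro onorm_bound) auto
  qed auto
  then show ?thesis by (simp add: power2_eq_square mult_ac)
qed

end

lemma closed_segment_Pair_fst: "closed_segment (a, b) (a', b) = (\<lambda>u. (u, b)) ` closed_segment a a'"
  by (auto simp: in_segment image_iff algebra_simps simp flip: scaleR_left_distrib)

lemma closed_segment_Pair_snd: "closed_segment (a, b) (a, b') = (\<lambda>w. (a, w)) ` closed_segment b b'"
  by (auto simp: in_segment image_iff algebra_simps simp flip: scaleR_left_distrib)

text \<open>As a function of \<open>u\<close>, the increment \<open>f (u, w) - f (u, w')\<close> has
  a derivative of size at most \<open>C * norm (w - w')\<close> by the Lipschitz bound on the
  gradient; the mean value theorem in \<open>u\<close> then gives the product.\<close>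

lemma mixed_difference_bound:
  fixes f :: "'a::euclidean_space \<times> 'b::euclidean_space \<Rightarrow> real"
  assumes C2: "C2_function f S T f1 f2"
    and lip: "\<And>p q v. closed_segment p q \<subseteq> S \<inter> ball p0 r \<Longrightarrow> \<bar>f1 p v - f1 q v\<bar> \<le> C * norm v * norm (p - q)"
    and "0 \<le> C" and conv: "convex U" "convex W" and UW: "U \<times> W \<subseteq> S \<inter> ball p0 r"
    and u: "u \<in> U" "u' \<in> U" and w: "w \<in> W" "w' \<in> W"
  shows "\<bar>f (u, w) - f (u, w') - (f (u', w) - f (u', w'))\<bar> \<le> C * norm (u - u') * norm (w - w')"
proof -
  interpret C2_function f S T f1 f2 by (rule C2)
  have "norm ((f (u, w) - f (u, w')) - (f (u', w) - f (u', w'))) \<le> (C * norm (w - w')) * norm (u - u')"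
  proof (rule differentiable_bound[OF conv(1) _ _ u, where f="\<lambda>u. f (u, w) - f (u, w')"
      and f'="\<lambda>u \<delta>. f1 (u, w) (\<delta>, 0) - f1 (u, w') (\<delta>, 0)"])
    fix x assume x: "x \<in> U"
    have d: "((\<lambda>u. f (u, v)) has_derivative (\<lambda>\<delta>. f1 (x, v) (\<delta>, 0))) (at x within U)" if "v \<in> W" for v
    proof -
      have "(x, v) \<in> S" using x that UW by auto
      then have "((f \<circ> (\<lambda>u. (u, v))) has_derivative f1 (x, v) \<circ> (\<lambda>\<delta>. (\<delta>, 0))) (at x within U)"
        by (intro diff_chain_within has_derivative_at_withinI[OF deriv] derivative_intros)
      then show ?thesis by (simp add: comp_def)
    qed
    show "((\<lambda>u. f (u, w) - f (u, w')) has_derivative (\<lambda>\<delta>. f1 (x, w) (\<delta>, 0) - f1 (x, w') (\<delta>, 0))) (at x within U)"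
      using d[OF w(1)] d[OF w(2)] by (rule has_derivative_diff)
    have "closed_segment w w' \<subseteq> W" using conv(2) w by (simp add: closed_segment_subset)
    then have "closed_segment (x, w) (x, w') \<subseteq> S \<inter> ball p0 r"
      using UW x unfolding closed_segment_Pair_snd by auto
    then have "\<bar>f1 (x, w) (\<delta>, 0) - f1 (x, w') (\<delta>, 0)\<bar> \<le> C * norm (w - w') * norm \<delta>" for \<delta>
      using lip[of "(x, w)" "(x, w')" "(\<delta>, 0)"] by (simp add: norm_Pair mult_ac)
    then show "onorm (\<lambda>\<delta>. f1 (x, w) (\<delta>, 0) - f1 (x, w') (\<delta>, 0)) \<le> C * norm (w - w')"
      using \<open>0 \<le> C\<close> by (intro onorm_bound) auto
  qed
  then show ?thesis by (simp add: mult_ac)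
qed

lemma linear_Pair_axis:
  fixes l :: "(real ^ 'n::finite) \<times> (real ^ 'n) \<Rightarrow> real"
  assumes "linear l"
  shows "l (\<delta>, 0) = (\<Sum>i\<in>UNIV. \<delta> $ i * l (axis i 1, 0))" and "l (0, \<delta>) = (\<Sum>i\<in>UNIV. \<delta> $ i * l (0, axis i 1))"
proof -
  have eq: "(\<delta>, 0) = (\<Sum>i\<in>UNIV. \<delta> $ i *\<^sub>R (axis i 1 :: real ^ 'n, 0 :: real ^ 'n))"
    "(0, \<delta>) = (\<Sum>i\<in>UNIV. \<delta> $ i *\<^sub>R (0 :: real ^ 'n, axis i 1 :: real ^ 'n))"
    by (simp_all add: prod_eq_iff fst_sum snd_sum vec_eq_iff sum_component axis_def if_distrib cong: if_cong)
  show "l (\<delta>, 0) = (\<Sum>i\<in>UNIV. \<delta> $ i * l (axis i 1, 0))" "l (0, \<delta>) = (\<Sum>i\<in>UNIV. \<delta> $ i * l (0, axis i 1))"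
    unfolding eq using assms by (simp_all only: linear_sum linear_scale real_scaleR_def)
qed

lemma dist_Pair_less:
  assumes "dist u0 u < r / 2" "dist w0 w < r / 2" shows "dist (u0, w0) (u, w) < r"
proof -
  have "dist (u0, w0) (u, w) \<le> dist u0 u + dist w0 w"
    unfolding dist_Pair_Pair by (rule sqrt_sum_squares_le_sum) auto
  then show ?thesis using assms by simp
qed

section \<open>Quantitative use of non-degeneracy\<close>

lemma nondegenerate_gradient_bound:
  fixes f :: "(real ^ 'n::finite) \<times> (real ^ 'n) \<Rightarrow> real"
  assumes C2: "C2_function f S T f1 f2" and p0: "(u0, w0) \<in> S" and "open S"
    and inv: "invertible (\<chi> i j. f2 (0, axis j 1) (u0, w0) (axis i 1, 0))"
  shows "\<exists>r>0. \<exists>c>0. ball u0 r \<times> ball w0 r \<subseteq> S \<and> (\<forall>u\<in>ball u0 r. \<forall>u'\<in>ball u0 r. \<forall>w\<in>ball w0 r.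
     c * norm (u - u') \<le> norm ((\<chi> j. f1 (u, w) (0, axis j 1)) - (\<chi> j. f1 (u', w) (0, axis j 1))))"
proof -
  interpret C2_function f S T f1 f2 by (rule C2)
  define a where "a i j p = f2 (0, axis j 1) p (axis i 1, 0)" for i j :: 'n and p
  define A where "A p \<delta> = (\<chi> j. f2 (0, axis j 1) p (\<delta>, 0))" for p and \<delta> :: "real ^ 'n"
  have A: "A p \<delta> = (\<chi> j. \<Sum>i\<in>UNIV. \<delta> $ i * a i j p)" if "p \<in> S" for p \<delta>
    unfolding A_def a_def by (simp only: vec_eq_iff vec_lambda_beta, intro allI, rule linear_Pair_axis(1)[OF linear2[OF that]])
  define M where "M = (\<chi> i j. a i j (u0, w0))"
  \<comment> \<open>\<open>\<delta>\<close> is paired with the first index of \<open>M\<close>,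
    hence the transpose.\<close>
  have AM: "A (u0, w0) = (*v) (transpose M)"
    by (simp add: fun_eq_iff A[OF p0] M_def matrix_vector_mult_def transpose_def vec_eq_iff mult.commute)
  have "invertible (transpose M)" using inv unfolding M_def a_def by (simp add: invertible_det_nz)
  then have "inj ((*v) (transpose M))"
    by (simp add: inj_matrix_vector_mult)
  then obtain B where B: "0 < B" "\<And>\<delta>. B * norm \<delta> \<le> norm (A (u0, w0) \<delta>)"
    unfolding AM using linear_inj_bounded_below_pos[OF matrix_vector_mul_linear] by blast
  define n where "n = real CARD('n)"
  have n: "0 < n" by (simp add: n_def)
  \<comment> \<open>An entrywise error \<open>\<epsilon>\<close> costs one factor \<open>n\<close>
    for the sum within a component and another for the sum over the components; the total is
    \<open>B / 2\<close>.\<close>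
  define \<epsilon> where "\<epsilon> = B / (2 * n * n)"
  have e: "0 < \<epsilon>" using B n by (simp add: \<epsilon>_def)
  have "\<exists>r>0. \<forall>p\<in>S. dist p (u0, w0) < r \<longrightarrow> \<bar>a i j p - a i j (u0, w0)\<bar> < \<epsilon>" for i j
    using continuous_on_subset[OF cont2 S_T, of "(0, axis j 1)" "(axis i 1, 0)"] p0 e
    unfolding continuous_on_iff dist_real_def a_def by blast
  then obtain r where r: "\<And>i j. 0 < r i j" "\<And>i j p. p \<in> S \<Longrightarrow> dist p (u0, w0) < r i j \<Longrightarrow> \<bar>a i j p - a i j (u0, w0)\<bar> < \<epsilon>"
    by metis
  define R1 where "R1 = Min (range (\<lambda>(i, j). r i j))"
  have R1: "0 < R1" "R1 \<le> r i j" for i j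
    unfolding R1_def using r(1) by (auto simp: Min_gr_iff intro!: Min_le)
  obtain R2 where R2: "0 < R2" "ball (u0, w0) R2 \<subseteq> S" using \<open>open S\<close> p0 open_contains_ball by blast
  define R where "R = min R1 R2 / 2"
  have "0 < R" using R1 R2 by (simp add: R_def)
  have near: "dist (u, w) (u0, w0) < min R1 R2" if "u \<in> ball u0 R" "w \<in> ball w0 R" for u w
    using dist_Pair_less[of u0 u "min R1 R2" w0 w] that by (simp add: R_def dist_commute)
  have sub: "ball u0 R \<times> ball w0 R \<subseteq> S"
  proof
    fix p assume "p \<in> ball u0 R \<times> ball w0 R"
    then obtain u w where p: "p = (u, w)" "u \<in> ball u0 R" "w \<in> ball w0 R" by auto
    then show "p \<in> S" using near[OF p(2,3)] R2(2) by (auto simp: dist_commute subset_iff)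
  qed
  have Abound: "norm (A p \<delta> - A (u0, w0) \<delta>) \<le> B / 2 * norm \<delta>" if p: "p \<in> S" "dist p (u0, w0) < R1" for p \<delta>
  proof -
    have "norm (A p \<delta> - A (u0, w0) \<delta>) \<le> (\<Sum>j\<in>UNIV. \<bar>(A p \<delta> - A (u0, w0) \<delta>) $ j\<bar>)"
      by (rule norm_le_l1_cart)
    also have "\<dots> \<le> (\<Sum>j\<in>(UNIV :: 'n set). n * (norm \<delta> * \<epsilon>))"
    proof (rule sum_mono)
      fix j :: 'n
      have "(A p \<delta> - A (u0, w0) \<delta>) $ j = (\<Sum>i\<in>UNIV. \<delta> $ i * (a i j p - a i j (u0, w0)))"
        by (simp add: A p p0 right_diff_distrib sum_subtractf)
      also have "\<bar>\<dots>\<bar> \<le> (\<Sum>i\<in>(UNIV :: 'n set). norm \<delta> * \<epsilon>)"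
      proof (intro order_trans[OF sum_abs] sum_mono)
        fix i :: 'n
        have "\<bar>a i j p - a i j (u0, w0)\<bar> \<le> \<epsilon>" using r(2)[OF p(1)] p(2) R1(2)[of i j] by (meson less_imp_le less_le_trans)
        then show "\<bar>\<delta> $ i * (a i j p - a i j (u0, w0))\<bar> \<le> norm \<delta> * \<epsilon>"
          using component_le_norm_cart[of \<delta> i] by (auto simp: abs_mult intro!: mult_mono)
      qed
      finally show "\<bar>(A p \<delta> - A (u0, w0) \<delta>) $ j\<bar> \<le> n * (norm \<delta> * \<epsilon>)" by (simp add: n_def)
    qed
    also have "\<dots> = B / 2 * norm \<delta>" using n by (simp add: \<epsilon>_def flip: n_def)
    finally show ?thesis .
  qed
  define G where "G u w = (\<chi> j. f1 (u, w) (0, axis j 1))" for u w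
  have "B / 2 * norm (u - u') \<le> norm (G u w - G u' w)"
    if u: "u \<in> ball u0 R" "u' \<in> ball u0 R" and w: "w \<in> ball w0 R" for u u' w
  proof -
    have lin: "bounded_linear (A (u0, w0))" unfolding AM by (rule matrix_vector_mul_bounded_linear)
    have "norm ((G u w - A (u0, w0) u) - (G u' w - A (u0, w0) u')) \<le> B / 2 * norm (u - u')"
    proof (rule differentiable_bound[OF convex_ball _ _ u, where f="\<lambda>u. G u w - A (u0, w0) u"
          and f'="\<lambda>u \<delta>. A (u, w) \<delta> - A (u0, w0) \<delta>"])
      fix x assume x: "x \<in> ball u0 R"
      have "(x, w) \<in> S" using x w sub by auto
      have "((\<lambda>u. f1 (u, w) (0, axis j 1)) has_derivative (\<lambda>\<delta>. f2 (0, axis j 1) (x, w) (\<delta>, 0))) (at x within ball u0 R)" for j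
      proof -
        have "(((\<lambda>p. f1 p (0, axis j 1)) \<circ> (\<lambda>u. (u, w))) has_derivative f2 (0, axis j 1) (x, w) \<circ> (\<lambda>\<delta>. (\<delta>, 0))) (at x within ball u0 R)"
          using \<open>(x, w) \<in> S\<close>
          by (intro diff_chain_within has_derivative_at_withinI[OF deriv1] derivative_intros)
        then show ?thesis by (simp add: comp_def)
      qed
      then have "((\<lambda>u. G u w) has_derivative A (x, w)) (at x within ball u0 R)"
        unfolding G_def A_def by (subst has_derivative_componentwise_within) (auto simp: Basis_vec_def inner_axis)
      then show "((\<lambda>u. G u w - A (u0, w0) u) has_derivative (\<lambda>\<delta>. A (x, w) \<delta> - A (u0, w0) \<delta>)) (at x within ball u0 R)"
        by (intro has_derivative_diff bounded_linear_imp_has_derivative lin)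
      show "onorm (\<lambda>\<delta>. A (x, w) \<delta> - A (u0, w0) \<delta>) \<le> B / 2"
        using Abound[OF \<open>(x, w) \<in> S\<close>] near[OF x w] B by (intro onorm_bound) auto
    qed
    moreover have "A (u0, w0) u - A (u0, w0) u' = A (u0, w0) (u - u')"
      using lin by (simp add: bounded_linear.linear linear_diff)
    ultimately have "norm ((G u w - G u' w) - A (u0, w0) (u - u')) \<le> B / 2 * norm (u - u')"
      by (simp add: algebra_simps)
    moreover have "norm (A (u0, w0) (u - u')) \<le> norm ((G u w - G u' w) - A (u0, w0) (u - u')) + norm (G u w - G u' w)"
      by (metis norm_minus_commute norm_triangle_sub add.commute)
    ultimately show ?thesis using B(2)[of "u - u'"] by linarith
  qed
  then show ?thesis
    using \<open>0 < R\<close> B(1) sub unfolding G_def by (intro exI[of _ R] conjI exI[of _ "B / 2"]) auto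
qed

text \<open>If \<open>\<psi>\<close> is semiconvex and \<open>H u' + \<psi>\<close> has a maximum at \<open>w'\<close>, then \<open>\<psi>\<close> has the gradient
  \<open>- G u' w'\<close> at \<open>w'\<close> up to a quadratic error. So a step of length \<open>t\<close> along \<open>G u w' - G u' w'\<close>
  raises \<open>H u + \<psi>\<close> by a multiple of \<open>\<bar>u - u'\<bar>\<^sup>2\<close>, while monotonicity allows at most a multiple of
  \<open>\<bar>u - u'\<bar> * \<bar>w - w'\<bar>\<close>.\<close>

lemma monotone_pair_Lipschitz:
  fixes H :: "'a::real_inner \<Rightarrow> 'b::real_inner \<Rightarrow> real" and G :: "'a \<Rightarrow> 'b \<Rightarrow> 'b"
  assumes C: "0 < C" and c: "0 < c"
    and Taylor: "\<And>u w w'. u \<in> ball u0 r \<Longrightarrow> w \<in> ball w0 r \<Longrightarrow> w' \<in> ball w0 r \<Longrightarrow>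
        \<bar>H u w' - H u w - G u w \<bullet> (w' - w)\<bar> \<le> C * (norm (w' - w))\<^sup>2"
    and lower: "\<And>u u' w. u \<in> ball u0 r \<Longrightarrow> u' \<in> ball u0 r \<Longrightarrow> w \<in> ball w0 r \<Longrightarrow>
        c * norm (u - u') \<le> norm (G u w - G u' w)"
    and upper: "\<And>u u' w. u \<in> ball u0 r \<Longrightarrow> u' \<in> ball u0 r \<Longrightarrow> w \<in> ball w0 r \<Longrightarrow>
        norm (G u w - G u' w) \<le> C * norm (u - u')"
    and mixed: "\<And>u u' w w'. u \<in> ball u0 r \<Longrightarrow> u' \<in> ball u0 r \<Longrightarrow> w \<in> ball w0 r \<Longrightarrow> w' \<in> ball w0 r \<Longrightarrow>
        H u w - H u w' - (H u' w - H u' w') \<le> C * norm (u - u') * norm (w - w')"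
    and u: "u \<in> ball u0 r" "u' \<in> ball u0 r" and w: "w \<in> ball w0 (r/2)" "w' \<in> ball w0 (r/2)"
    and semiconvex: "\<And>v. w' + v \<in> ball w0 r \<Longrightarrow> w' - v \<in> ball w0 r \<Longrightarrow>
        - C * (norm v)\<^sup>2 \<le> \<psi> (w' + v) + \<psi> (w' - v) - 2 * \<psi> w'"
    and maximum: "\<And>\<omega>. \<omega> \<in> ball w0 r \<Longrightarrow> H u' \<omega> + \<psi> \<omega> \<le> H u' w' + \<psi> w'"
    and monotone: "\<And>\<omega>. \<omega> \<in> ball w0 r \<Longrightarrow> H u \<omega> + \<psi> \<omega> + H u' w \<le> H u w + H u' w' + \<psi> w'"
  shows "norm (u - u') \<le> 12 * C\<^sup>2 / c\<^sup>2 * norm (w - w')"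
proof (cases "u = u'")
  case False
  have "0 < r" using u(1) by (auto intro: le_less_trans[OF zero_le_dist])
  then have wr: "w \<in> ball w0 r" "w' \<in> ball w0 r" using w by auto
  define a where "a = G u w' - G u' w'"
  \<comment> \<open>This length maximises \<open>t - 3 * C * t\<^sup>2\<close>, the gain per unit of
    \<open>(norm a)\<^sup>2\<close>, with value \<open>1 / (12 * C)\<close>. It is also short enough
    to keep \<open>w' + v\<close> and \<open>w' - v\<close> in the ball.\<close>
  define t where "t = 1 / (6 * C)"
  define v where "v = t *\<^sub>R a"
  have "0 < t" using C by (simp add: t_def)
  have "norm a \<le> C * norm (u - u')" unfolding a_def using upper u wr by blast
  moreover have "norm (u - u') < 2 * r"
    using u dist_triangle2[of u u' u0] by (simp add: dist_norm norm_minus_commute dist_commute)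
  ultimately have "norm a < C * (2 * r)" using C by (meson le_less_trans mult_less_cancel_left_pos)
  moreover have "norm v = norm a / (6 * C)" using C by (simp add: v_def t_def)
  ultimately have "norm v < r / 3" using C by (simp add: divide_less_eq mult_ac)
  then have "norm v < r / 2" using \<open>0 < r\<close> by simp
  then have in_ball: "w' + v \<in> ball w0 r" "w' - v \<in> ball w0 r"
    using w(2) dist_triangle[of w0 "w' + v" w'] dist_triangle[of w0 "w' - v" w'] by (auto simp: dist_norm)
  have 1: "H u w' + G u w' \<bullet> v - C * (norm v)\<^sup>2 \<le> H u (w' + v)"
    using Taylor[OF u(1) wr(2) in_ball(1)] by (simp add: abs_le_iff)
  have 2: "H u' w' - G u' w' \<bullet> v - C * (norm v)\<^sup>2 \<le> H u' (w' - v)"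
    using Taylor[OF u(2) wr(2) in_ball(2)] by (simp add: abs_le_iff)
  \<comment> \<open>Monotonicity is used at \<open>w' + v\<close> and the maximum at
    \<open>w' - v\<close>; semiconvexity then eliminates \<open>\<psi>\<close>. Two Taylor errors
    and the semiconvexity error make up the factor 3.\<close>
  have "a \<bullet> v - 3 * C * (norm v)\<^sup>2 \<le> H u w - H u w' - (H u' w - H u' w')"
    using 1 2 semiconvex[OF in_ball] maximum[OF in_ball(2)] monotone[OF in_ball(1)]
    by (simp add: a_def inner_diff_left)
  also have "\<dots> \<le> C * norm (u - u') * norm (w - w')" using mixed u wr by blast
  finally have key: "a \<bullet> v - 3 * C * (norm v)\<^sup>2 \<le> C * norm (u - u') * norm (w - w')" .
  have "a \<bullet> v - 3 * C * (norm v)\<^sup>2 = (norm a)\<^sup>2 / (12 * C)"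
    using C by (simp add: v_def t_def power_mult_distrib power2_eq_square field_simps flip: power2_norm_eq_inner)
  then have "(norm a)\<^sup>2 \<le> C * norm (u - u') * norm (w - w') * (12 * C)"
    using key C by (simp add: pos_divide_le_eq)
  moreover have "(c * norm (u - u'))\<^sup>2 \<le> (norm a)\<^sup>2"
    using lower[OF u wr(2)] c unfolding a_def by (intro power_mono) auto
  ultimately have "(c * norm (u - u'))\<^sup>2 \<le> 12 * C\<^sup>2 * norm (u - u') * norm (w - w')"
    by (simp add: power2_eq_square mult_ac)
  then have "norm (u - u') * (c\<^sup>2 * norm (u - u')) \<le> norm (u - u') * (12 * C\<^sup>2 * norm (w - w'))"
    by (simp add: power2_eq_square mult_ac)
  then have "c\<^sup>2 * norm (u - u') \<le> 12 * C\<^sup>2 * norm (w - w')" using False by simp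
  then show ?thesis using c by (simp add: field_simps)
qed (use c C in auto)

section \<open>Functions of class \<open>C\<^sup>2\<close> on manifolds\<close>

lemma smooth_atlasD:
  assumes "smooth_atlas A" and "c \<in> A"
  shows chart_open: "open (fst c)"
    and chart_open_image: "open (snd c ` fst c)"
    and chart_homeomorphism: "homeomorphism (fst c) (snd c ` fst c) (snd c) (chart_inv c)"
    and chart_cont: "continuous_on (fst c) (snd c)"
    and chart_inv_cont: "continuous_on (snd c ` fst c) (chart_inv c)"
    and chart_inv_left: "\<And>x. x \<in> fst c \<Longrightarrow> chart_inv c (snd c x) = x"
proof -
  show o: "open (fst c)" "open (snd c ` fst c)"
    and hom: "homeomorphism (fst c) (snd c ` fst c) (snd c) (chart_inv c)"
    using assms(2) bspec[OF conjunct1[OF conjunct2[OF assms(1)[unfolded smooth_atlas_def]]], of c] by auto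
  show "continuous_on (fst c) (snd c)" "continuous_on (snd c ` fst c) (chart_inv c)"
    "\<And>x. x \<in> fst c \<Longrightarrow> chart_inv c (snd c x) = x"
    using hom unfolding homeomorphism_def by auto
qed

lemma ex_chart:
  assumes "smooth_atlas A" obtains c where "c \<in> A" "x \<in> fst c"
proof -
  have "x \<in> (\<Union>c\<in>A. fst c)" using assms(1) by (simp add: smooth_atlas_def)
  then show ?thesis using that by blast
qed

lemma manifold_hausdorff_dim_nonneg:
  assumes "smooth_atlas (A :: ('m::topological_space, 'k::finite) chart set)"
  shows "0 \<le> manifold_hausdorff_dim A S"
proof -
  obtain d where "d \<in> A" using ex_chart[OF assms] by blast
  have "0 \<le> hausdorff_dim (snd d ` (S \<inter> fst d))" by (rule hausdorff_dim_nonneg)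
  also have "\<dots> \<le> manifold_hausdorff_dim A S"
    unfolding manifold_hausdorff_dim_def by (rule SUP_upper[OF \<open>d \<in> A\<close>])
  finally show ?thesis .
qed

lemma chart_image_open:
  assumes "smooth_atlas A" "c \<in> A" "open U"
  shows "open (snd c ` (fst c \<inter> U))"
proof -
  have "openin (top_of_set (fst c)) (fst c \<inter> U)" using \<open>open U\<close> by blast
  then have "openin (top_of_set (snd c ` fst c)) (snd c ` (fst c \<inter> U))"
    by (rule homeomorphism_imp_open_map[OF chart_homeomorphism[OF assms(1,2)]])
  then show ?thesis using openin_open_eq[OF chart_open_image[OF assms(1,2)]] by blast
qed

lemma chart_preimage_open:
  assumes "smooth_atlas A" "c \<in> A" "open B"
  shows "open {x \<in> fst c. snd c x \<in> B}"
proof -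
  have "open (fst c \<inter> snd c -` B)"
    using chart_cont[OF assms(1,2)] chart_open[OF assms(1,2)] assms(3) by (rule continuous_open_preimage)
  moreover have "fst c \<inter> snd c -` B = {x \<in> fst c. snd c x \<in> B}" by auto
  ultimately show ?thesis by simp
qed

text \<open>The index type \<open>'n\<close> is nonempty, so open sets of coordinates have no
  isolated points. This makes the limits in \<open>ext_to_closure\<close> unique.\<close>

lemma ex_other_point:
  assumes A: "smooth_atlas (A :: ('m::topological_space, 'n::finite) chart set)" and "open U" "(x :: 'm) \<in> U"
  shows "\<exists>x'\<in>U. x' \<noteq> x"
proof (rule ccontr)
  assume "\<not> ?thesis"
  then have U: "U = {x}" using \<open>x \<in> U\<close> by blast
  obtain c where c: "c \<in> A" "x \<in> fst c" using ex_chart[OF A] .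
  then have "fst c \<inter> U = {x}" using U by auto
  then have "open {snd c x}" using chart_image_open[OF A c(1) \<open>open U\<close>] by simp
  then show False using not_open_singleton by blast
qed

text \<open>The tube lemma for a strict inequality. It takes the place of uniform continuity, since
  the manifolds carry no metric here.\<close>

lemma compact_tube_less:
  fixes \<phi> :: "'p::topological_space \<Rightarrow> 'q::topological_space \<Rightarrow> real"
  assumes K: "compact K" and cont: "continuous_on (P \<times> K) (\<lambda>(p, z). \<phi> p z)" and p: "p \<in> P"
    and less: "\<And>z. z \<in> K \<Longrightarrow> \<phi> p z < 0"
  shows "\<exists>U. open U \<and> p \<in> U \<and> (\<forall>p'\<in>U \<inter> P. \<forall>z\<in>K. \<phi> p' z < 0)"
proof -
  obtain W where W: "open W" "W \<inter> (P \<times> K) = (\<lambda>(p, z). \<phi> p z) -` {..<0} \<inter> (P \<times> K)"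
    using cont[unfolded continuous_on_open_invariant, rule_format, of "{..<0}"] by auto
  have "\<exists>A B. open A \<and> open B \<and> p \<in> A \<and> z \<in> B \<and> A \<times> B \<subseteq> W" if "z \<in> K" for z
  proof -
    have "(p, z) \<in> W" using W(2) p less that by auto
    then obtain A B where "open A" "open B" "(p, z) \<in> A \<times> B" "A \<times> B \<subseteq> W"
      using open_prod_elim[OF W(1)] by blast
    then show ?thesis by blast
  qed
  then obtain A B where AB: "\<And>z. z \<in> K \<Longrightarrow> open (A z)" "\<And>z. z \<in> K \<Longrightarrow> open (B z)" "\<And>z. z \<in> K \<Longrightarrow> p \<in> A z"
    "\<And>z. z \<in> K \<Longrightarrow> z \<in> B z" "\<And>z. z \<in> K \<Longrightarrow> A z \<times> B z \<subseteq> W" by metis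
  obtain D where D: "D \<subseteq> K" "finite D" "K \<subseteq> (\<Union>z\<in>D. B z)"
  proof (rule compactE_image[OF K, of K B])
    show "K \<subseteq> (\<Union>z\<in>K. B z)" using AB(4) by blast
  qed (use AB in auto)
  have "\<phi> p' z < 0" if pz: "p' \<in> (\<Inter>z\<in>D. A z) \<inter> P" "z \<in> K" for p' z
  proof -
    obtain z' where "z' \<in> D" "z \<in> B z'" using D pz by auto
    then have "(p', z) \<in> W" using subsetD[OF AB(5)[of z']] D(1) pz by blast
    then have "(p', z) \<in> W \<inter> (P \<times> K)" using pz by auto
    then show ?thesis unfolding W(2) by auto
  qed
  moreover have "open (\<Inter>z\<in>D. A z)" "p \<in> (\<Inter>z\<in>D. A z)" using D AB by auto
  ultimately show ?thesis by blast
qed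

section \<open>Derivatives up to the closure, in coordinates\<close>

locale C2_on_manifolds =
  fixes A :: "('p::{t2_space, second_countable_topology}, 'n::finite) chart set"
    and B :: "('q::{t2_space, second_countable_topology}, 'n) chart set"
    and P :: "'p set" and Q :: "'q set" and h :: "'p \<Rightarrow> 'q \<Rightarrow> real"
  assumes atlas_A: "smooth_atlas A" and atlas_B: "smooth_atlas B"
    and open_P: "open P" and open_Q: "open Q" and C2: "C2_closure A B P Q h"
begin

abbreviation coord :: "('p, 'n) chart \<Rightarrow> ('q, 'n) chart \<Rightarrow> (real ^ 'n) \<times> (real ^ 'n) \<Rightarrow> real" where
  "coord c d \<equiv> \<lambda>(u, w). h (chart_inv c u) (chart_inv d w)"

abbreviation inner_set :: "('p, 'n) chart \<Rightarrow> ('q, 'n) chart \<Rightarrow> ((real ^ 'n) \<times> (real ^ 'n)) set" where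
  "inner_set c d \<equiv> snd c ` (fst c \<inter> P) \<times> snd d ` (fst d \<inter> Q)"

abbreviation outer_set :: "('p, 'n) chart \<Rightarrow> ('q, 'n) chart \<Rightarrow> ((real ^ 'n) \<times> (real ^ 'n)) set" where
  "outer_set c d \<equiv> snd c ` (fst c \<inter> closure P) \<times> snd d ` (fst d \<inter> closure Q)"

lemma inner_subset_outer: "inner_set c d \<subseteq> outer_set c d"
  by (intro Sigma_mono image_mono Int_mono order_refl closure_subset)

lemma open_inner_set: "c \<in> A \<Longrightarrow> d \<in> B \<Longrightarrow> open (inner_set c d)"
  by (intro open_Times chart_image_open[OF atlas_A _ open_P] chart_image_open[OF atlas_B _ open_Q])

lemma obtain_C2_function:
  assumes "c \<in> A" "d \<in> B"
  obtains f1 f2 where "C2_function (coord c d) (inner_set c d) (outer_set c d) f1 f2"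
proof -
  have "Ck_on 2 (coord c d) (inner_set c d) (outer_set c d)"
    using C2 assms unfolding C2_closure_def by blast
  then show ?thesis by (rule Ck_on_2_imp_C2_function[OF _ inner_subset_outer that])
qed

lemma continuous_on_charts:
  fixes k :: "(real ^ 'n) \<times> (real ^ 'n) \<Rightarrow> 'c::topological_space"
  assumes "c \<in> A" "d \<in> B" and k: "continuous_on (outer_set c d) k"
  shows "continuous_on ((fst c \<times> fst d) \<inter> (closure P \<times> closure Q)) (\<lambda>(p, q). k (snd c p, snd d q))"
proof -
  let ?N = "(fst c \<times> fst d) \<inter> (closure P \<times> closure Q)"
  have "continuous_on ?N (\<lambda>z. (snd c (fst z), snd d (snd z)))"
    by (intro continuous_intros continuous_on_compose2[OF chart_cont[OF atlas_A assms(1)]]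
        continuous_on_compose2[OF chart_cont[OF atlas_B assms(2)]]) auto
  then have "continuous_on ?N (\<lambda>z. k (snd c (fst z), snd d (snd z)))"
    by (intro continuous_on_compose2[OF k]) auto
  then show ?thesis by (simp add: case_prod_unfold)
qed

lemma continuous_on_h: "continuous_on (closure P \<times> closure Q) (\<lambda>(p, q). h p q)"
  unfolding continuous_on_eq_continuous_within
proof
  fix z assume z: "z \<in> closure P \<times> closure Q"
  obtain p q where pq: "z = (p, q)" by (cases z)
  obtain c where c: "c \<in> A" "p \<in> fst c" using ex_chart[OF atlas_A] .
  obtain d where d: "d \<in> B" "q \<in> fst d" using ex_chart[OF atlas_B] .
  let ?N = "fst c \<times> fst d"
  obtain f1 f2 where "C2_function (coord c d) (inner_set c d) (outer_set c d) f1 f2"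
    using obtain_C2_function[OF c(1) d(1)] .
  then interpret C2_function "coord c d" "inner_set c d" "outer_set c d" f1 f2 .
  have "continuous_on (?N \<inter> (closure P \<times> closure Q)) (\<lambda>(p, q). coord c d (snd c p, snd d q))"
    by (rule continuous_on_charts[OF c(1) d(1) cont])
  then have "continuous_on (?N \<inter> (closure P \<times> closure Q)) (\<lambda>(p, q). h p q)"
    by (rule continuous_on_eq) (auto simp: chart_inv_left[OF atlas_A c(1)] chart_inv_left[OF atlas_B d(1)])
  then have "continuous (at z within ?N \<inter> (closure P \<times> closure Q)) (\<lambda>(p, q). h p q)"
    using z pq c d by (simp add: continuous_on_eq_continuous_within)
  moreover have "at z within ?N \<inter> (closure P \<times> closure Q) = at z within (closure P \<times> closure Q)"
    using z pq c d by (intro at_within_nhd[of _ ?N] open_Times chart_open[OF atlas_A] chart_open[OF atlas_B]) auto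
  ultimately show "continuous (at z within closure P \<times> closure Q) (\<lambda>(p, q). h p q)" by simp
qed

lemma continuous_on_h_fst:
  assumes "q \<in> closure Q" shows "continuous_on (closure P) (\<lambda>p. h p q)"
proof -
  have "continuous_on (closure P) (\<lambda>p. (\<lambda>(p, q). h p q) (p, q))"
    using assms by (intro continuous_on_compose2[OF continuous_on_h] continuous_intros) auto
  then show ?thesis by simp
qed

lemma continuous_on_h_snd:
  assumes "p \<in> closure P" shows "continuous_on (closure Q) (h p)"
proof -
  have "continuous_on (closure Q) (\<lambda>q. (\<lambda>(p, q). h p q) (p, q))"
    using assms by (intro continuous_on_compose2[OF continuous_on_h] continuous_intros) auto
  then show ?thesis by simp
qed

text \<open>The limit that defines the extension is read off from a function \<open>k\<close>
  continuous in coordinates. The point \<open>p\<close> is interior while \<open>q\<close> may lie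
  on the boundary, as happens at a kink; the limit is unique because \<open>p\<close> is not
  isolated in \<open>P\<close>.\<close>

lemma ext_to_closure_eq:
  assumes c: "c \<in> A" "p \<in> fst c" and d: "d \<in> B" "q \<in> fst d" and pq: "p \<in> P" "q \<in> closure Q"
    and k: "continuous_on (outer_set c d) k"
    and eq: "\<And>s t. s \<in> fst c \<inter> P \<Longrightarrow> t \<in> fst d \<inter> Q \<Longrightarrow> \<kappa> s t = k (snd c s, snd d t)"
  shows "ext_to_closure P Q \<kappa> p q = k (snd c p, snd d q)"
  unfolding ext_to_closure_def
proof (rule tendsto_Lim)
  let ?N = "fst c \<times> fst d" and ?C = "closure P \<times> closure Q"
  have N: "open ?N" "(p, q) \<in> ?N" using c d by (simp_all add: open_Times chart_open[OF atlas_A] chart_open[OF atlas_B])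
  have pq': "(p, q) \<in> ?C" using pq closure_subset by auto
  have sub: "?N \<inter> (P \<times> Q) \<subseteq> ?N \<inter> ?C"
    by (intro Int_mono Sigma_mono order_refl closure_subset)
  have "(p, q) islimpt P \<times> Q"
    unfolding islimpt_def
  proof (intro allI impI)
    fix O' assume "(p, q) \<in> O'" "open O'"
    then obtain U V where UV: "open U" "open V" "(p, q) \<in> U \<times> V" "U \<times> V \<subseteq> O'"
      using open_prod_elim[of O' "(p, q)"] by blast
    obtain p' where "p' \<in> U \<inter> P" "p' \<noteq> p"
      using ex_other_point[OF atlas_A, of "U \<inter> P" p] UV pq open_P by auto
    moreover obtain q' where "q' \<in> V \<inter> Q" using UV pq(2) open_Int_closure_eq_empty[OF UV(2), of Q] by auto
    ultimately show "\<exists>y\<in>P \<times> Q. y \<in> O' \<and> y \<noteq> (p, q)" using UV by (intro bexI[of _ "(p', q')"]) auto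
  qed
  then show "\<not> trivial_limit (at (p, q) within P \<times> Q)" by (simp add: trivial_limit_within)
  have "((\<lambda>(p, q). k (snd c p, snd d q)) \<longlongrightarrow> k (snd c p, snd d q)) (at (p, q) within ?N \<inter> ?C)"
    using continuous_on_charts[OF c(1) d(1) k, unfolded continuous_on_def, rule_format, of "(p, q)"] N pq'
    by simp
  then have "((\<lambda>(p, q). k (snd c p, snd d q)) \<longlongrightarrow> k (snd c p, snd d q)) (at (p, q) within ?N \<inter> (P \<times> Q))"
    by (rule tendsto_mono[OF at_le[OF sub], rotated])
  also have "at (p, q) within ?N \<inter> (P \<times> Q) = at (p, q) within P \<times> Q"
    using N by (intro at_within_nhd[of _ ?N]) auto
  finally have lim: "((\<lambda>(p, q). k (snd c p, snd d q)) \<longlongrightarrow> k (snd c p, snd d q)) (at (p, q) within P \<times> Q)" .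
  have "\<forall>\<^sub>F z in at (p, q) within P \<times> Q. (\<lambda>(p, q). k (snd c p, snd d q)) z = (\<lambda>(s, t). \<kappa> s t) z"
    unfolding eventually_at_topological using N eq by (intro exI[of _ ?N]) auto
  from tendsto_cong[OF this] lim
  show "((\<lambda>(s, t). \<kappa> s t) \<longlongrightarrow> k (snd c p, snd d q)) (at (p, q) within P \<times> Q)" by simp
qed

lemma pd_first:
  assumes C2f: "C2_function (coord c d) (inner_set c d) (outer_set c d) f1 f2"
    and c: "c \<in> A" and d: "d \<in> B" and s: "s \<in> fst c \<inter> P" and t: "t \<in> fst d \<inter> Q"
  shows "pd c i (\<lambda>s'. h s' t) s = f1 (snd c s, snd d t) (axis i 1, 0)"
proof -
  interpret C2_function "coord c d" "inner_set c d" "outer_set c d" f1 f2 by (rule C2f)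
  have "(snd c s, snd d t) \<in> inner_set c d" using s t by blast
  then have D: "(coord c d has_derivative f1 (snd c s, snd d t)) (at (snd c s, snd d t))" by (rule deriv)
  have "((coord c d \<circ> (\<lambda>u. (u, snd d t))) has_derivative f1 (snd c s, snd d t) \<circ> (\<lambda>\<delta>. (\<delta>, 0))) (at (snd c s))"
    by (rule diff_chain_at[OF has_derivative_Pair[OF has_derivative_ident has_derivative_const] D])
  moreover have "coord c d \<circ> (\<lambda>u. (u, snd d t)) = (\<lambda>s'. h s' t) \<circ> chart_inv c"
    using t by (auto simp: chart_inv_left[OF atlas_B d])
  ultimately have "frechet_derivative ((\<lambda>s'. h s' t) \<circ> chart_inv c) (at (snd c s)) = f1 (snd c s, snd d t) \<circ> (\<lambda>\<delta>. (\<delta>, 0))"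
    using frechet_derivative_at by metis
  then show ?thesis by (simp add: pd_def)
qed

lemma pd_second:
  assumes C2f: "C2_function (coord c d) (inner_set c d) (outer_set c d) f1 f2"
    and c: "c \<in> A" and d: "d \<in> B" and s: "s \<in> fst c \<inter> P" and t: "t \<in> fst d \<inter> Q"
  shows "pd d j (h s) t = f1 (snd c s, snd d t) (0, axis j 1)"
proof -
  interpret C2_function "coord c d" "inner_set c d" "outer_set c d" f1 f2 by (rule C2f)
  have "(snd c s, snd d t) \<in> inner_set c d" using s t by blast
  then have D: "(coord c d has_derivative f1 (snd c s, snd d t)) (at (snd c s, snd d t))" by (rule deriv)
  have "((coord c d \<circ> (\<lambda>w. (snd c s, w))) has_derivative f1 (snd c s, snd d t) \<circ> (\<lambda>\<delta>. (0, \<delta>))) (at (snd d t))"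
    by (rule diff_chain_at[OF has_derivative_Pair[OF has_derivative_const has_derivative_ident] D])
  moreover have "coord c d \<circ> (\<lambda>w. (snd c s, w)) = h s \<circ> chart_inv d"
    using s by (auto simp: chart_inv_left[OF atlas_A c])
  ultimately have "frechet_derivative (h s \<circ> chart_inv d) (at (snd d t)) = f1 (snd c s, snd d t) \<circ> (\<lambda>\<delta>. (0, \<delta>))"
    using frechet_derivative_at by metis
  then show ?thesis by (simp add: pd_def)
qed

lemma D_first_eq:
  assumes C2f: "C2_function (coord c d) (inner_set c d) (outer_set c d) f1 f2"
    and c: "c \<in> A" "p \<in> fst c" and d: "d \<in> B" "q \<in> fst d" and pq: "p \<in> P" "q \<in> closure Q"
  shows "D_first c P Q h p q $ i = f1 (snd c p, snd d q) (axis i 1, 0)"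
proof -
  interpret C2_function "coord c d" "inner_set c d" "outer_set c d" f1 f2 by (rule C2f)
  have "ext_to_closure P Q (\<lambda>s t. pd c i (\<lambda>s'. h s' t) s) p q = f1 (snd c p, snd d q) (axis i 1, 0)"
    by (rule ext_to_closure_eq[OF c d pq cont1]) (rule pd_first[OF C2f c(1) d(1)])
  then show ?thesis by (simp add: D_first_def)
qed

lemma D2_mixed_eq:
  assumes C2f: "C2_function (coord c d) (inner_set c d) (outer_set c d) f1 f2"
    and c: "c \<in> A" "p \<in> fst c" and d: "d \<in> B" "q \<in> fst d" and pq: "p \<in> P" "q \<in> closure Q"
  shows "D2_mixed c d P Q h p q = (\<chi> i j. f2 (0, axis j 1) (snd c p, snd d q) (axis i 1, 0))"
proof -
  interpret C2_function "coord c d" "inner_set c d" "outer_set c d" f1 f2 by (rule C2f)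
  have "pd c i (\<lambda>s'. pd d j (h s') t) s = f2 (0, axis j 1) (snd c s, snd d t) (axis i 1, 0)"
    if s: "s \<in> fst c \<inter> P" and t: "t \<in> fst d \<inter> Q" for s t i j
  proof -
    let ?U = "snd c ` (fst c \<inter> P)"
    have D: "((\<lambda>p. f1 p (0, axis j 1)) has_derivative f2 (0, axis j 1) (snd c s, snd d t)) (at (snd c s, snd d t))"
    proof (rule deriv1)
      show "(snd c s, snd d t) \<in> inner_set c d" using s t by blast
    qed
    have "(((\<lambda>p. f1 p (0, axis j 1)) \<circ> (\<lambda>u. (u, snd d t))) has_derivative
        f2 (0, axis j 1) (snd c s, snd d t) \<circ> (\<lambda>\<delta>. (\<delta>, 0))) (at (snd c s))"
      by (rule diff_chain_at[OF has_derivative_Pair[OF has_derivative_ident has_derivative_const] D])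
    then have "(((\<lambda>s'. pd d j (h s') t) \<circ> chart_inv c) has_derivative
        f2 (0, axis j 1) (snd c s, snd d t) \<circ> (\<lambda>\<delta>. (\<delta>, 0))) (at (snd c s))"
    proof (rule has_derivative_transform_within_open)
      show "open ?U" using chart_image_open[OF atlas_A c(1) open_P] .
      show "snd c s \<in> ?U" using s by auto
      fix u assume "u \<in> ?U"
      then obtain s' where s': "s' \<in> fst c \<inter> P" "u = snd c s'" by auto
      then show "((\<lambda>p. f1 p (0, axis j 1)) \<circ> (\<lambda>u. (u, snd d t))) u = ((\<lambda>s'. pd d j (h s') t) \<circ> chart_inv c) u"
        using pd_second[OF C2f c(1) d(1) s'(1) t] by (simp add: chart_inv_left[OF atlas_A c(1)])
    qed
    then have "frechet_derivative ((\<lambda>s'. pd d j (h s') t) \<circ> chart_inv c) (at (snd c s)) =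
        f2 (0, axis j 1) (snd c s, snd d t) \<circ> (\<lambda>\<delta>. (\<delta>, 0))"
      by (rule frechet_derivative_at[symmetric])
    then show ?thesis by (simp add: pd_def)
  qed
  note pd = this
  have "ext_to_closure P Q (\<lambda>s t. pd c i (\<lambda>s'. pd d j (h s') t) s) p q
      = f2 (0, axis j 1) (snd c p, snd d q) (axis i 1, 0)" for i j
  proof (rule ext_to_closure_eq[OF c d pq])
    show "continuous_on (outer_set c d) (\<lambda>x. f2 (0, axis j 1) x (axis i 1, 0))" by (rule cont2)
  qed (rule pd)
  then show ?thesis unfolding D2_mixed_def by presburger
qed

section \<open>Local estimates in coordinate balls\<close>

lemma ex_coord_ball:
  assumes "c \<in> A" "p \<in> fst c \<inter> P"
  obtains r where "0 < r" "ball (snd c p) r \<subseteq> snd c ` (fst c \<inter> P)"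
proof -
  have "snd c p \<in> snd c ` (fst c \<inter> P)" using assms(2) by blast
  then show ?thesis
    using chart_image_open[OF atlas_A assms(1) open_P] that unfolding open_contains_ball by blast
qed

lemma ex_coord_ball_snd:
  assumes "d \<in> B" "q \<in> fst d \<inter> Q"
  obtains r where "0 < r" "ball (snd d q) r \<subseteq> snd d ` (fst d \<inter> Q)"
proof -
  have "snd d q \<in> snd d ` (fst d \<inter> Q)" using assms(2) by blast
  then show ?thesis
    using chart_image_open[OF atlas_B assms(1) open_Q] that unfolding open_contains_ball by blast
qed

lemma chart_inv_P: "c \<in> A \<Longrightarrow> u \<in> snd c ` (fst c \<inter> P) \<Longrightarrow> chart_inv c u \<in> P"
  by (auto simp: chart_inv_left[OF atlas_A])

lemma chart_inv_Q: "d \<in> B \<Longrightarrow> w \<in> snd d ` (fst d \<inter> Q) \<Longrightarrow> chart_inv d w \<in> Q"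
  by (auto simp: chart_inv_left[OF atlas_B])

text \<open>The derivative in the first variable is nearly constant close to
  \<open>(p0, q0)\<close>, so the increment of \<open>h\<close> is compared with one fixed covector,
  uniformly in \<open>q\<close>. For \<open>q\<close> in \<open>Q\<close> this is the mean value
  theorem. Boundary points \<open>q\<close> follow by continuity, since the estimate involves only
  values of \<open>h\<close>.\<close>

lemma strict_derivative:
  assumes c: "c \<in> A" and p0: "p0 \<in> fst c \<inter> P" and q0: "q0 \<in> closure Q" and "0 < \<epsilon>"
  shows "\<exists>r>0. \<exists>V. open V \<and> q0 \<in> V \<and> ball (snd c p0) r \<subseteq> snd c ` (fst c \<inter> P) \<and>
    (\<forall>u\<in>ball (snd c p0) r. \<forall>u'\<in>ball (snd c p0) r. \<forall>q\<in>V \<inter> closure Q.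
       \<bar>h (chart_inv c u') q - h (chart_inv c u) q - D_first c P Q h p0 q0 \<bullet> (u' - u)\<bar> \<le> \<epsilon> * norm (u' - u))"
proof -
  obtain d where d: "d \<in> B" "q0 \<in> fst d" using ex_chart[OF atlas_B] .
  obtain f1 f2 where C2f: "C2_function (coord c d) (inner_set c d) (outer_set c d) f1 f2"
    using obtain_C2_function[OF c d(1)] .
  interpret C2_function "coord c d" "inner_set c d" "outer_set c d" f1 f2 by (rule C2f)
  define u0 w0 D where "u0 = snd c p0" and "w0 = snd d q0" and "D = D_first c P Q h p0 q0"
  have D: "D $ i = f1 (u0, w0) (axis i 1, 0)" for i
    unfolding D_def u0_def w0_def using p0 q0 d c by (intro D_first_eq[OF C2f]) auto
  have "p0 \<in> closure P" using p0 closure_subset by auto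
  then have in_outer: "(u0, w0) \<in> outer_set c d" unfolding u0_def w0_def using p0 q0 d by blast
  define n where "n = real CARD('n)"
  have n: "0 < n" by (simp add: n_def)
  have "0 < \<epsilon> / n" using n \<open>0 < \<epsilon>\<close> by simp
  then have "\<exists>r>0. \<forall>x\<in>outer_set c d. dist x (u0, w0) < r \<longrightarrow> \<bar>f1 x (axis i 1, 0) - D $ i\<bar> < \<epsilon> / n" for i
    using cont1[of "(axis i 1, 0)"] in_outer
    unfolding continuous_on_iff dist_real_def D by blast
  then obtain r where r: "\<And>i. 0 < r i"
    "\<And>i x. x \<in> outer_set c d \<Longrightarrow> dist x (u0, w0) < r i \<Longrightarrow> \<bar>f1 x (axis i 1, 0) - D $ i\<bar> < \<epsilon> / n"
    by metis
  define R1 where "R1 = Min (range r)"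
  have R1: "0 < R1" "R1 \<le> r i" for i
    unfolding R1_def using r(1) by (auto simp: Min_gr_iff intro!: Min_le)
  obtain R2 where R2: "0 < R2" "ball u0 R2 \<subseteq> snd c ` (fst c \<inter> P)"
    unfolding u0_def using ex_coord_ball[OF c p0] .
  define R where "R = min (R1 / 2) R2"
  have R: "0 < R" "R \<le> R1 / 2" using R1(1) R2 by (auto simp: R_def)
  have sub: "ball u0 R \<subseteq> snd c ` (fst c \<inter> P)" using R2(2) by (auto simp: R_def)
  define V where "V = {q \<in> fst d. snd d q \<in> ball w0 R}"
  have V: "open V" "q0 \<in> V"
    unfolding V_def using chart_preimage_open[OF atlas_B d(1) open_ball] d R by (auto simp: w0_def simp del: mem_ball)
  have ineq: "\<bar>h (chart_inv c u') q - h (chart_inv c u) q - D \<bullet> (u' - u)\<bar> \<le> \<epsilon> * norm (u' - u)"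
    if u: "u \<in> ball u0 R" "u' \<in> ball u0 R" and q: "q \<in> V \<inter> Q" for u u' q
  proof -
    define w where "w = snd d q"
    have q': "q \<in> fst d" "w \<in> ball w0 R" "chart_inv d w = q"
      using q by (auto simp: V_def w_def chart_inv_left[OF atlas_B d(1)])
    have "norm ((coord c d (u', w) - D \<bullet> u') - (coord c d (u, w) - D \<bullet> u)) \<le> \<epsilon> * norm (u' - u)"
    proof (rule differentiable_bound[OF convex_ball _ _ u(2) u(1), where f="\<lambda>u. coord c d (u, w) - D \<bullet> u"
          and f'="\<lambda>u \<delta>. f1 (u, w) (\<delta>, 0) - D \<bullet> \<delta>"])
      fix x assume x: "x \<in> ball u0 R"
      have "x \<in> snd c ` (fst c \<inter> P)" using x sub by blast
      moreover have "w \<in> snd d ` (fst d \<inter> Q)" using q q' unfolding w_def by blast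
      ultimately have inn: "(x, w) \<in> inner_set c d" by blast
      have dx: "(coord c d has_derivative f1 (x, w)) (at (x, w))" by (rule deriv[OF inn])
      have "((coord c d \<circ> (\<lambda>u. (u, w))) has_derivative f1 (x, w) \<circ> (\<lambda>\<delta>. (\<delta>, 0))) (at x)"
        by (rule diff_chain_at[OF has_derivative_Pair[OF has_derivative_ident has_derivative_const] dx])
      then have "((\<lambda>u. coord c d (u, w)) has_derivative (\<lambda>\<delta>. f1 (x, w) (\<delta>, 0))) (at x)"
        unfolding comp_def .
      then show "((\<lambda>u. coord c d (u, w) - D \<bullet> u) has_derivative (\<lambda>\<delta>. f1 (x, w) (\<delta>, 0) - D \<bullet> \<delta>)) (at x within ball u0 R)"
        by (rule has_derivative_at_withinI[OF has_derivative_diff[OF _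
              bounded_linear_imp_has_derivative[OF bounded_linear_inner_right]]])
      show "onorm (\<lambda>\<delta>. f1 (x, w) (\<delta>, 0) - D \<bullet> \<delta>) \<le> \<epsilon>"
      proof (rule onorm_bound)
        fix \<delta> :: "real ^ 'n"
        have "f1 (x, w) (\<delta>, 0) - D \<bullet> \<delta> = (\<Sum>i\<in>UNIV. \<delta> $ i * (f1 (x, w) (axis i 1, 0) - D $ i))"
          unfolding linear_Pair_axis(1)[OF linear1[OF inn], of \<delta>]
          by (simp add: inner_vec_def sum_subtractf right_diff_distrib mult.commute)
        also have "\<bar>\<dots>\<bar> \<le> (\<Sum>i\<in>(UNIV :: 'n set). norm \<delta> * (\<epsilon> / n))"
        proof (intro order_trans[OF sum_abs] sum_mono)
          fix i :: 'n
          have "dist (u0, w0) (x, w) < R1" using x q' R(2) by (intro dist_Pair_less) auto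
          then have "dist (x, w) (u0, w0) < r i" using R1(2)[of i] by (simp add: dist_commute)
          then have "\<bar>f1 (x, w) (axis i 1, 0) - D $ i\<bar> \<le> \<epsilon> / n"
            by (rule less_imp_le[OF r(2)[OF subsetD[OF inner_subset_outer inn]]])
          then show "\<bar>\<delta> $ i * (f1 (x, w) (axis i 1, 0) - D $ i)\<bar> \<le> norm \<delta> * (\<epsilon> / n)"
            using component_le_norm_cart[of \<delta> i] unfolding abs_mult by (intro mult_mono) auto
        qed
        also have "\<dots> = \<epsilon> * norm \<delta>" using n by (simp add: n_def)
        finally show "norm (f1 (x, w) (\<delta>, 0) - D \<bullet> \<delta>) \<le> \<epsilon> * norm \<delta>" by simp
      qed (use \<open>0 < \<epsilon>\<close> in simp)
    qed
    then show ?thesis by (simp add: q' inner_diff_right algebra_simps)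
  qed
  have "\<bar>h (chart_inv c u') q - h (chart_inv c u) q - D \<bullet> (u' - u)\<bar> \<le> \<epsilon> * norm (u' - u)"
    if u: "u \<in> ball u0 R" "u' \<in> ball u0 R" and q: "q \<in> V \<inter> closure Q" for u u' q
  proof (rule continuous_le_on_closure[where S="V \<inter> Q"])
    have "chart_inv c u \<in> P" "chart_inv c u' \<in> P" using chart_inv_P[OF c] sub u by blast+
    then have "continuous_on (closure Q) (h (chart_inv c u))" "continuous_on (closure Q) (h (chart_inv c u'))"
      using closure_subset[of P] by (auto intro!: continuous_on_h_snd)
    moreover have "closure (V \<inter> Q) \<subseteq> closure Q" by (intro closure_mono) auto
    ultimately show "continuous_on (closure (V \<inter> Q)) (\<lambda>q. \<bar>h (chart_inv c u') q - h (chart_inv c u) q - D \<bullet> (u' - u)\<bar>)"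
      by (intro continuous_intros) (auto intro: continuous_on_subset)
    show "q \<in> closure (V \<inter> Q)" using open_Int_closure_subset[OF V(1), of Q] q by blast
  qed (use ineq u in blast)
  then show ?thesis
    using R(1) V sub unfolding u0_def D_def by blast
qed

text \<open>Collects, on one common pair of balls, the hypotheses on \<open>H\<close> and
  \<open>G\<close> of \<open>monotone_pair_Lipschitz\<close>. A single Lipschitz constant
  \<open>C\<close> of the gradient serves the Taylor, upper and mixed estimates; \<open>k\<close>
  comes from the invertible mixed derivative.\<close>

lemma nondegenerate_expansion:
  assumes c: "c \<in> A" and p0: "p0 \<in> fst c \<inter> P" and d: "d \<in> B" and q0: "q0 \<in> fst d \<inter> Q"
    and inv: "invertible (D2_mixed c d P Q h p0 q0)"
  obtains r C k G where "0 < r" "0 < C" "0 < k"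
    "ball (snd c p0) r \<subseteq> snd c ` (fst c \<inter> P)" "ball (snd d q0) r \<subseteq> snd d ` (fst d \<inter> Q)"
    "\<And>u w w'. u \<in> ball (snd c p0) r \<Longrightarrow> w \<in> ball (snd d q0) r \<Longrightarrow> w' \<in> ball (snd d q0) r \<Longrightarrow>
      \<bar>h (chart_inv c u) (chart_inv d w') - h (chart_inv c u) (chart_inv d w) - G u w \<bullet> (w' - w)\<bar> \<le> C * (norm (w' - w))\<^sup>2"
    "\<And>u u' w. u \<in> ball (snd c p0) r \<Longrightarrow> u' \<in> ball (snd c p0) r \<Longrightarrow> w \<in> ball (snd d q0) r \<Longrightarrow>
      k * norm (u - u') \<le> norm (G u w - G u' w :: real ^ 'n)"
    "\<And>u u' w. u \<in> ball (snd c p0) r \<Longrightarrow> u' \<in> ball (snd c p0) r \<Longrightarrow> w \<in> ball (snd d q0) r \<Longrightarrow>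
      norm (G u w - G u' w) \<le> C * norm (u - u')"
    "\<And>u u' w w'. u \<in> ball (snd c p0) r \<Longrightarrow> u' \<in> ball (snd c p0) r \<Longrightarrow> w \<in> ball (snd d q0) r \<Longrightarrow> w' \<in> ball (snd d q0) r \<Longrightarrow>
      h (chart_inv c u) (chart_inv d w) - h (chart_inv c u) (chart_inv d w')
        - (h (chart_inv c u') (chart_inv d w) - h (chart_inv c u') (chart_inv d w'))
      \<le> C * norm (u - u') * norm (w - w')"
proof -
  obtain f1 f2 where C2f: "C2_function (coord c d) (inner_set c d) (outer_set c d) f1 f2"
    using obtain_C2_function[OF c d] .
  interpret C2_function "coord c d" "inner_set c d" "outer_set c d" f1 f2 by (rule C2f)
  define u0 w0 where "u0 = snd c p0" and "w0 = snd d q0"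
  have inn: "(u0, w0) \<in> inner_set c d" unfolding u0_def w0_def using p0 q0 by blast
  have "q0 \<in> closure Q" using q0 closure_subset by auto
  then have "D2_mixed c d P Q h p0 q0 = (\<chi> i j. f2 (0, axis j 1) (u0, w0) (axis i 1, 0))"
    unfolding u0_def w0_def using p0 q0 c d by (intro D2_mixed_eq[OF C2f]) auto
  then have inv': "invertible (\<chi> i j. f2 (0, axis j 1) (u0, w0) (axis i 1, 0))" using inv by (rule back_subst[rotated])
  define G where "G u w = (\<chi> j. f1 (u, w) (0, axis j 1))" for u w
  obtain r1 k where r1: "0 < r1" "0 < k" "ball u0 r1 \<times> ball w0 r1 \<subseteq> inner_set c d"
    "\<And>u u' w. u \<in> ball u0 r1 \<Longrightarrow> u' \<in> ball u0 r1 \<Longrightarrow> w \<in> ball w0 r1 \<Longrightarrow> k * norm (u - u') \<le> norm (G u w - G u' w)"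
    using nondegenerate_gradient_bound[OF C2f inn open_inner_set[OF c d] inv'] unfolding G_def by blast
  obtain r2 C where r2: "0 < r2" "0 < C"
    and lip: "\<And>p q v. closed_segment p q \<subseteq> inner_set c d \<inter> ball (u0, w0) r2 \<Longrightarrow>
      \<bar>f1 p v - f1 q v\<bar> \<le> C * norm v * norm (p - q)"
    using gradient_Lipschitz[OF subsetD[OF inner_subset_outer inn]] by blast
  define r where "r = min r1 (r2 / 2)"
  have r: "0 < r" "r \<le> r1" "r \<le> r2 / 2" using r1 r2 by (auto simp: r_def)
  have sub: "ball u0 r \<times> ball w0 r \<subseteq> inner_set c d \<inter> ball (u0, w0) r2"
  proof -
    have "ball u0 r \<times> ball w0 r \<subseteq> ball u0 r1 \<times> ball w0 r1" using r by (intro Sigma_mono subset_ball)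
    moreover have "ball u0 r \<times> ball w0 r \<subseteq> ball (u0, w0) r2"
      using r(3) dist_Pair_less[of u0 _ r2 w0] by force
    ultimately show ?thesis using r1(3) by blast
  qed
  have in1: "(u, w) \<in> inner_set c d" if "u \<in> ball u0 r" "w \<in> ball w0 r" for u w
    using sub that by blast
  have Gin: "f1 (u, w) (0, v) = G u w \<bullet> v" if "u \<in> ball u0 r" "w \<in> ball w0 r" for u w v
    unfolding linear_Pair_axis(2)[OF linear1[OF in1[OF that]], of v] G_def
    by (simp add: inner_vec_def mult.commute)
  have segw: "closed_segment (u, w) (u, w') \<subseteq> inner_set c d \<inter> ball (u0, w0) r2"
    if "u \<in> ball u0 r" "w \<in> ball w0 r" "w' \<in> ball w0 r" for u w w'
  proof -
    have "closed_segment w w' \<subseteq> ball w0 r" using that by (intro closed_segment_subset) auto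
    then have "(\<lambda>w. (u, w)) ` closed_segment w w' \<subseteq> ball u0 r \<times> ball w0 r" using that(1) by blast
    then show ?thesis unfolding closed_segment_Pair_snd using sub by blast
  qed
  have segu: "closed_segment (u, w) (u', w) \<subseteq> inner_set c d \<inter> ball (u0, w0) r2"
    if "u \<in> ball u0 r" "u' \<in> ball u0 r" "w \<in> ball w0 r" for u u' w
  proof -
    have "closed_segment u u' \<subseteq> ball u0 r" using that by (intro closed_segment_subset) auto
    then have "(\<lambda>u. (u, w)) ` closed_segment u u' \<subseteq> ball u0 r \<times> ball w0 r" using that(3) by blast
    then show ?thesis unfolding closed_segment_Pair_fst using sub by blast
  qed
  show ?thesis
  proof (rule that[of r C k G])
    show "0 < r" "0 < C" "0 < k" by fact+
    have w0in: "w0 \<in> ball w0 r" and u0in: "u0 \<in> ball u0 r" using r by auto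
    show "ball (snd c p0) r \<subseteq> snd c ` (fst c \<inter> P)"
    proof
      fix u assume "u \<in> ball (snd c p0) r"
      then show "u \<in> snd c ` (fst c \<inter> P)" using in1[OF _ w0in, of u] unfolding u0_def by blast
    qed
    show "ball (snd d q0) r \<subseteq> snd d ` (fst d \<inter> Q)"
    proof
      fix w assume "w \<in> ball (snd d q0) r"
      then show "w \<in> snd d ` (fst d \<inter> Q)" using in1[OF u0in, of w] unfolding w0_def by blast
    qed
  next
    fix u w w' assume u: "u \<in> ball (snd c p0) r" "w \<in> ball (snd d q0) r" "w' \<in> ball (snd d q0) r"
    note u = u[folded u0_def w0_def]
    have "\<bar>coord c d (u, w') - coord c d (u, w) - f1 (u, w) ((u, w') - (u, w))\<bar> \<le> C * (norm ((u, w') - (u, w)))\<^sup>2"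
      using r2(2) by (intro Taylor_bound[OF lip _ segw[OF u]]) auto
    then show "\<bar>h (chart_inv c u) (chart_inv d w') - h (chart_inv c u) (chart_inv d w) - G u w \<bullet> (w' - w)\<bar> \<le> C * (norm (w' - w))\<^sup>2"
      by (simp add: Gin[OF u(1,2)] norm_Pair)
  next
    fix u u' w assume u: "u \<in> ball (snd c p0) r" "u' \<in> ball (snd c p0) r" "w \<in> ball (snd d q0) r"
    note u = u[folded u0_def w0_def]
    show "k * norm (u - u') \<le> norm (G u w - G u' w)"
      using u r by (intro r1(4)) auto
    \<comment> \<open>Testing the directional bound in the direction \<open>a\<close> itself turns
      it into a bound on \<open>norm a\<close>.\<close>
    define a where "a = G u w - G u' w"
    have "norm a * norm a = a \<bullet> a" by (simp add: power2_norm_eq_inner[symmetric] power2_eq_square)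
    also have "\<dots> = f1 (u, w) (0, a) - f1 (u', w) (0, a)"
      unfolding Gin[OF u(1,3)] Gin[OF u(2,3)] by (simp add: inner_diff_left[symmetric] a_def)
    also have "\<dots> \<le> C * norm (0 :: real ^ 'n, a) * norm ((u, w) - (u', w))"
      by (rule order_trans[OF abs_ge_self lip[OF segu[OF u]]])
    also have "\<dots> = norm a * (C * norm (u - u'))" by (simp add: norm_Pair)
    finally have "norm a * norm a \<le> norm a * (C * norm (u - u'))" .
    then have "norm a \<le> C * norm (u - u')"
      using r2(2) by (cases "a = 0") auto
    then show "norm (G u w - G u' w) \<le> C * norm (u - u')" by (simp add: a_def)
  next
    fix u u' w w'
    assume u: "u \<in> ball (snd c p0) r" "u' \<in> ball (snd c p0) r" "w \<in> ball (snd d q0) r" "w' \<in> ball (snd d q0) r"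
    note u = u[folded u0_def w0_def]
    have "\<bar>coord c d (u, w) - coord c d (u, w') - (coord c d (u', w) - coord c d (u', w'))\<bar> \<le> C * norm (u - u') * norm (w - w')"
      using u r2(2) by (intro mixed_difference_bound[OF C2f lip _ convex_ball convex_ball sub]) auto
    then show "h (chart_inv c u) (chart_inv d w) - h (chart_inv c u) (chart_inv d w')
        - (h (chart_inv c u') (chart_inv d w) - h (chart_inv c u') (chart_inv d w'))
      \<le> C * norm (u - u') * norm (w - w')" by simp
  qed
qed

text \<open>Semiconvexity in the second variable, uniformly for \<open>p\<close> near
  \<open>p0\<close>, which may be a boundary point. Derivatives need not exist there, but a
  symmetric second difference involves only values of \<open>h\<close>, so the bound passes from
  \<open>V \<inter> P\<close> to the closure.\<close>

lemma second_difference_bound: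
  assumes p0: "p0 \<in> closure P" and d: "d \<in> B" and q0: "q0 \<in> fst d \<inter> Q"
  obtains r C V where "0 < r" "0 < C" "open V" "p0 \<in> V" "ball (snd d q0) r \<subseteq> snd d ` (fst d \<inter> Q)"
    "\<And>p w v. p \<in> V \<inter> closure P \<Longrightarrow> w \<in> ball (snd d q0) r \<Longrightarrow> w + v \<in> ball (snd d q0) r \<Longrightarrow> w - v \<in> ball (snd d q0) r \<Longrightarrow>
      - C * (norm v)\<^sup>2 \<le> h p (chart_inv d (w + v)) + h p (chart_inv d (w - v)) - 2 * h p (chart_inv d w)"
proof -
  obtain c where c: "c \<in> A" "p0 \<in> fst c" using ex_chart[OF atlas_A] .
  obtain f1 f2 where C2f: "C2_function (coord c d) (inner_set c d) (outer_set c d) f1 f2"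
    using obtain_C2_function[OF c(1) d] .
  interpret C2_function "coord c d" "inner_set c d" "outer_set c d" f1 f2 by (rule C2f)
  define u0 w0 where "u0 = snd c p0" and "w0 = snd d q0"
  have "q0 \<in> closure Q" using q0 closure_subset by auto
  then have out: "(u0, w0) \<in> outer_set c d" unfolding u0_def w0_def using p0 q0 c by blast
  obtain r2 C where r2: "0 < r2" "0 < C"
    and lip: "\<And>p q v. closed_segment p q \<subseteq> inner_set c d \<inter> ball (u0, w0) r2 \<Longrightarrow>
      \<bar>f1 p v - f1 q v\<bar> \<le> C * norm v * norm (p - q)"
    using gradient_Lipschitz[OF out] by blast
  obtain r1 where r1: "0 < r1" "ball w0 r1 \<subseteq> snd d ` (fst d \<inter> Q)"
    unfolding w0_def using ex_coord_ball_snd[OF d q0] .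
  define r where "r = min r1 (r2 / 2)"
  have r: "0 < r" "r \<le> r1" "r \<le> r2 / 2" using r1 r2 by (auto simp: r_def)
  have sub: "ball w0 r \<subseteq> snd d ` (fst d \<inter> Q)" using r1(2) r(2) by auto
  define V where "V = {p \<in> fst c. snd c p \<in> ball u0 (r2 / 2)}"
  have V: "open V" "p0 \<in> V"
    unfolding V_def using chart_preimage_open[OF atlas_A c(1) open_ball] c r2 by (auto simp: u0_def simp del: mem_ball)
  have ineq: "- (h p (chart_inv d (w + v)) + h p (chart_inv d (w - v)) - 2 * h p (chart_inv d w)) \<le> 2 * C * (norm v)\<^sup>2"
    if p: "p \<in> V \<inter> P" and w: "w \<in> ball w0 r" "w + v \<in> ball w0 r" "w - v \<in> ball w0 r" for p w v
  proof -
    define u where "u = snd c p"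
    have u: "chart_inv c u = p" "u \<in> ball u0 (r2 / 2)" "u \<in> snd c ` (fst c \<inter> P)"
      using p by (auto simp: V_def u_def chart_inv_left[OF atlas_A c(1)])
    have T: "\<bar>h p (chart_inv d w') - h p (chart_inv d w) - f1 (u, w) (0, w' - w)\<bar> \<le> C * (norm (w' - w))\<^sup>2"
      if w': "w' \<in> ball w0 r" for w'
    proof -
      have "closed_segment w w' \<subseteq> ball w0 r" using w w' by (intro closed_segment_subset) auto
      moreover have "ball w0 r \<subseteq> ball w0 (r2 / 2)" using r by auto
      ultimately have "(\<lambda>w. (u, w)) ` closed_segment w w' \<subseteq> inner_set c d \<inter> ball (u0, w0) r2"
        using u(2,3) sub dist_Pair_less[of u0 u r2 w0] by fastforce
      then have "closed_segment (u, w) (u, w') \<subseteq> inner_set c d \<inter> ball (u0, w0) r2"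
        unfolding closed_segment_Pair_snd .
      then have "\<bar>coord c d (u, w') - coord c d (u, w) - f1 (u, w) ((u, w') - (u, w))\<bar> \<le> C * (norm ((u, w') - (u, w)))\<^sup>2"
        using r2(2) by (intro Taylor_bound[OF lip]) auto
      then show ?thesis by (simp add: u norm_Pair)
    qed
    have "(u, w) \<in> inner_set c d" using u(3) sub w(1) by blast
    \<comment> \<open>The first-order terms at \<open>w + v\<close> and \<open>w - v\<close> cancel;
      two Taylor errors remain, whence the constant \<open>2 * C\<close>.\<close>
    then have "f1 (u, w) (- (0, v)) = - f1 (u, w) (0, v)" by (rule linear_neg[OF linear1])
    then show ?thesis using T[OF w(2)] T[OF w(3)] by simp
  qed
  show ?thesis
  proof (rule that[of r "2 * C" V])
    show "0 < r" "0 < 2 * C" "open V" "p0 \<in> V" using r r2 V by auto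
    show "ball (snd d q0) r \<subseteq> snd d ` (fst d \<inter> Q)" using sub by (simp add: w0_def)
    fix p w v assume p: "p \<in> V \<inter> closure P"
      and w: "w \<in> ball (snd d q0) r" "w + v \<in> ball (snd d q0) r" "w - v \<in> ball (snd d q0) r"
    note w = w[folded w0_def]
    have "- (h p (chart_inv d (w + v)) + h p (chart_inv d (w - v)) - 2 * h p (chart_inv d w)) \<le> 2 * C * (norm v)\<^sup>2"
    proof (rule continuous_le_on_closure[where S="V \<inter> P"])
      have "chart_inv d w \<in> closure Q" "chart_inv d (w + v) \<in> closure Q" "chart_inv d (w - v) \<in> closure Q"
        using chart_inv_Q[OF d] sub w closure_subset[of Q] by blast+
      moreover have "closure (V \<inter> P) \<subseteq> closure P" by (intro closure_mono) auto
      ultimately show "continuous_on (closure (V \<inter> P)) (\<lambda>p. - (h p (chart_inv d (w + v)) + h p (chart_inv d (w - v)) - 2 * h p (chart_inv d w)))"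
        by (intro continuous_intros; elim continuous_on_subset[rotated]; intro continuous_on_h_fst)
      show "p \<in> closure (V \<inter> P)" using open_Int_closure_subset[OF V(1), of P] p by blast
    qed (use ineq w in blast)
    then show "- (2 * C) * (norm v)\<^sup>2 \<le> h p (chart_inv d (w + v)) + h p (chart_inv d (w - v)) - 2 * h p (chart_inv d w)"
      by simp
  qed
qed

end

section \<open>Surplus, contracts and the optimal map\<close>

text \<open>Coordinate balls whose closed versions stay in \<open>U\<close> cover it, and Lindelof
  leaves countably many. This is for the measurability of the contract map, whose preimages are
  accessible for compact sets.\<close>

lemma open_manifold_sigma_compact:
  fixes B :: "('q::{t2_space, second_countable_topology}, 'n::finite) chart set"
  assumes B: "smooth_atlas B" and U: "open (U :: 'q set)"
  obtains K where "countable K" "\<And>k. k \<in> K \<Longrightarrow> compact k" "\<Union>K = U"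
proof -
  define \<F> where "\<F> = {V. open V \<and> (\<exists>k. compact k \<and> V \<subseteq> k \<and> k \<subseteq> U)}"
  have "\<exists>V\<in>\<F>. q \<in> V" if q: "q \<in> U" for q
  proof -
    obtain d where d: "d \<in> B" "q \<in> fst d" using ex_chart[OF B] .
    have "snd d q \<in> snd d ` (fst d \<inter> U)" using d q by blast
    then obtain r where r: "0 < r" "cball (snd d q) r \<subseteq> snd d ` (fst d \<inter> U)"
      using chart_image_open[OF B d(1) U] unfolding open_contains_cball by blast
    define V where "V = {q' \<in> fst d. snd d q' \<in> ball (snd d q) r}"
    have "open V" unfolding V_def by (rule chart_preimage_open[OF B d(1) open_ball])
    moreover have "q \<in> V" using r(1) d by (simp add: V_def)
    moreover have "compact (chart_inv d ` cball (snd d q) r)"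
      using r(2) by (intro compact_continuous_image continuous_on_subset[OF chart_inv_cont[OF B d(1)]]) auto
    moreover have "V \<subseteq> chart_inv d ` cball (snd d q) r"
    proof
      fix q' assume "q' \<in> V"
      then have "q' = chart_inv d (snd d q')" "snd d q' \<in> cball (snd d q) r"
        by (auto simp: V_def chart_inv_left[OF B d(1)])
      then show "q' \<in> chart_inv d ` cball (snd d q) r" by blast
    qed
    moreover have "chart_inv d ` cball (snd d q) r \<subseteq> U"
    proof
      fix q' assume "q' \<in> chart_inv d ` cball (snd d q) r"
      then obtain w where w: "q' = chart_inv d w" "w \<in> cball (snd d q) r" by blast
      then obtain q'' where "q'' \<in> fst d" "q'' \<in> U" "w = snd d q''" using r(2) by blast
      then show "q' \<in> U" using w by (simp add: chart_inv_left[OF B d(1)])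
    qed
    ultimately show ?thesis unfolding \<F>_def by blast
  qed
  moreover have "\<Union>\<F> \<subseteq> U" unfolding \<F>_def by blast
  ultimately have U': "\<Union>\<F> = U" by blast
  obtain \<F>' where F': "\<F>' \<subseteq> \<F>" "countable \<F>'" "\<Union>\<F>' = \<Union>\<F>"
    using Lindelof[of \<F>] unfolding \<F>_def by blast
  have "\<forall>V\<in>\<F>'. \<exists>k. compact k \<and> V \<subseteq> k \<and> k \<subseteq> U" using F'(1) unfolding \<F>_def by blast
  then obtain \<kappa> where k: "\<And>V. V \<in> \<F>' \<Longrightarrow> compact (\<kappa> V)" "\<And>V. V \<in> \<F>' \<Longrightarrow> V \<subseteq> \<kappa> V"
    "\<And>V. V \<in> \<F>' \<Longrightarrow> \<kappa> V \<subseteq> U" by metis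
  have "\<Union>(\<kappa> ` \<F>') = U"
  proof
    show "\<Union>(\<kappa> ` \<F>') \<subseteq> U" using k(3) by blast
    show "U \<subseteq> \<Union>(\<kappa> ` \<F>')"
    proof
      fix q assume "q \<in> U"
      then obtain V where "V \<in> \<F>'" "q \<in> V" using U' F'(3) by blast
      then show "q \<in> \<Union>(\<kappa> ` \<F>')" using k(2) by blast
    qed
  qed
  then show ?thesis using that[of "\<kappa> ` \<F>'"] F'(2) k(1) by blast
qed

text \<open>The localisation takes place in the parameter \<open>t\<close> and not in the image
  point \<open>f t\<close>. The estimates below hold only near given values of all components of a
  triple, and one point \<open>x\<close> may belong to several triples.\<close>

lemma hausdorff_dim_locally_le:
  fixes \<Gamma> :: "'t::second_countable_topology set" and f :: "'t \<Rightarrow> 'a::metric_space"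
  assumes "0 \<le> s" and loc: "\<And>t. t \<in> \<Gamma> \<Longrightarrow> \<exists>U. open U \<and> t \<in> U \<and> hausdorff_dim (f ` (\<Gamma> \<inter> U)) \<le> s"
  shows "hausdorff_dim (f ` \<Gamma>) \<le> s"
proof -
  define \<F> where "\<F> = {U. open U \<and> hausdorff_dim (f ` (\<Gamma> \<inter> U)) \<le> s}"
  obtain \<F>' where F': "\<F>' \<subseteq> \<F>" "countable \<F>'" "\<Union>\<F>' = \<Union>\<F>"
    using Lindelof[of \<F>] unfolding \<F>_def by blast
  have "\<Gamma> \<subseteq> \<Union>\<F>" unfolding \<F>_def using loc by blast
  then have "f ` \<Gamma> \<subseteq> (\<Union>U\<in>\<F>'. f ` (\<Gamma> \<inter> U))" unfolding F'(3)[symmetric] by blast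
  then have "hausdorff_dim (f ` \<Gamma>) \<le> hausdorff_dim (\<Union>U\<in>\<F>'. f ` (\<Gamma> \<inter> U))"
    by (rule hausdorff_dim_mono)
  also have "\<dots> \<le> s"
    using F' assms(1) unfolding \<F>_def by (intro hausdorff_dim_countable_UN_le) auto
  finally show ?thesis .
qed

section \<open>The surplus and the contract\<close>

locale hedonic = H: C2_on_manifolds AX AZ X Z h + G: C2_on_manifolds AY AZ Y Z g
  for AX :: "('x::{t2_space, second_countable_topology}, 'n::finite) chart set"
    and AY :: "('y::{t2_space, second_countable_topology}, 'n) chart set"
    and AZ :: "('z::{t2_space, second_countable_topology}, 'n) chart set"
    and X Y Z h g +
  assumes compact_X: "compact (closure X)" and compact_Y: "compact (closure Y)" and compact_Z: "compact (closure Z)"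
    and unique_maximizer: "\<And>x y. x \<in> closure X \<Longrightarrow> y \<in> closure Y \<Longrightarrow>
           \<exists>!z. z \<in> Z \<and> h x z + g y z = surplus h g Z x y"
begin

abbreviation b :: "'x \<Rightarrow> 'y \<Rightarrow> real" where "b \<equiv> surplus h g Z"

abbreviation contr :: "'x \<Rightarrow> 'y \<Rightarrow> 'z" where "contr \<equiv> contract h g Z"

lemma contr:
  assumes "x \<in> closure X" "y \<in> closure Y"
  shows contr_in: "contr x y \<in> Z" and contr_value: "h x (contr x y) + g y (contr x y) = b x y"
    and contr_eqI: "\<And>z. z \<in> Z \<Longrightarrow> h x z + g y z = b x y \<Longrightarrow> contr x y = z"
proof -
  show "contr x y \<in> Z" "h x (contr x y) + g y (contr x y) = b x y"
    using theI'[OF unique_maximizer[OF assms]] unfolding contract_def by blast+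
  show "contr x y = z" if "z \<in> Z" "h x z + g y z = b x y" for z
    unfolding contract_def using that by (intro the1_equality unique_maximizer assms) simp
qed

lemma contr_in_closure: "x \<in> closure X \<Longrightarrow> y \<in> closure Y \<Longrightarrow> contr x y \<in> closure Z"
  by (rule subsetD[OF closure_subset contr_in])

lemma value_le:
  assumes "x \<in> closure X" "y \<in> closure Y" "z \<in> closure Z"
  shows "h x z + g y z \<le> b x y"
proof (rule continuous_le_on_closure[OF _ assms(3)])
  show cont: "continuous_on (closure Z) (\<lambda>z. h x z + g y z)"
    using H.continuous_on_h_snd[OF assms(1)] G.continuous_on_h_snd[OF assms(2)] by (rule continuous_on_add)
  \<comment> \<open>A real supremum is meaningful only for a bounded family; the bound comes from
    compactness of \<open>closure Z\<close>.\<close>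
  have "bdd_above ((\<lambda>z. h x z + g y z) ` closure Z)"
    by (intro bounded_imp_bdd_above compact_imp_bounded compact_continuous_image cont compact_Z)
  then have "bdd_above ((\<lambda>z. h x z + g y z) ` Z)"
    by (rule bdd_above_mono) (intro image_mono closure_subset)
  then show "h x z + g y z \<le> b x y" if "z \<in> Z" for z
    unfolding surplus_def using that by (intro cSUP_upper)
qed

lemma continuous_on_value:
  "continuous_on ((closure X \<times> closure Y) \<times> closure Z) (\<lambda>(p, z). h (fst p) z + g (snd p) z)"
proof -
  let ?P = "(closure X \<times> closure Y) \<times> closure Z"
  have "continuous_on ?P (\<lambda>t. (\<lambda>(x, z). h x z) (fst (fst t), snd t))"
    by (rule continuous_on_compose2[OF H.continuous_on_h]) (auto intro!: continuous_intros)
  moreover have "continuous_on ?P (\<lambda>t. (\<lambda>(y, z). g y z) (snd (fst t), snd t))"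
    by (rule continuous_on_compose2[OF G.continuous_on_h]) (auto intro!: continuous_intros)
  ultimately have "continuous_on ?P (\<lambda>t. (\<lambda>(x, z). h x z) (fst (fst t), snd t) + (\<lambda>(y, z). g y z) (snd (fst t), snd t))"
    by (rule continuous_on_add)
  then show ?thesis by (simp add: case_prod_unfold)
qed

text \<open>From below, a maximiser at \<open>p\<close> remains a competitor at nearby pairs. From
  above, the tube lemma makes all values small near \<open>p\<close>, and \<open>b\<close> is itself
  one of these values because the supremum is attained.\<close>

lemma continuous_on_b: "continuous_on (closure X \<times> closure Y) (\<lambda>p. b (fst p) (snd p))"
  unfolding continuous_on_def
proof (intro ballI order_tendstoI)
  let ?P = "closure X \<times> closure Y"
  fix p a assume p: "p \<in> ?P"
  then have p': "fst p \<in> closure X" "snd p \<in> closure Y" by auto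
  { assume a: "a < b (fst p) (snd p)"
    define z where "z = contr (fst p) (snd p)"
    have z: "z \<in> closure Z" "h (fst p) z + g (snd p) z = b (fst p) (snd p)"
      unfolding z_def using contr_in[OF p'] contr_value[OF p'] by (auto intro: subsetD[OF closure_subset])
    have contz: "continuous_on ?P (\<lambda>p. (\<lambda>(p, z). h (fst p) z + g (snd p) z) (p, z))"
      using z(1) by (intro continuous_on_compose2[OF continuous_on_value]) (auto intro!: continuous_intros)
    have "((\<lambda>p. h (fst p) z + g (snd p) z) \<longlongrightarrow> b (fst p) (snd p)) (at p within ?P)"
      using bspec[OF contz[unfolded continuous_on_def] p] z(2) by simp
    then have "\<forall>\<^sub>F p' in at p within ?P. a < h (fst p') z + g (snd p') z"
      using a by (rule order_tendstoD)
    moreover have "\<forall>\<^sub>F p' in at p within ?P. p' \<in> ?P" by (simp add: eventually_at_filter)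
    ultimately show "\<forall>\<^sub>F p' in at p within ?P. a < b (fst p') (snd p')"
    proof eventually_elim
      case (elim p')
      then have "h (fst p') z + g (snd p') z \<le> b (fst p') (snd p')" by (intro value_le z) auto
      then show ?case using elim(1) by linarith
    qed }
  { assume a: "b (fst p) (snd p) < a"
    have "continuous_on (?P \<times> closure Z) (\<lambda>(p, z). h (fst p) z + g (snd p) z - a)"
      using continuous_on_diff[OF continuous_on_value continuous_on_const[of _ a]] by (simp add: case_prod_unfold)
    moreover have "h (fst p) z + g (snd p) z - a < 0" if "z \<in> closure Z" for z
      using value_le[OF p' that] a by linarith
    ultimately obtain U where U: "open U" "p \<in> U" "\<And>p' z. p' \<in> U \<inter> ?P \<Longrightarrow> z \<in> closure Z \<Longrightarrow> h (fst p') z + g (snd p') z - a < 0"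
      using compact_tube_less[OF compact_Z, of ?P "\<lambda>p z. h (fst p) z + g (snd p) z - a" p] p by blast
    have "b (fst p') (snd p') < a" if "p' \<in> U \<inter> ?P" for p'
    proof -
      have c: "fst p' \<in> closure X" "snd p' \<in> closure Y" using that by auto
      then have "contr (fst p') (snd p') \<in> closure Z" by (rule contr_in_closure)
      then show ?thesis using U(3)[OF that] contr_value[OF c] by fastforce
    qed
    then show "\<forall>\<^sub>F p' in at p within ?P. b (fst p') (snd p') < a"
      unfolding eventually_at_topological using U(1,2) by blast }
qed

lemma not_maximizer_open:
  assumes "compact K" "K \<subseteq> closure Z" and x: "x \<in> closure X" and y: "y \<in> closure Y"
    and less: "\<And>z. z \<in> K \<Longrightarrow> h x z + g y z < b x y"
  obtains U V where "open U" "open V" "x \<in> U" "y \<in> V"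
    "\<And>x' y' z. x' \<in> U \<Longrightarrow> x' \<in> closure X \<Longrightarrow> y' \<in> V \<Longrightarrow> y' \<in> closure Y \<Longrightarrow> z \<in> K \<Longrightarrow> h x' z + g y' z < b x' y'"
proof -
  let ?P = "closure X \<times> closure Y"
  have "continuous_on (?P \<times> K) (\<lambda>t. (\<lambda>(p, z). h (fst p) z + g (snd p) z) t - b (fst (fst t)) (snd (fst t)))"
  proof (rule continuous_on_diff)
    show "continuous_on (?P \<times> K) (\<lambda>(p, z). h (fst p) z + g (snd p) z)"
      using assms(2) by (intro continuous_on_subset[OF continuous_on_value] Sigma_mono) auto
    show "continuous_on (?P \<times> K) (\<lambda>t. b (fst (fst t)) (snd (fst t)))"
      by (rule continuous_on_compose2[OF continuous_on_b]) (auto intro!: continuous_intros)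
  qed
  then have cont: "continuous_on (?P \<times> K) (\<lambda>(p, z). h (fst p) z + g (snd p) z - b (fst p) (snd p))"
    by (simp add: case_prod_unfold)
  have "h (fst (x, y)) z + g (snd (x, y)) z - b (fst (x, y)) (snd (x, y)) < 0" if "z \<in> K" for z
    using less[OF that] by simp
  then obtain W where W: "open W" "(x, y) \<in> W"
    "\<And>p z. p \<in> W \<inter> ?P \<Longrightarrow> z \<in> K \<Longrightarrow> h (fst p) z + g (snd p) z - b (fst p) (snd p) < 0"
    using compact_tube_less[OF assms(1) cont, of "(x, y)"] x y by blast
  obtain U V where UV: "open U" "open V" "(x, y) \<in> U \<times> V" "U \<times> V \<subseteq> W"
    using open_prod_elim[OF W(1,2)] by blast
  show ?thesis
  proof (rule that[of U V])
    show "open U" "open V" "x \<in> U" "y \<in> V" using UV by auto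
    show "h x' z + g y' z < b x' y'"
      if "x' \<in> U" "x' \<in> closure X" "y' \<in> V" "y' \<in> closure Y" "z \<in> K" for x' y' z
      using W(3)[of "(x', y')" z] that UV(4) by auto
  qed
qed

text \<open>Continuity of the contract where the maximiser is unique in all of
  \<open>closure Z\<close>. The points of \<open>closure Z - V\<close> form a compact set on which
  the maximum is missed, and this persists nearby. A second maximiser on the boundary of
  \<open>Z\<close> could attract the contracts of nearby pairs.\<close>

lemma contr_near:
  assumes x: "x \<in> closure X" and y: "y \<in> closure Y" and V: "open V" "contr x y \<in> V"
    and unique: "\<And>z. z \<in> closure Z \<Longrightarrow> h x z + g y z = b x y \<Longrightarrow> z = contr x y"
  obtains U W where "open U" "open W" "x \<in> U" "y \<in> W"
    "\<And>x' y'. x' \<in> U \<Longrightarrow> x' \<in> closure X \<Longrightarrow> y' \<in> W \<Longrightarrow> y' \<in> closure Y \<Longrightarrow> contr x' y' \<in> V"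
proof -
  have comp: "compact (closure Z - V)" using compact_Z V(1) by (rule compact_diff)
  have less: "h x z + g y z < b x y" if "z \<in> closure Z - V" for z
    using value_le[OF x y, of z] unique[of z] that V(2) by fastforce
  obtain U W where UW: "open U" "open W" "x \<in> U" "y \<in> W"
    "\<And>x' y' z. x' \<in> U \<Longrightarrow> x' \<in> closure X \<Longrightarrow> y' \<in> W \<Longrightarrow> y' \<in> closure Y \<Longrightarrow> z \<in> closure Z - V \<Longrightarrow> h x' z + g y' z < b x' y'"
    by (rule not_maximizer_open[OF comp Diff_subset x y less]) (assumption | rule that)+
  show ?thesis
  proof (rule that[OF UW(1-4)])
    fix x' y' assume xy: "x' \<in> U" "x' \<in> closure X" "y' \<in> W" "y' \<in> closure Y"
    show "contr x' y' \<in> V"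
    proof (rule ccontr)
      assume "contr x' y' \<notin> V"
      then have "contr x' y' \<in> closure Z - V" using contr_in_closure[OF xy(2,4)] by simp
      from UW(5)[OF xy this] show False using contr_value[OF xy(2,4)] by simp
    qed
  qed
qed

end

section \<open>Measurability along the transport map\<close>

locale hedonic_transport = hedonic AX AY AZ X Y Z h g
  for AX :: "('x::{t2_space, second_countable_topology}, 'n::finite) chart set"
    and AY :: "('y::{t2_space, second_countable_topology}, 'n) chart set"
    and AZ :: "('z::{t2_space, second_countable_topology}, 'n) chart set"
    and X Y Z h g +
  fixes \<mu> :: "'x measure" and \<nu> :: "'y measure" and F :: "'x \<Rightarrow> 'y"
  assumes mu: "borel_prob_on X \<mu>" and nu: "borel_prob_on Y \<nu>"
    and monge: "monge_solution (surplus h g Z) \<mu> \<nu> F"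
    and atomless: "\<And>x. x \<in> X \<Longrightarrow> emeasure \<mu> {x} = 0"
begin

sublocale prob_space \<mu> using mu by (simp add: borel_prob_on_def)

lemma sets_mu: "sets \<mu> = sets (restrict_space borel X)" and sets_nu: "sets \<nu> = sets (restrict_space borel Y)"
  using mu nu by (simp_all add: borel_prob_on_def)

lemma space_mu [simp]: "space \<mu> = X" and space_nu [simp]: "space \<nu> = Y"
  using sets_eq_imp_space_eq[OF sets_mu] sets_eq_imp_space_eq[OF sets_nu] by (simp_all add: space_restrict_space)

lemma measurable_mu_nu_iff: "T \<in> measurable M \<nu> \<longleftrightarrow> T \<in> measurable M borel \<and> T \<in> space M \<rightarrow> Y"
  using measurable_cong_sets[OF refl sets_nu, of M] measurable_restrict_space2_iff[of T M borel Y] by blast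

lemma measurable_mu_iff: "T \<in> measurable M \<mu> \<longleftrightarrow> T \<in> measurable M borel \<and> T \<in> space M \<rightarrow> X"
  using measurable_cong_sets[OF refl sets_mu, of M] measurable_restrict_space2_iff[of T M borel X] by blast

lemma ident_borel [measurable]: "(\<lambda>x. x) \<in> measurable \<mu> borel"
  using measurable_mu_iff[of "\<lambda>x. x" \<mu>] by auto

lemma F_transport: "F \<in> measurable \<mu> \<nu>" "distr \<mu> \<nu> F = \<nu>"
  using monge by (auto simp: monge_solution_def transport_map_def)

lemma F_borel [measurable]: "F \<in> measurable \<mu> borel" and F_Y: "x \<in> X \<Longrightarrow> F x \<in> Y"
  using F_transport(1) measurable_mu_nu_iff[of F \<mu>] by auto

lemma measurable_b:
  assumes "T \<in> measurable \<mu> \<nu>"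
  shows "(\<lambda>x. b x (T x)) \<in> borel_measurable \<mu>"
proof -
  have T: "T \<in> measurable \<mu> borel" "\<And>x. x \<in> X \<Longrightarrow> T x \<in> Y" using assms measurable_mu_nu_iff[of T \<mu>] by auto
  have XY: "X \<times> Y \<in> sets borel" by (intro borel_open open_Times H.open_P G.open_P)
  have "X \<times> Y \<subseteq> closure X \<times> closure Y" by (intro Sigma_mono closure_subset)
  then have "(\<lambda>p. indicator (X \<times> Y) p *\<^sub>R b (fst p) (snd p)) \<in> borel_measurable borel"
    by (intro borel_measurable_continuous_on_indicator XY continuous_on_subset[OF continuous_on_b])
  moreover have "(\<lambda>x. (x, T x)) \<in> measurable \<mu> (borel \<Otimes>\<^sub>M borel)"
    using T(1) ident_borel by (intro measurable_Pair)
  then have "(\<lambda>x. (x, T x)) \<in> measurable \<mu> borel" by (simp add: borel_prod)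
  ultimately have "(\<lambda>p. indicator (X \<times> Y) p *\<^sub>R b (fst p) (snd p)) \<circ> (\<lambda>x. (x, T x)) \<in> borel_measurable \<mu>"
    by (rule measurable_comp[rotated])
  then show ?thesis by (rule measurable_cong[THEN iffD1, rotated]) (simp add: T(2))
qed

lemma integrable_b:
  assumes "T \<in> measurable \<mu> \<nu>"
  shows "integrable \<mu> (\<lambda>x. b x (T x))"
proof -
  have "compact ((\<lambda>p. b (fst p) (snd p)) ` (closure X \<times> closure Y))"
    by (intro compact_continuous_image continuous_on_b compact_Times compact_X compact_Y)
  then have "bounded ((\<lambda>p. b (fst p) (snd p)) ` (closure X \<times> closure Y))" by (rule compact_imp_bounded)
  then obtain C where "\<forall>p\<in>closure X \<times> closure Y. \<bar>b (fst p) (snd p)\<bar> \<le> C"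
    unfolding bounded_iff by auto
  then have C: "\<bar>b x y\<bar> \<le> C" if "x \<in> closure X" "y \<in> closure Y" for x y
    using that by force
  show ?thesis
  proof (rule integrable_const_bound[where B=C])
    have "\<bar>b x (T x)\<bar> \<le> C" if "x \<in> X" for x
      using that assms closure_subset[of X] closure_subset[of Y] measurable_space[OF assms, of x] by (intro C) auto
    then show "AE x in \<mu>. norm (b x (T x)) \<le> C" by (intro AE_I2) simp
  qed (rule measurable_b[OF assms])
qed

text \<open>No continuity of \<open>contr\<close> is used. For compact \<open>K\<close> inside
  \<open>Z\<close>, the contract lies in \<open>K\<close> exactly when some point of
  \<open>K\<close> attains the maximum, by uniqueness in \<open>Z\<close>; missing the maximum on
  \<open>K\<close> is an open condition on the pair. Open sets are then countable unions of compact
  ones.\<close>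

lemma measurable_contr: "(\<lambda>x. contr x (F x)) \<in> measurable \<mu> (restrict_space borel Z)"
proof (rule measurable_restrict_space2)
  have XF: "x \<in> closure X" "F x \<in> closure Y" if "x \<in> X" for x
    using that F_Y closure_subset[of X] closure_subset[of Y] by auto
  show Z: "(\<lambda>x. contr x (F x)) \<in> space \<mu> \<rightarrow> Z" using XF contr_in by auto
  have compact: "{x \<in> X. contr x (F x) \<in> K} \<in> sets \<mu>" if K: "compact K" "K \<subseteq> Z" for K
  proof -
    have KZ: "K \<subseteq> closure Z" using K(2) closure_subset by (rule subset_trans)
    define D where "D = {p \<in> X \<times> Y. \<forall>z\<in>K. h (fst p) z + g (snd p) z < b (fst p) (snd p)}"
    have "open D"
      unfolding open_subopen[of D]
    proof
      fix p assume "p \<in> D"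
      then have p: "fst p \<in> X" "snd p \<in> Y" "\<And>z. z \<in> K \<Longrightarrow> h (fst p) z + g (snd p) z < b (fst p) (snd p)"
        by (auto simp: D_def)
      obtain U V where UV: "open U" "open V" "fst p \<in> U" "snd p \<in> V"
        "\<And>x' y' z. x' \<in> U \<Longrightarrow> x' \<in> closure X \<Longrightarrow> y' \<in> V \<Longrightarrow> y' \<in> closure Y \<Longrightarrow> z \<in> K \<Longrightarrow> h x' z + g y' z < b x' y'"
        by (rule not_maximizer_open[OF K(1) KZ subsetD[OF closure_subset p(1)] subsetD[OF closure_subset p(2)] p(3)])
          (assumption | rule that)+
      have "(U \<inter> X) \<times> (V \<inter> Y) \<subseteq> D"
      proof
        fix p' assume "p' \<in> (U \<inter> X) \<times> (V \<inter> Y)"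
        then have p': "fst p' \<in> U" "fst p' \<in> X" "snd p' \<in> V" "snd p' \<in> Y" by auto
        have "h (fst p') z + g (snd p') z < b (fst p') (snd p')" if "z \<in> K" for z
          using p' that by (intro UV(5) subsetD[OF closure_subset p'(2)] subsetD[OF closure_subset p'(4)])
        then show "p' \<in> D" using p' by (simp add: D_def mem_Times_iff)
      qed
      moreover have "open ((U \<inter> X) \<times> (V \<inter> Y))" using UV H.open_P G.open_P by (intro open_Times open_Int)
      moreover have "p \<in> (U \<inter> X) \<times> (V \<inter> Y)" using UV p by (simp add: mem_Times_iff)
      ultimately show "\<exists>T. open T \<and> p \<in> T \<and> T \<subseteq> D" by blast
    qed
    have "contr x (F x) \<in> K \<longleftrightarrow> (x, F x) \<notin> D" if x: "x \<in> X" for x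
    proof
      assume "contr x (F x) \<in> K"
      then show "(x, F x) \<notin> D" using contr_value[OF XF[OF x]] by (force simp: D_def)
    next
      assume "(x, F x) \<notin> D"
      then obtain z where z: "z \<in> K" "\<not> h x z + g (F x) z < b x (F x)" using x F_Y by (auto simp: D_def)
      then have "h x z + g (F x) z = b x (F x)" using value_le[OF XF[OF x], of z] KZ by force
      then show "contr x (F x) \<in> K" using contr_eqI[OF XF[OF x]] z(1) K(2) by blast
    qed
    then have "{x \<in> X. contr x (F x) \<in> K} = {x \<in> space \<mu>. (x, F x) \<notin> D}" by auto
    also have "\<dots> \<in> sets \<mu>"
    proof -
      have "(\<lambda>x. (x, F x)) \<in> measurable \<mu> (borel \<Otimes>\<^sub>M borel)" by (intro measurable_Pair ident_borel F_borel)
      then have "(\<lambda>x. (x, F x)) \<in> measurable \<mu> borel" by (simp add: borel_prod)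
      from measurable_sets[OF this borel_closed[of "- D"]] \<open>open D\<close> show ?thesis
        by (simp add: vimage_def Int_def conj_commute closed_def)
    qed
    finally show ?thesis .
  qed
  show "(\<lambda>x. contr x (F x)) \<in> measurable \<mu> borel"
  proof (rule borel_measurableI)
    fix U :: "'z set" assume "open U"
    then have "open (U \<inter> Z)" using H.open_Q by (rule open_Int)
    then obtain \<K> where K: "countable \<K>" "\<And>k. k \<in> \<K> \<Longrightarrow> compact k" "\<Union>\<K> = U \<inter> Z"
      by (rule open_manifold_sigma_compact[OF H.atlas_B]) blast
    have "(\<lambda>x. contr x (F x)) -` U \<inter> space \<mu> = (\<Union>k\<in>\<K>. {x \<in> X. contr x (F x) \<in> k})"
    proof -
      have "(\<lambda>x. contr x (F x)) -` U \<inter> space \<mu> = {x \<in> X. contr x (F x) \<in> U \<inter> Z}" using Z by auto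
      then show ?thesis unfolding K(3)[symmetric] by blast
    qed
    moreover have "{x \<in> X. contr x (F x) \<in> k} \<in> sets \<mu>" if "k \<in> \<K>" for k
    proof (rule compact[OF K(2)[OF that]])
      show "k \<subseteq> Z" using K(3) that by blast
    qed
    ultimately show "(\<lambda>x. contr x (F x)) -` U \<inter> space \<mu> \<in> sets \<mu>"
      using K(1) by (auto intro!: sets.countable_UN')
  qed
qed

section \<open>The support of the graph of \<open>F\<close>\<close>

text \<open>The support of the push-forward of \<open>\<mu>\<close> under
  \<open>\<lambda>x. (x, F x)\<close>, tested on boxes. The second component ranges over
  \<open>closure Y\<close>, because the values of \<open>F\<close> near \<open>x\<close> may
  accumulate outside \<open>Y\<close>.\<close>

definition graph_support :: "('x \<times> 'y) set" where
  "graph_support = {(x, y). x \<in> X \<and> y \<in> closure Y \<and>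
     (\<forall>U V. open U \<longrightarrow> open V \<longrightarrow> x \<in> U \<longrightarrow> y \<in> V \<longrightarrow> emeasure \<mu> {x' \<in> X. x' \<in> U \<and> F x' \<in> V} \<noteq> 0)}"

lemma graph_supportD:
  assumes "(x, y) \<in> graph_support"
  shows "x \<in> X" "x \<in> closure X" "y \<in> closure Y"
    and "\<And>U V. open U \<Longrightarrow> open V \<Longrightarrow> x \<in> U \<Longrightarrow> y \<in> V \<Longrightarrow> emeasure \<mu> {x' \<in> X. x' \<in> U \<and> F x' \<in> V} \<noteq> 0"
  using assms closure_subset[of X] unfolding graph_support_def by auto

lemma sets_box [measurable]: "open U \<Longrightarrow> open V \<Longrightarrow> {x \<in> X. x \<in> U \<and> F x \<in> V} \<in> sets \<mu>"
proof -
  assume UV: "open U" "open V"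
  have "((\<lambda>x. x) -` U \<inter> space \<mu>) \<inter> (F -` V \<inter> space \<mu>) \<in> sets \<mu>"
    by (intro sets.Int measurable_sets[OF ident_borel] measurable_sets[OF F_borel] borel_open UV)
  also have "((\<lambda>x. x) -` U \<inter> space \<mu>) \<inter> (F -` V \<inter> space \<mu>) = {x \<in> X. x \<in> U \<and> F x \<in> V}" by auto
  finally show ?thesis .
qed

text \<open>Otherwise each \<open>y\<close> would have a box of measure zero around
  \<open>(x, y)\<close>. Finitely many of these boxes cover \<open>closure Y\<close>, and the
  intersection of their first sides would be a null neighbourhood of \<open>x\<close>.\<close>

lemma ex_graph_support:
  assumes "x \<in> msupport \<mu>"
  shows "\<exists>y. (x, y) \<in> graph_support"
proof (rule ccontr)
  assume no: "\<not> ?thesis"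
  have x: "x \<in> X" "\<And>U. open U \<Longrightarrow> x \<in> U \<Longrightarrow> emeasure \<mu> (U \<inter> X) \<noteq> 0"
    using assms by (auto simp: msupport_def)
  have "\<forall>y\<in>closure Y. \<exists>U V. open U \<and> open V \<and> x \<in> U \<and> y \<in> V \<and> emeasure \<mu> {x' \<in> X. x' \<in> U \<and> F x' \<in> V} = 0"
    using no x(1) unfolding graph_support_def by blast
  then have "\<forall>y\<in>closure Y. \<exists>UV. open (fst UV) \<and> open (snd UV) \<and> x \<in> fst UV \<and> y \<in> snd UV \<and>
      emeasure \<mu> {x' \<in> X. x' \<in> fst UV \<and> F x' \<in> snd UV} = 0" by simp
  from bchoice[OF this] obtain f where f: "\<forall>y\<in>closure Y. open (fst (f y)) \<and> open (snd (f y)) \<and> x \<in> fst (f y) \<and>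
      y \<in> snd (f y) \<and> emeasure \<mu> {x' \<in> X. x' \<in> fst (f y) \<and> F x' \<in> snd (f y)} = 0" ..
  define U V where "U y = fst (f y)" and "V y = snd (f y)" for y
  have UV: "open (U y)" "open (V y)" "x \<in> U y" "y \<in> V y" "emeasure \<mu> {x' \<in> X. x' \<in> U y \<and> F x' \<in> V y} = 0"
    if "y \<in> closure Y" for y
    using bspec[OF f that] by (simp_all add: U_def V_def)
  obtain D where D: "D \<subseteq> closure Y" "finite D" "closure Y \<subseteq> (\<Union>y\<in>D. V y)"
  proof (rule compactE_image[OF compact_Y, of "closure Y" V])
    show "closure Y \<subseteq> (\<Union>y\<in>closure Y. V y)" using UV(4) by blast
  qed (use UV in auto)
  define W where "W = (\<Inter>y\<in>D. U y)"
  have "open W" "x \<in> W" unfolding W_def using D UV by auto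
  have "W \<inter> X \<subseteq> (\<Union>y\<in>D. {x' \<in> X. x' \<in> U y \<and> F x' \<in> V y})"
  proof
    fix x' assume x': "x' \<in> W \<inter> X"
    then have "F x' \<in> closure Y" using F_Y closure_subset[of Y] by auto
    then obtain y where "y \<in> D" "F x' \<in> V y" using D(3) by blast
    then show "x' \<in> (\<Union>y\<in>D. {x' \<in> X. x' \<in> U y \<and> F x' \<in> V y})" using x' unfolding W_def by blast
  qed
  then have "emeasure \<mu> (W \<inter> X) \<le> emeasure \<mu> (\<Union>y\<in>D. {x' \<in> X. x' \<in> U y \<and> F x' \<in> V y})"
    using D UV by (intro emeasure_mono sets.finite_UN sets_box) auto
  also have "\<dots> \<le> (\<Sum>y\<in>D. emeasure \<mu> {x' \<in> X. x' \<in> U y \<and> F x' \<in> V y})"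
    using D UV by (intro emeasure_subadditive_finite) (auto intro!: sets_box)
  also have "\<dots> = 0" using D UV by (intro sum.neutral) auto
  finally show False using x(2)[OF \<open>open W\<close> \<open>x \<in> W\<close>] by simp
qed

text \<open>By \<open>contr_near\<close> a box around \<open>(x, y)\<close> is sent into a given
  neighbourhood of the contract, and the part of the graph of \<open>F\<close> over that box has
  positive mass.\<close>

lemma contr_in_support:
  assumes G: "(x, y) \<in> graph_support"
    and unique: "\<And>z. z \<in> closure Z \<Longrightarrow> h x z + g y z = b x y \<Longrightarrow> z = contr x y"
  shows "contr x y \<in> msupport (distr \<mu> (restrict_space borel Z) (\<lambda>x. contr x (F x)))"
proof -
  let ?D = "distr \<mu> (restrict_space borel Z) (\<lambda>x. contr x (F x))"
  note xy = graph_supportD[OF G]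
  have "emeasure ?D (O' \<inter> space ?D) \<noteq> 0" if O': "open O'" "contr x y \<in> O'" for O'
  proof -
    obtain U W where UW: "open U" "open W" "x \<in> U" "y \<in> W"
      "\<And>x' y'. x' \<in> U \<Longrightarrow> x' \<in> closure X \<Longrightarrow> y' \<in> W \<Longrightarrow> y' \<in> closure Y \<Longrightarrow> contr x' y' \<in> O'"
      by (rule contr_near[OF xy(2,3) O' unique]) (assumption | rule that)+
    have O: "O' \<inter> Z \<in> sets (restrict_space borel Z)"
      using O'(1) by (auto simp: sets_restrict_space)
    have "emeasure \<mu> {x' \<in> X. x' \<in> U \<and> F x' \<in> W} \<le> emeasure \<mu> ((\<lambda>x. contr x (F x)) -` (O' \<inter> Z) \<inter> space \<mu>)"
    proof (rule emeasure_mono)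
      show "(\<lambda>x. contr x (F x)) -` (O' \<inter> Z) \<inter> space \<mu> \<in> sets \<mu>"
        by (rule measurable_sets[OF measurable_contr O])
      show "{x' \<in> X. x' \<in> U \<and> F x' \<in> W} \<subseteq> (\<lambda>x. contr x (F x)) -` (O' \<inter> Z) \<inter> space \<mu>"
      proof
        fix x' assume "x' \<in> {x' \<in> X. x' \<in> U \<and> F x' \<in> W}"
        then have x': "x' \<in> X" "x' \<in> U" "F x' \<in> W" by auto
        then have cl: "x' \<in> closure X" "F x' \<in> closure Y"
          using F_Y closure_subset[of X] closure_subset[of Y] by auto
        then show "x' \<in> (\<lambda>x. contr x (F x)) -` (O' \<inter> Z) \<inter> space \<mu>"
          using UW(5)[OF x'(2) cl(1) x'(3) cl(2)] contr_in[OF cl] x'(1) by simp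
      qed
    qed
    moreover have "emeasure \<mu> {x' \<in> X. x' \<in> U \<and> F x' \<in> W} \<noteq> 0" by (rule xy(4)[OF UW(1-4)])
    ultimately have "emeasure \<mu> ((\<lambda>x. contr x (F x)) -` (O' \<inter> Z) \<inter> space \<mu>) \<noteq> 0" by auto
    then show ?thesis
      by (simp add: emeasure_distr[OF measurable_contr O] space_restrict_space)
  qed
  then show ?thesis
    using contr_in[OF xy(2,3)] by (simp add: msupport_def space_restrict_space)
qed

section \<open>The exchange argument\<close>

text \<open>Coordinates followed by the real code are injective on the chart, so a level set of
  \<open>f\<close> there has at most one point and is null. Off the chart, and off the coordinate
  range of \<open>X\<close>, constants serve as default values.\<close>

lemma Borel_code_on_chart:
  assumes c: "c \<in> AX" and x0: "x0 \<in> X"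
  obtains f p where "f \<in> borel_measurable \<mu>" "p \<in> measurable borel \<mu>" "\<And>x. x \<in> X \<inter> fst c \<Longrightarrow> p (f x) = (x::'x)"
    "\<And>t. measure \<mu> {x \<in> X \<inter> fst c. f x = (t::real)} = 0"
proof -
  obtain code :: "real ^ 'n \<Rightarrow> real" and decode where code: "code \<in> borel_measurable borel"
    "decode \<in> borel_measurable borel" "\<And>x. decode (code x) = x"
    using ex_Borel_code by blast
  define f where "f x = code (if x \<in> fst c then snd c x else 0)" for x
  define U where "U = snd c ` (fst c \<inter> X)"
  define p where "p t = (if decode t \<in> U then chart_inv c (decode t) else x0)" for t
  have "open U" unfolding U_def by (rule chart_image_open[OF H.atlas_A c H.open_P])
  have p_f: "p (f x) = x" if "x \<in> X \<inter> fst c" for x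
  proof -
    have "decode (f x) = snd c x" using that by (simp add: f_def code(3))
    moreover have "snd c x \<in> U" unfolding U_def using that by blast
    ultimately show ?thesis using that by (simp add: p_def chart_inv_left[OF H.atlas_A c])
  qed
  have "(\<lambda>x. if x \<in> fst c then snd c x else 0) \<in> borel_measurable borel"
    by (intro borel_measurable_continuous_on_if borel_open chart_open[OF H.atlas_A c] chart_cont[OF H.atlas_A c]
        continuous_on_const)
  from measurable_compose[OF measurable_compose[OF ident_borel this] code(1)]
  have f: "f \<in> borel_measurable \<mu>" unfolding f_def .
  have U_sub: "U \<subseteq> snd c ` fst c" unfolding U_def by blast
  have "(\<lambda>u. if u \<in> U then chart_inv c u else x0) \<in> borel_measurable borel"
    using \<open>open U\<close> by (intro borel_measurable_continuous_on_if borel_open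
        continuous_on_subset[OF chart_inv_cont[OF H.atlas_A c] U_sub] continuous_on_const)
  from measurable_compose[OF code(2) this] have "p \<in> borel_measurable borel" unfolding p_def .
  moreover have "p t \<in> X" for t
    using x0 H.chart_inv_P[OF c] by (simp add: p_def U_def)
  ultimately have "p \<in> measurable borel \<mu>" unfolding measurable_mu_iff by blast
  moreover have "measure \<mu> {x \<in> X \<inter> fst c. f x = t} = 0" for t
  proof -
    have sub: "{x \<in> X \<inter> fst c. f x = t} \<subseteq> {p t}" using p_f by auto
    have "p t \<in> X" by fact
    then have "measure \<mu> {p t} = 0" using atomless[of "p t"] by (simp add: measure_def)
    moreover have "{p t} \<in> sets \<mu>"
    proof -
      have "{p t} = (\<lambda>x. x) -` {p t} \<inter> space \<mu>" using \<open>p t \<in> X\<close> by auto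
      then show ?thesis using measurable_sets[OF ident_borel borel_closed[OF closed_singleton]] by metis
    qed
    ultimately show ?thesis using sub
      by (metis finite_measure_mono measure_le_0_iff)
  qed
  ultimately show ?thesis using that f p_f by blast
qed

lemma b_near:
  assumes "x \<in> closure X" "y \<in> closure Y" "0 < \<epsilon>"
  obtains U V where "open U" "open V" "x \<in> U" "y \<in> V"
    "\<And>x' y'. x' \<in> U \<Longrightarrow> x' \<in> closure X \<Longrightarrow> y' \<in> V \<Longrightarrow> y' \<in> closure Y \<Longrightarrow> \<bar>b x' y' - b x y\<bar> < \<epsilon>"
proof -
  let ?P = "closure X \<times> closure Y"
  have "(x, y) \<in> ?P" using assms by simp
  from bspec[OF continuous_on_b[unfolded continuous_on_def] this]
  have "((\<lambda>p. b (fst p) (snd p)) \<longlongrightarrow> b x y) (at (x, y) within ?P)" by simp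
  from tendstoD[OF this \<open>0 < \<epsilon>\<close>] obtain W where W: "open W" "(x, y) \<in> W"
    "\<And>p. p \<in> W \<Longrightarrow> p \<noteq> (x, y) \<Longrightarrow> p \<in> ?P \<Longrightarrow> dist (b (fst p) (snd p)) (b x y) < \<epsilon>"
    unfolding eventually_at_topological by blast
  obtain U V where UV: "open U" "open V" "(x, y) \<in> U \<times> V" "U \<times> V \<subseteq> W"
    using open_prod_elim[OF W(1,2)] by blast
  show ?thesis
  proof (rule that[of U V])
    fix x' y' assume "x' \<in> U" "x' \<in> closure X" "y' \<in> V" "y' \<in> closure Y"
    then have "(x', y') \<in> W" "(x', y') \<in> ?P" using UV(4) by auto
    then show "\<bar>b x' y' - b x y\<bar> < \<epsilon>"
      using W(3)[of "(x', y')"] \<open>0 < \<epsilon>\<close> by (cases "(x', y') = (x, y)") (auto simp: dist_real_def)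
  qed (use UV in auto)
qed

text \<open>Let \<open>D\<close> be the preimage of a set under \<open>F\<close>. Under the new map
  the part of \<open>A\<close> sent to that set has the mass of \<open>A' \<inter> D\<close>, the
  part of \<open>A'\<close> has the mass of \<open>A \<inter> D\<close>, and nothing changes
  elsewhere; the total is again the mass of \<open>D\<close>.\<close>

lemma swap_transport_map:
  assumes A: "A \<in> sets \<mu>" "A' \<in> sets \<mu>" "A \<inter> A' = {}"
    and \<phi>: "\<phi> \<in> measurable \<mu> \<mu>" "\<And>C. C \<in> sets \<mu> \<Longrightarrow> emeasure \<mu> {x \<in> A. \<phi> x \<in> C} = emeasure \<mu> (A' \<inter> C)"
    and \<psi>: "\<psi> \<in> measurable \<mu> \<mu>" "\<And>C. C \<in> sets \<mu> \<Longrightarrow> emeasure \<mu> {x \<in> A'. \<psi> x \<in> C} = emeasure \<mu> (A \<inter> C)"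
  shows "transport_map \<mu> \<nu> (\<lambda>x. if x \<in> A then F (\<phi> x) else if x \<in> A' then F (\<psi> x) else F x)"
    (is "transport_map \<mu> \<nu> ?T")
proof -
  note [measurable] = A(1,2) \<phi>(1) \<psi>(1) F_transport(1)
  have T [measurable]: "?T \<in> measurable \<mu> \<nu>" by measurable
  have "distr \<mu> \<nu> ?T = distr \<mu> \<nu> F"
  proof (rule measure_eqI)
    fix C assume "C \<in> sets (distr \<mu> \<nu> ?T)"
    then have C [measurable]: "C \<in> sets \<nu>" by simp
    define D where "D = F -` C \<inter> space \<mu>"
    have D [measurable]: "D \<in> sets \<mu>" unfolding D_def by measurable
    have AX: "A \<subseteq> X" "A' \<subseteq> X" using A(1,2)[THEN sets.sets_into_space] by simp_all
    have \<phi>X: "\<phi> x \<in> X" "\<psi> x \<in> X" if "x \<in> X" for x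
      using that measurable_space[OF \<phi>(1)] measurable_space[OF \<psi>(1)] by auto
    have sA: "{x \<in> A. \<phi> x \<in> D} \<in> sets \<mu>" "{x \<in> A'. \<psi> x \<in> D} \<in> sets \<mu>"
    proof -
      have "A \<inter> (\<phi> -` D \<inter> space \<mu>) \<in> sets \<mu>" "A' \<inter> (\<psi> -` D \<inter> space \<mu>) \<in> sets \<mu>" by measurable
      moreover have "A \<inter> (\<phi> -` D \<inter> space \<mu>) = {x \<in> A. \<phi> x \<in> D}" "A' \<inter> (\<psi> -` D \<inter> space \<mu>) = {x \<in> A'. \<psi> x \<in> D}"
        using AX by auto
      ultimately show "{x \<in> A. \<phi> x \<in> D} \<in> sets \<mu>" "{x \<in> A'. \<psi> x \<in> D} \<in> sets \<mu>" by simp_all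
    qed
    have "?T -` C \<inter> space \<mu> = {x \<in> A. \<phi> x \<in> D} \<union> ({x \<in> A'. \<psi> x \<in> D} \<union> (D - (A \<union> A')))"
      using AX \<phi>X A(3) by (auto simp: D_def split: if_splits)
    then have "emeasure (distr \<mu> \<nu> ?T) C = emeasure \<mu> ({x \<in> A. \<phi> x \<in> D} \<union> ({x \<in> A'. \<psi> x \<in> D} \<union> (D - (A \<union> A'))))"
      by (simp add: emeasure_distr)
    also have "\<dots> = emeasure \<mu> {x \<in> A. \<phi> x \<in> D} + (emeasure \<mu> {x \<in> A'. \<psi> x \<in> D} + emeasure \<mu> (D - (A \<union> A')))"
    proof -
      have "{x \<in> A'. \<psi> x \<in> D} \<inter> (D - (A \<union> A')) = {}"
        "{x \<in> A. \<phi> x \<in> D} \<inter> ({x \<in> A'. \<psi> x \<in> D} \<union> (D - (A \<union> A'))) = {}" using A(3) by auto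
      then show ?thesis using sA by (simp add: plus_emeasure)
    qed
    also have "\<dots> = emeasure \<mu> (A' \<inter> D) + (emeasure \<mu> (A \<inter> D) + emeasure \<mu> (D - (A \<union> A')))"
      unfolding \<phi>(2)[OF D] \<psi>(2)[OF D] ..
    also have "\<dots> = emeasure \<mu> ((A' \<inter> D) \<union> ((A \<inter> D) \<union> (D - (A \<union> A'))))"
    proof -
      have "(A \<inter> D) \<inter> (D - (A \<union> A')) = {}" "(A' \<inter> D) \<inter> ((A \<inter> D) \<union> (D - (A \<union> A'))) = {}" using A(3) by auto
      then show ?thesis by (simp add: plus_emeasure)
    qed
    also have "(A' \<inter> D) \<union> ((A \<inter> D) \<union> (D - (A \<union> A'))) = D" by auto
    also have "emeasure \<mu> D = emeasure (distr \<mu> \<nu> F) C" by (simp add: emeasure_distr D_def)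
    finally show "emeasure (distr \<mu> \<nu> ?T) C = emeasure (distr \<mu> \<nu> F) C" .
  qed simp
  then show ?thesis using F_transport(2) T by (simp add: transport_map_def)
qed

lemma graph_support_monotone:
  assumes G1: "(x1, y1) \<in> graph_support" and G2: "(x2, y2) \<in> graph_support"
  shows "b x1 y2 + b x2 y1 \<le> b x1 y1 + b x2 y2"
proof (rule ccontr)
  assume "\<not> ?thesis"
  then have gap: "b x1 y1 + b x2 y2 < b x1 y2 + b x2 y1" by simp
  \<comment> \<open>With \<open>x1 = x2\<close> both sides of the claim agree. Distinct points have
    disjoint neighbourhoods, which the exchange requires.\<close>
  then have "x1 \<noteq> x2" by auto
  \<comment> \<open>The gap equals \<open>8 * \<epsilon>\<close>. Each of the four surplus values is
    off by less than \<open>\<epsilon>\<close> on the small sets, so half of the gap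
    survives.\<close>
  define \<epsilon> where "\<epsilon> = (b x1 y2 + b x2 y1 - (b x1 y1 + b x2 y2)) / 8"
  have e: "0 < \<epsilon>" using gap by (simp add: \<epsilon>_def)
  note g1 = graph_supportD[OF G1] and g2 = graph_supportD[OF G2]
  obtain U11 V11 where 11: "open U11" "open V11" "x1 \<in> U11" "y1 \<in> V11"
    "\<And>x' y'. x' \<in> U11 \<Longrightarrow> x' \<in> closure X \<Longrightarrow> y' \<in> V11 \<Longrightarrow> y' \<in> closure Y \<Longrightarrow> \<bar>b x' y' - b x1 y1\<bar> < \<epsilon>"
    by (rule b_near[OF g1(2) g1(3) e]) (rule that)
  obtain U12 V12 where 12: "open U12" "open V12" "x1 \<in> U12" "y2 \<in> V12"
    "\<And>x' y'. x' \<in> U12 \<Longrightarrow> x' \<in> closure X \<Longrightarrow> y' \<in> V12 \<Longrightarrow> y' \<in> closure Y \<Longrightarrow> \<bar>b x' y' - b x1 y2\<bar> < \<epsilon>"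
    by (rule b_near[OF g1(2) g2(3) e]) (rule that)
  obtain U21 V21 where 21: "open U21" "open V21" "x2 \<in> U21" "y1 \<in> V21"
    "\<And>x' y'. x' \<in> U21 \<Longrightarrow> x' \<in> closure X \<Longrightarrow> y' \<in> V21 \<Longrightarrow> y' \<in> closure Y \<Longrightarrow> \<bar>b x' y' - b x2 y1\<bar> < \<epsilon>"
    by (rule b_near[OF g2(2) g1(3) e]) (rule that)
  obtain U22 V22 where 22: "open U22" "open V22" "x2 \<in> U22" "y2 \<in> V22"
    "\<And>x' y'. x' \<in> U22 \<Longrightarrow> x' \<in> closure X \<Longrightarrow> y' \<in> V22 \<Longrightarrow> y' \<in> closure Y \<Longrightarrow> \<bar>b x' y' - b x2 y2\<bar> < \<epsilon>"
    by (rule b_near[OF g2(2) g2(3) e]) (rule that)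
  obtain c1 where c1: "c1 \<in> AX" "x1 \<in> fst c1" using ex_chart[OF H.atlas_A] .
  obtain c2 where c2: "c2 \<in> AX" "x2 \<in> fst c2" using ex_chart[OF H.atlas_A] .
  obtain S1 S2 where S: "open S1" "open S2" "x1 \<in> S1" "x2 \<in> S2" "S1 \<inter> S2 = {}"
    using hausdorff[OF \<open>x1 \<noteq> x2\<close>] by blast
  define U1 U2 V1 V2 where "U1 = U11 \<inter> U12 \<inter> S1 \<inter> fst c1" and "U2 = U21 \<inter> U22 \<inter> S2 \<inter> fst c2"
    and "V1 = V11 \<inter> V21" and "V2 = V12 \<inter> V22"
  have open_UV: "open U1" "open U2" "open V1" "open V2"
    unfolding U1_def U2_def V1_def V2_def
    using 11 12 21 22 S chart_open[OF H.atlas_A c1(1)] chart_open[OF H.atlas_A c2(1)] by (simp_all add: open_Int)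
  define A1 A2 where "A1 = {x \<in> X. x \<in> U1 \<and> F x \<in> V1}" and "A2 = {x \<in> X. x \<in> U2 \<and> F x \<in> V2}"
  have sets_A: "A1 \<in> sets \<mu>" "A2 \<in> sets \<mu>"
    unfolding A1_def A2_def by (intro sets_box open_UV)+
  have "emeasure \<mu> A1 \<noteq> 0" "emeasure \<mu> A2 \<noteq> 0"
    unfolding A1_def A2_def using 11 12 21 22 S c1 c2
    by (intro g1(4) g2(4) open_UV; simp add: U1_def U2_def V1_def V2_def)+
  then have pos: "0 < measure \<mu> A1" "0 < measure \<mu> A2"
    by (simp_all add: emeasure_eq_measure zero_less_measure_iff)
  obtain f1 :: "'x \<Rightarrow> real" and p1 where fp1: "f1 \<in> borel_measurable \<mu>" "p1 \<in> measurable borel \<mu>" "\<And>x. x \<in> X \<inter> fst c1 \<Longrightarrow> p1 (f1 x) = x"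
    "\<And>t. measure \<mu> {x \<in> X \<inter> fst c1. f1 x = t} = 0"
    by (rule Borel_code_on_chart[OF c1(1) g1(1)]) (rule that)
  obtain f2 :: "'x \<Rightarrow> real" and p2 where fp2: "f2 \<in> borel_measurable \<mu>" "p2 \<in> measurable borel \<mu>" "\<And>x. x \<in> X \<inter> fst c2 \<Longrightarrow> p2 (f2 x) = x"
    "\<And>t. measure \<mu> {x \<in> X \<inter> fst c2. f2 x = t} = 0"
    by (rule Borel_code_on_chart[OF c2(1) g2(1)]) (rule that)
  have null: "measure \<mu> {x \<in> B. f x = t} = 0"
    if f: "f \<in> borel_measurable \<mu>" "measure \<mu> {x \<in> X \<inter> fst c. f x = t} = 0" and c: "c \<in> AX" and B: "B \<subseteq> X \<inter> fst c"
    for B c t and f :: "'x \<Rightarrow> real"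
  proof -
    have "((\<lambda>x. x) -` fst c \<inter> space \<mu>) \<inter> (f -` {t} \<inter> space \<mu>) \<in> sets \<mu>"
      by (rule sets.Int[OF measurable_sets[OF ident_borel borel_open[OF chart_open[OF H.atlas_A c]]]
            measurable_sets[OF f(1) borel_closed[OF closed_singleton]]])
    also have "((\<lambda>x. x) -` fst c \<inter> space \<mu>) \<inter> (f -` {t} \<inter> space \<mu>) = {x \<in> X \<inter> fst c. f x = t}" by auto
    finally have "measure \<mu> {x \<in> B. f x = t} \<le> measure \<mu> {x \<in> X \<inter> fst c. f x = t}"
      using B by (intro finite_measure_mono) auto
    then show ?thesis using f(2) by (simp add: measure_le_0_iff)
  qed
  have A_sub: "A1 \<subseteq> X \<inter> fst c1" "A2 \<subseteq> X \<inter> fst c2" by (auto simp: A1_def A2_def U1_def U2_def)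
  \<comment> \<open>The two neighbourhoods may differ in mass; both are trimmed to the smaller
    value.\<close>
  define m where "m = min (measure \<mu> A1) (measure \<mu> A2)"
  have m: "0 < m" "m \<le> measure \<mu> A1" "m \<le> measure \<mu> A2" using pos by (auto simp: m_def)
  obtain B1 where B1: "B1 \<in> sets \<mu>" "B1 \<subseteq> A1" "measure \<mu> B1 = m"
    using ex_subset_of_measure[OF sets_A(1) less_imp_le[OF m(1)] m(2) fp1(1) null[OF fp1(1,4) c1(1) A_sub(1)]] by blast
  obtain B2 where B2: "B2 \<in> sets \<mu>" "B2 \<subseteq> A2" "measure \<mu> B2 = m"
    using ex_subset_of_measure[OF sets_A(2) less_imp_le[OF m(1)] m(3) fp2(1) null[OF fp2(1,4) c2(1) A_sub(2)]] by blast
  have B_sub: "B1 \<subseteq> X \<inter> fst c1" "B2 \<subseteq> X \<inter> fst c2" using A_sub B1 B2 by auto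
  have B12: "measure \<mu> B1 = measure \<mu> B2" "0 < measure \<mu> B1" "0 < measure \<mu> B2" using B1 B2 m by auto
  obtain \<phi> where \<phi>: "\<phi> \<in> measurable \<mu> \<mu>" "\<And>x. \<phi> x \<in> B2"
    "\<And>C. C \<in> sets \<mu> \<Longrightarrow> emeasure \<mu> {x \<in> B1. \<phi> x \<in> C} = emeasure \<mu> (B2 \<inter> C)"
    using ex_measure_preserving[OF B1(1) B2(1) B12(1,2) fp1(1) null[OF fp1(1,4) c1(1) B_sub(1)] fp2(1,2)]
      fp2(3) B_sub(2) by blast
  obtain \<psi> where \<psi>: "\<psi> \<in> measurable \<mu> \<mu>" "\<And>x. \<psi> x \<in> B1"
    "\<And>C. C \<in> sets \<mu> \<Longrightarrow> emeasure \<mu> {x \<in> B2. \<psi> x \<in> C} = emeasure \<mu> (B1 \<inter> C)"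
    using ex_measure_preserving[OF B2(1) B1(1) B12(1)[symmetric] B12(3) fp2(1) null[OF fp2(1,4) c2(1) B_sub(2)] fp1(1,2)]
      fp1(3) B_sub(1) by blast
  have disj: "B1 \<inter> B2 = {}" using B1(2) B2(2) S(5) by (auto simp: A1_def A2_def U1_def U2_def)
  define T where "T x = (if x \<in> B1 then F (\<phi> x) else if x \<in> B2 then F (\<psi> x) else F x)" for x
  have T: "transport_map \<mu> \<nu> T"
    unfolding T_def[abs_def] by (rule swap_transport_map[OF B1(1) B2(1) disj \<phi>(1,3) \<psi>(1,3)])
  then have T_meas: "T \<in> measurable \<mu> \<nu>" by (simp add: transport_map_def)
  \<comment> \<open>Lower bounds for the pointwise gain on \<open>B1\<close> and on
    \<open>B2\<close>. One of them may be negative; since both sets have mass \<open>m\<close>, only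
    the sum \<open>\<alpha> + \<beta>\<close>, which is \<open>4 * \<epsilon>\<close>,
    decides.\<close>
  define \<alpha> \<beta> where "\<alpha> = b x1 y2 - b x1 y1 - 2 * \<epsilon>" and "\<beta> = b x2 y1 - b x2 y2 - 2 * \<epsilon>"
  have in1: "x \<in> U11" "x \<in> U12" "x \<in> closure X" "F x \<in> V11" "F x \<in> V21" "F x \<in> closure Y" if "x \<in> B1" for x
    using that B1(2) F_Y[of x] closure_subset[of X] closure_subset[of Y] by (auto simp: A1_def U1_def V1_def)
  have in2: "x \<in> U21" "x \<in> U22" "x \<in> closure X" "F x \<in> V12" "F x \<in> V22" "F x \<in> closure Y" if "x \<in> B2" for x
    using that B2(2) F_Y[of x] closure_subset[of X] closure_subset[of Y] by (auto simp: A2_def U2_def V2_def)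
  have point: "b x (F x) + (\<alpha> * indicator B1 x + \<beta> * indicator B2 x) \<le> b x (T x)" for x
  proof -
    consider "x \<in> B1" "x \<notin> B2" | "x \<in> B2" "x \<notin> B1" | "x \<notin> B1" "x \<notin> B2" using disj by blast
    then show ?thesis
    proof cases
      case 1
      have "\<bar>b x (F x) - b x1 y1\<bar> < \<epsilon>" by (intro 11(5) in1 1)
      moreover have "\<bar>b x (F (\<phi> x)) - b x1 y2\<bar> < \<epsilon>" by (intro 12(5) in1 1 in2 \<phi>(2))
      ultimately show ?thesis using 1 by (simp add: T_def \<alpha>_def)
    next
      case 2
      have "\<bar>b x (F x) - b x2 y2\<bar> < \<epsilon>" by (intro 22(5) in2 2)
      moreover have "\<bar>b x (F (\<psi> x)) - b x2 y1\<bar> < \<epsilon>" by (intro 21(5) in2 2 in1 \<psi>(2))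
      ultimately show ?thesis using 2 by (simp add: T_def \<beta>_def)
    next
      case 3
      then show ?thesis by (simp add: T_def)
    qed
  qed
  have int: "integrable \<mu> (\<lambda>x. \<alpha> * indicator B1 x + \<beta> * indicator B2 x :: real)"
    using B1(1) B2(1) by (intro Bochner_Integration.integrable_add integrable_mult_right integrable_real_indicator)
      (auto simp: emeasure_eq_measure)
  have "(\<integral>x. b x (F x) + (\<alpha> * indicator B1 x + \<beta> * indicator B2 x) \<partial>\<mu>) \<le> (\<integral>x. b x (T x) \<partial>\<mu>)"
    by (intro integral_mono Bochner_Integration.integrable_add int integrable_b F_transport(1) T_meas point)
  also have "\<dots> \<le> (\<integral>x. b x (F x) \<partial>\<mu>)"
    using monge T by (simp add: monge_solution_def)
  finally have "(\<integral>x. b x (F x) \<partial>\<mu>) + (\<integral>x. \<alpha> * indicator B1 x + \<beta> * indicator B2 x \<partial>\<mu>) \<le> (\<integral>x. b x (F x) \<partial>\<mu>)"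
    by (subst (asm) Bochner_Integration.integral_add[OF integrable_b[OF F_transport(1)] int])
  then have "(\<integral>x. \<alpha> * indicator B1 x + \<beta> * indicator B2 x \<partial>\<mu>) \<le> 0" by simp
  moreover have "(\<integral>x. \<alpha> * indicator B1 x + \<beta> * indicator B2 x \<partial>\<mu>) = (\<alpha> + \<beta>) * m"
  proof -
    have i: "integrable \<mu> (\<lambda>x. \<alpha> * indicator B1 x :: real)" "integrable \<mu> (\<lambda>x. \<beta> * indicator B2 x :: real)"
      using B1(1) B2(1) by (auto intro!: integrable_mult_right integrable_real_indicator simp: emeasure_eq_measure)
    have "B1 \<inter> X = B1" "B2 \<inter> X = B2" using B_sub by auto
    then show ?thesis
      by (subst Bochner_Integration.integral_add[OF i]) (simp add: B1(3) B2(3) distrib_right)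
  qed
  moreover have "0 < \<alpha> + \<beta>" using gap by (simp add: \<alpha>_def \<beta>_def \<epsilon>_def)
  ultimately show False using m(1) by (simp add: mult_le_0_iff)
qed

section \<open>Dimension of the support\<close>

abbreviation mu_Z :: "'z measure" where
  "mu_Z \<equiv> distr \<mu> (restrict_space borel Z) (\<lambda>x. contr x (F x))"

text \<open>Both maximisers are recorded because the derivative estimates are local in them;
  \<open>y\<close> is quantified away, since it enters only through monotonicity and through values
  that cancel.\<close>

definition kinks :: "('x, 'n) chart \<Rightarrow> ('x \<times> 'z \<times> 'z) set" where
  "kinks c = {(x, z, z'). x \<in> fst c \<and> z \<in> closure Z \<and> z' \<in> closure Z \<and> z \<noteq> z' \<and>
     (\<exists>y. (x, y) \<in> graph_support \<and> h x z + g y z = b x y \<and> h x z' + g y z' = b x y)}"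

text \<open>Here \<open>y\<close> is recorded as well: the semiconvexity constant of
  \<open>g\<close> is available only near a given \<open>y\<close>.\<close>

definition contacts :: "('x, 'n) chart \<Rightarrow> ('x \<times> 'y \<times> 'z) set" where
  "contacts c = {(x, y, z). x \<in> fst c \<and> (x, y) \<in> graph_support \<and> z \<in> Z \<and> z \<in> msupport mu_Z \<and> h x z + g y z = b x y}"

text \<open>If \<open>b(\<cdot>, y)\<close> has two maximisers \<open>z \<noteq> z'\<close> at \<open>x\<close>, then by the twist condition it
  dominates two functions with distinct derivatives there. Monotonicity of the graph forces the
  points of this kind into a cone.\<close>

lemma kinks_dim_locally:
  assumes twist: "twisted_first_second AX X Z h" and c: "c \<in> AX" and t: "t \<in> kinks c"
  shows "\<exists>U. open U \<and> t \<in> U \<and>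
    hausdorff_dim ((\<lambda>(x, z, z'). snd c x) ` (kinks c \<inter> U)) \<le> ereal (real CARD('n) - 1)"
proof -
  obtain x0 z1 z2 where t_eq: "t = (x0, z1, z2)" by (cases t) auto
  obtain y0 where x0: "x0 \<in> fst c" "z1 \<in> closure Z" "z2 \<in> closure Z" "z1 \<noteq> z2" "(x0, y0) \<in> graph_support"
    using t unfolding t_eq kinks_def by auto
  note x0X = graph_supportD(1,2)[OF x0(5)]
  define D1 D2 where "D1 = D_first c X Z h x0 z1" and "D2 = D_first c X Z h x0 z2"
  have "inj_on (\<lambda>q. D_first c X Z h x0 q) (closure Z)"
    using twist c x0(1) x0X(2) unfolding twisted_first_second_def by blast
  then have "D1 \<noteq> D2" unfolding D1_def D2_def using x0 by (auto dest: inj_onD)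
  define n where "n = real CARD('n)"
  have n: "0 < n" by (simp add: n_def)
  \<comment> \<open>Two errors of size \<open>\<epsilon>\<close> add up to the constant that
    \<open>hausdorff_dim_cone\<close> asks for with \<open>q = D1 - D2\<close>.\<close>
  define \<epsilon> where "\<epsilon> = norm (D1 - D2) / (4 * n)"
  have e: "0 < \<epsilon>" using \<open>D1 \<noteq> D2\<close> n by (simp add: \<epsilon>_def)
  have x0cX: "x0 \<in> fst c \<inter> X" using x0(1) x0X(1) by simp
  obtain r1 V1 where r1: "0 < r1" "open V1" "z1 \<in> V1" "ball (snd c x0) r1 \<subseteq> snd c ` (fst c \<inter> X)"
    "\<forall>u\<in>ball (snd c x0) r1. \<forall>u'\<in>ball (snd c x0) r1. \<forall>q\<in>V1 \<inter> closure Z.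
       \<bar>h (chart_inv c u') q - h (chart_inv c u) q - D1 \<bullet> (u' - u)\<bar> \<le> \<epsilon> * norm (u' - u)"
    using H.strict_derivative[OF c x0cX x0(2) e] unfolding D1_def[symmetric] by (elim exE conjE) (rule that)
  obtain r2 V2 where r2: "0 < r2" "open V2" "z2 \<in> V2" "ball (snd c x0) r2 \<subseteq> snd c ` (fst c \<inter> X)"
    "\<forall>u\<in>ball (snd c x0) r2. \<forall>u'\<in>ball (snd c x0) r2. \<forall>q\<in>V2 \<inter> closure Z.
       \<bar>h (chart_inv c u') q - h (chart_inv c u) q - D2 \<bullet> (u' - u)\<bar> \<le> \<epsilon> * norm (u' - u)"
    using H.strict_derivative[OF c x0cX x0(3) e] unfolding D2_def[symmetric] by (elim exE conjE) (rule that)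
  define B where "B = ball (snd c x0) (min r1 r2)"
  have B: "B \<subseteq> ball (snd c x0) r1" "B \<subseteq> ball (snd c x0) r2" by (auto simp: B_def)
  define U where "U = {x \<in> fst c. snd c x \<in> B} \<times> V1 \<times> V2"
  have "open U"
    unfolding U_def B_def by (intro open_Times chart_preimage_open[OF H.atlas_A c] open_ball r1(2) r2(2))
  moreover have "t \<in> U" using x0 r1 r2 by (simp add: t_eq U_def B_def)
  moreover have "hausdorff_dim ((\<lambda>(x, z, z'). snd c x) ` (kinks c \<inter> U)) \<le> ereal (real CARD('n) - 1)"
  proof (rule hausdorff_dim_cone)
    have "(\<lambda>(x, z, z'). snd c x) ` (kinks c \<inter> U) \<subseteq> B" by (auto simp: U_def)
    then show "bounded ((\<lambda>(x, z, z'). snd c x) ` (kinks c \<inter> U))"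
      by (rule bounded_subset[rotated]) (simp add: B_def)
    show "D1 - D2 \<noteq> 0" using \<open>D1 \<noteq> D2\<close> by simp
    fix u u' assume "u \<in> (\<lambda>(x, z, z'). snd c x) ` (kinks c \<inter> U)" "u' \<in> (\<lambda>(x, z, z'). snd c x) ` (kinks c \<inter> U)"
    then obtain x z w x' z' w' where k: "(x, z, w) \<in> kinks c" "(x, z, w) \<in> U" "u = snd c x"
      "(x', z', w') \<in> kinks c" "(x', z', w') \<in> U" "u' = snd c x'" by auto
    obtain y where y: "x \<in> fst c" "z \<in> closure Z" "(x, y) \<in> graph_support" "h x z + g y z = b x y"
      using k(1) unfolding kinks_def by auto
    obtain y' where y': "x' \<in> fst c" "w' \<in> closure Z" "(x', y') \<in> graph_support" "h x' w' + g y' w' = b x' y'"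
      using k(4) unfolding kinks_def by auto
    have inB: "u \<in> B" "u' \<in> B" "z \<in> V1" "w' \<in> V2" using k by (auto simp: U_def)
    have inv: "chart_inv c u = x" "chart_inv c u' = x'"
      using k y(1) y'(1) by (simp_all add: chart_inv_left[OF H.atlas_A c])
    \<comment> \<open>The first maximiser of one point is paired with the second maximiser of the
      other. As competitors, \<open>z\<close> serves the pair \<open>(x', y)\<close> and
      \<open>w'\<close> the pair \<open>(x, y')\<close>; after adding monotonicity all values of
      \<open>g\<close> cancel and only increments of \<open>h\<close> in \<open>x\<close>
      remain.\<close>
    have "\<bar>h x' z - h x z - D1 \<bullet> (u' - u)\<bar> \<le> \<epsilon> * norm (u' - u)"
      using r1(5)[rule_format, of u u' z] inB B y(2) unfolding inv by blast
    moreover have "\<bar>h x w' - h x' w' - D2 \<bullet> (u - u')\<bar> \<le> \<epsilon> * norm (u - u')"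
      using r2(5)[rule_format, of u' u w'] inB B y'(2) unfolding inv by blast
    moreover have "h x' z + g y z \<le> b x' y"
      by (rule value_le[OF graph_supportD(2)[OF y'(3)] graph_supportD(3)[OF y(3)] y(2)])
    moreover have "h x w' + g y' w' \<le> b x y'"
      by (rule value_le[OF graph_supportD(2)[OF y(3)] graph_supportD(3)[OF y'(3)] y'(2)])
    moreover have "b x y' + b x' y \<le> b x y + b x' y'"
      by (rule graph_support_monotone[OF y(3) y'(3)])
    moreover have "norm (u - u') = norm (u' - u)" by (rule norm_minus_commute)
    moreover have "D2 \<bullet> (u - u') = - (D2 \<bullet> (u' - u))" by (simp add: inner_diff_right)
    ultimately have "D1 \<bullet> (u' - u) - D2 \<bullet> (u' - u) \<le> 2 * (\<epsilon> * norm (u' - u))"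
      using y(4) y'(4) by (simp only: abs_le_iff) linarith
    then have "(D1 - D2) \<bullet> (u' - u) \<le> 2 * \<epsilon> * norm (u' - u)" by (simp add: inner_diff_left)
    also have "2 * \<epsilon> = norm (D1 - D2) / (2 * real CARD('n))" by (simp add: \<epsilon>_def n_def)
    finally show "(D1 - D2) \<bullet> (u' - u) \<le> norm (D1 - D2) / (2 * real CARD('n)) * norm (u' - u)" .
  qed
  ultimately show ?thesis by blast
qed

text \<open>Near \<open>t\<close>, \<open>monotone_pair_Lipschitz\<close> applies in charts with
  \<open>h\<close> as \<open>H\<close> and \<open>g y'\<close> as \<open>\<psi>\<close>. It bounds
  the distance of the points \<open>x\<close> by that of the points \<open>z\<close>, and the latter
  stay in the support of \<open>mu_Z\<close>, whose dimension therefore dominates.\<close>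

lemma contacts_dim_locally:
  assumes nondeg: "nondegenerate AX AZ X Z h" and c: "c \<in> AX" and t: "t \<in> contacts c"
  shows "\<exists>U. open U \<and> t \<in> U \<and>
    hausdorff_dim ((\<lambda>(x, y, z). snd c x) ` (contacts c \<inter> U)) \<le> manifold_hausdorff_dim AZ (msupport mu_Z)"
proof -
  obtain x0 y0 z0 where t_eq: "t = (x0, y0, z0)" by (cases t) auto
  have x0: "x0 \<in> fst c" "(x0, y0) \<in> graph_support" "z0 \<in> Z"
    using t unfolding t_eq contacts_def by auto
  note x0X = graph_supportD(1-3)[OF x0(2)]
  obtain d where d: "d \<in> AZ" "z0 \<in> fst d" using ex_chart[OF H.atlas_B] .
  define u0 w0 where "u0 = snd c x0" and "w0 = snd d z0"
  have x0cX: "x0 \<in> fst c \<inter> X" and z0dZ: "z0 \<in> fst d \<inter> Z" using x0 x0X d by simp_all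
  have "x0 \<in> closure X \<inter> fst c" "z0 \<in> closure Z \<inter> fst d"
    using x0 x0X d closure_subset[of Z] by auto
  then have inv: "invertible (D2_mixed c d X Z h x0 z0)"
    using nondeg c d(1) unfolding nondegenerate_def by blast
  obtain r1 C1 k Gr where r1: "0 < r1" "0 < C1" "0 < k"
    "ball u0 r1 \<subseteq> snd c ` (fst c \<inter> X)" "ball w0 r1 \<subseteq> snd d ` (fst d \<inter> Z)"
    "\<And>u w w'. u \<in> ball u0 r1 \<Longrightarrow> w \<in> ball w0 r1 \<Longrightarrow> w' \<in> ball w0 r1 \<Longrightarrow>
      \<bar>h (chart_inv c u) (chart_inv d w') - h (chart_inv c u) (chart_inv d w) - Gr u w \<bullet> (w' - w)\<bar> \<le> C1 * (norm (w' - w))\<^sup>2"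
    "\<And>u u' w. u \<in> ball u0 r1 \<Longrightarrow> u' \<in> ball u0 r1 \<Longrightarrow> w \<in> ball w0 r1 \<Longrightarrow>
      k * norm (u - u') \<le> norm (Gr u w - Gr u' w :: real ^ 'n)"
    "\<And>u u' w. u \<in> ball u0 r1 \<Longrightarrow> u' \<in> ball u0 r1 \<Longrightarrow> w \<in> ball w0 r1 \<Longrightarrow>
      norm (Gr u w - Gr u' w) \<le> C1 * norm (u - u')"
    "\<And>u u' w w'. u \<in> ball u0 r1 \<Longrightarrow> u' \<in> ball u0 r1 \<Longrightarrow> w \<in> ball w0 r1 \<Longrightarrow> w' \<in> ball w0 r1 \<Longrightarrow>
      h (chart_inv c u) (chart_inv d w) - h (chart_inv c u) (chart_inv d w')
        - (h (chart_inv c u') (chart_inv d w) - h (chart_inv c u') (chart_inv d w'))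
      \<le> C1 * norm (u - u') * norm (w - w')"
    by (rule H.nondegenerate_expansion[OF c x0cX d(1) z0dZ inv, folded u0_def w0_def]) (rule that)
  obtain r2 C2 V where r2: "0 < r2" "0 < C2" "open V" "y0 \<in> V" "ball w0 r2 \<subseteq> snd d ` (fst d \<inter> Z)"
    "\<And>y w v. y \<in> V \<inter> closure Y \<Longrightarrow> w \<in> ball w0 r2 \<Longrightarrow> w + v \<in> ball w0 r2 \<Longrightarrow> w - v \<in> ball w0 r2 \<Longrightarrow>
      - C2 * (norm v)\<^sup>2 \<le> g y (chart_inv d (w + v)) + g y (chart_inv d (w - v)) - 2 * g y (chart_inv d w)"
    by (rule G.second_difference_bound[OF x0X(3) d(1) z0dZ, folded w0_def]) (rule that)
  define r where "r = min r1 r2"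
  define C where "C = max C1 C2"
  have r: "0 < r" "r \<le> r1" "r \<le> r2" using r1(1) r2(1) by (auto simp: r_def)
  have C: "0 < C" "C1 \<le> C" "C2 \<le> C" using r1(2) by (auto simp: C_def)
  have sub: "ball u0 r \<subseteq> ball u0 r1" "ball w0 r \<subseteq> ball w0 r1" "ball w0 r \<subseteq> ball w0 r2" "ball w0 (r / 2) \<subseteq> ball w0 r"
    using r by (auto intro!: subset_ball)
  \<comment> \<open>Halving the ball in \<open>z\<close> leaves room for the steps
    \<open>w' + v\<close> and \<open>w' - v\<close>.\<close>
  define U where "U = {x \<in> fst c. snd c x \<in> ball u0 r} \<times> V \<times> {z \<in> fst d. snd d z \<in> ball w0 (r / 2)}"
  have "open U"
    unfolding U_def by (intro open_Times chart_preimage_open[OF H.atlas_A c] chart_preimage_open[OF H.atlas_B d(1)] open_ball r2(3))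
  moreover have "t \<in> U" using x0 r2(4) r d by (simp add: t_eq U_def u0_def w0_def)
  moreover have "hausdorff_dim ((\<lambda>(x, y, z). snd c x) ` (contacts c \<inter> U)) \<le> manifold_hausdorff_dim AZ (msupport mu_Z)"
  proof -
    define R where "R = (\<lambda>(x, y, z). (snd c x, snd d z)) ` (contacts c \<inter> U)"
    have "hausdorff_dim (fst ` R) \<le> hausdorff_dim (snd ` R)"
    proof (rule hausdorff_dim_Lipschitz_relation)
      fix u u' w w' assume "(u, w) \<in> R" "(u', w') \<in> R"
      then obtain x y z x' y' z' where t: "(x, y, z) \<in> contacts c" "(x, y, z) \<in> U" "u = snd c x" "w = snd d z"
        "(x', y', z') \<in> contacts c" "(x', y', z') \<in> U" "u' = snd c x'" "w' = snd d z'"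
        unfolding R_def by auto
      have G: "(x, y) \<in> graph_support" "(x', y') \<in> graph_support" and eq: "h x z + g y z = b x y" "h x' z' + g y' z' = b x' y'"
        and zZ: "z \<in> Z" "z' \<in> Z"
        using t unfolding contacts_def by auto
      note cl = graph_supportD(2,3)[OF G(1)] graph_supportD(2,3)[OF G(2)]
      have inU: "x \<in> fst c" "x' \<in> fst c" "z \<in> fst d" "z' \<in> fst d" "y' \<in> V"
        "u \<in> ball u0 r" "u' \<in> ball u0 r" "w \<in> ball w0 (r/2)" "w' \<in> ball w0 (r/2)"
        using t unfolding U_def by auto
      have chart: "chart_inv c u = x" "chart_inv c u' = x'" "chart_inv d w = z" "chart_inv d w' = z'"
        using t inU by (simp_all add: chart_inv_left[OF H.atlas_A c] chart_inv_left[OF H.atlas_B d(1)])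
      have in_Z: "chart_inv d \<omega> \<in> closure Z" if "\<omega> \<in> ball w0 r" for \<omega>
        using subsetD[OF closure_subset H.chart_inv_Q[OF d(1)]] subsetD[OF r1(5) subsetD[OF sub(2) that]] by blast
      have "norm (u - u') \<le> 12 * C\<^sup>2 / k\<^sup>2 * norm (w - w')"
      proof (rule monotone_pair_Lipschitz[OF C(1) r1(3), where H="\<lambda>u w. h (chart_inv c u) (chart_inv d w)"
            and G=Gr and r=r and \<psi>="\<lambda>w. g y' (chart_inv d w)"])
        fix v \<omega> \<omega>' assume v: "v \<in> ball u0 r" "\<omega> \<in> ball w0 r" "\<omega>' \<in> ball w0 r"
        have "\<bar>h (chart_inv c v) (chart_inv d \<omega>') - h (chart_inv c v) (chart_inv d \<omega>) - Gr v \<omega> \<bullet> (\<omega>' - \<omega>)\<bar> \<le> C1 * (norm (\<omega>' - \<omega>))\<^sup>2"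
          using v sub by (intro r1(6)) auto
        also have "\<dots> \<le> C * (norm (\<omega>' - \<omega>))\<^sup>2" using C by (intro mult_right_mono) auto
        finally show "\<bar>h (chart_inv c v) (chart_inv d \<omega>') - h (chart_inv c v) (chart_inv d \<omega>) - Gr v \<omega> \<bullet> (\<omega>' - \<omega>)\<bar> \<le> C * (norm (\<omega>' - \<omega>))\<^sup>2" .
      next
        fix v v' \<omega> assume v: "v \<in> ball u0 r" "v' \<in> ball u0 r" "\<omega> \<in> ball w0 r"
        show "k * norm (v - v') \<le> norm (Gr v \<omega> - Gr v' \<omega>)"
          using v sub by (intro r1(7)) auto
        have "norm (Gr v \<omega> - Gr v' \<omega>) \<le> C1 * norm (v - v')"
          using v sub by (intro r1(8)) auto
        also have "\<dots> \<le> C * norm (v - v')" using C by (intro mult_right_mono) auto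
        finally show "norm (Gr v \<omega> - Gr v' \<omega>) \<le> C * norm (v - v')" .
      next
        fix v v' \<omega> \<omega>' assume v: "v \<in> ball u0 r" "v' \<in> ball u0 r" "\<omega> \<in> ball w0 r" "\<omega>' \<in> ball w0 r"
        have "h (chart_inv c v) (chart_inv d \<omega>) - h (chart_inv c v) (chart_inv d \<omega>')
          - (h (chart_inv c v') (chart_inv d \<omega>) - h (chart_inv c v') (chart_inv d \<omega>'))
          \<le> C1 * norm (v - v') * norm (\<omega> - \<omega>')"
          using v sub by (intro r1(9)) auto
        also have "\<dots> \<le> C * norm (v - v') * norm (\<omega> - \<omega>')" using C by (intro mult_right_mono) auto
        finally show "h (chart_inv c v) (chart_inv d \<omega>) - h (chart_inv c v) (chart_inv d \<omega>')
          - (h (chart_inv c v') (chart_inv d \<omega>) - h (chart_inv c v') (chart_inv d \<omega>'))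
          \<le> C * norm (v - v') * norm (\<omega> - \<omega>')" .
      next
        show "u \<in> ball u0 r" "u' \<in> ball u0 r" "w \<in> ball w0 (r/2)" "w' \<in> ball w0 (r/2)" by fact+
      next
        fix v assume v: "w' + v \<in> ball w0 r" "w' - v \<in> ball w0 r"
        have "- C2 * (norm v)\<^sup>2 \<le> g y' (chart_inv d (w' + v)) + g y' (chart_inv d (w' - v)) - 2 * g y' (chart_inv d w')"
        proof (rule r2(6))
          show "y' \<in> V \<inter> closure Y" using inU(5) cl(4) by simp
          show "w' \<in> ball w0 r2" by (rule subsetD[OF sub(3) subsetD[OF sub(4) inU(9)]])
        qed (rule subsetD[OF sub(3) v(1)], rule subsetD[OF sub(3) v(2)])
        moreover have "- C * (norm v)\<^sup>2 \<le> - C2 * (norm v)\<^sup>2" using C by (intro mult_right_mono) auto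
        ultimately show "- C * (norm v)\<^sup>2 \<le> g y' (chart_inv d (w' + v)) + g y' (chart_inv d (w' - v)) - 2 * g y' (chart_inv d w')"
          by (rule order_trans[rotated])
      next
        fix \<omega> assume w: "\<omega> \<in> ball w0 r"
        show "h (chart_inv c u') (chart_inv d \<omega>) + g y' (chart_inv d \<omega>) \<le> h (chart_inv c u') (chart_inv d w') + g y' (chart_inv d w')"
          using value_le[OF cl(3,4) in_Z[OF w]] eq(2) unfolding chart by simp
        \<comment> \<open>Here \<open>\<omega>\<close> competes for \<open>(x, y')\<close> and
          \<open>z\<close> for \<open>(x', y)\<close>. Monotonicity joins the two inequalities, and
          \<open>g y z\<close> cancels, so \<open>g\<close> survives only at
          \<open>y'\<close>.\<close>
        have "h x (chart_inv d \<omega>) + g y' (chart_inv d \<omega>) \<le> b x y'" by (rule value_le[OF cl(1,4) in_Z[OF w]])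
        moreover have "h x' z + g y z \<le> b x' y" by (rule value_le[OF cl(3,2) subsetD[OF closure_subset zZ(1)]])
        moreover have "b x y' + b x' y \<le> b x y + b x' y'" by (rule graph_support_monotone[OF G])
        ultimately show "h (chart_inv c u) (chart_inv d \<omega>) + g y' (chart_inv d \<omega>) + h (chart_inv c u') (chart_inv d w)
            \<le> h (chart_inv c u) (chart_inv d w) + h (chart_inv c u') (chart_inv d w') + g y' (chart_inv d w')"
          using eq unfolding chart by linarith
      qed
      then show "dist u u' \<le> 12 * C\<^sup>2 / k\<^sup>2 * dist w w'" by (simp add: dist_norm)
    qed
    also have "fst ` R = (\<lambda>(x, y, z). snd c x) ` (contacts c \<inter> U)"
      unfolding R_def image_image by (intro image_cong) auto
    also have "hausdorff_dim (snd ` R) \<le> hausdorff_dim (snd d ` (msupport mu_Z \<inter> fst d))"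
    proof (rule hausdorff_dim_mono)
      show "snd ` R \<subseteq> snd d ` (msupport mu_Z \<inter> fst d)" unfolding R_def U_def contacts_def by auto
    qed
    also have "\<dots> \<le> manifold_hausdorff_dim AZ (msupport mu_Z)"
      unfolding manifold_hausdorff_dim_def using d(1) by (intro SUP_upper)
    finally show ?thesis .
  qed
  ultimately show ?thesis by blast
qed

lemma support_cases:
  assumes c: "x \<in> msupport \<mu>" "x \<in> fst c"
  shows "(\<exists>y z. (x, y, z) \<in> contacts c) \<or> (\<exists>z z'. (x, z, z') \<in> kinks c)"
proof -
  obtain y where G: "(x, y) \<in> graph_support" using ex_graph_support[OF c(1)] by blast
  note xy = graph_supportD(2,3)[OF G]
  note z = contr_in[OF xy] contr_in_closure[OF xy] contr_value[OF xy]
  show ?thesis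
  proof (cases "\<exists>z'\<in>closure Z. h x z' + g y z' = b x y \<and> z' \<noteq> contr x y")
    case True
    then obtain z' where "z' \<in> closure Z" "h x z' + g y z' = b x y" "contr x y \<noteq> z'" by metis
    then have "(x, contr x y, z') \<in> kinks c" unfolding kinks_def using z G c(2) by auto
    then show ?thesis by blast
  next
    case False
    then have "contr x y \<in> msupport mu_Z" using contr_in_support[OF G] by blast
    then have "(x, y, contr x y) \<in> contacts c" unfolding contacts_def using z G c(2) by auto
    then show ?thesis by blast
  qed
qed

lemma manifold_hausdorff_dim_support_le:
  assumes twist: "twisted_first_second AX X Z h" and nondeg: "nondegenerate AX AZ X Z h"
  shows "manifold_hausdorff_dim AX (msupport \<mu>) \<le>
    max (manifold_hausdorff_dim AZ (msupport mu_Z)) (ereal (real CARD('n) - 1))"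
  unfolding manifold_hausdorff_dim_def[of AX]
proof (rule SUP_least)
  let ?s = "max (manifold_hausdorff_dim AZ (msupport mu_Z)) (ereal (real CARD('n) - 1))"
  fix c assume c: "c \<in> AX"
  have s0: "0 \<le> ?s" using manifold_hausdorff_dim_nonneg[OF H.atlas_B] by (simp add: le_max_iff_disj)
  let ?C = "(\<lambda>(x, y, z). snd c x) ` contacts c" and ?K = "(\<lambda>(x, z, z'). snd c x) ` kinks c"
  have C: "hausdorff_dim ?C \<le> ?s"
  proof (rule hausdorff_dim_locally_le[OF s0])
    fix t assume "t \<in> contacts c"
    then show "\<exists>U. open U \<and> t \<in> U \<and> hausdorff_dim ((\<lambda>(x, y, z). snd c x) ` (contacts c \<inter> U)) \<le> ?s"
      using contacts_dim_locally[OF nondeg c] by (meson max.coboundedI1)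
  qed
  have K: "hausdorff_dim ?K \<le> ?s"
  proof (rule hausdorff_dim_locally_le[OF s0])
    fix t assume "t \<in> kinks c"
    then show "\<exists>U. open U \<and> t \<in> U \<and> hausdorff_dim ((\<lambda>(x, z, z'). snd c x) ` (kinks c \<inter> U)) \<le> ?s"
      using kinks_dim_locally[OF twist c] by (meson max.coboundedI2)
  qed
  have "snd c ` (msupport \<mu> \<inter> fst c) \<subseteq> (\<Union>S\<in>{?C, ?K}. S)"
  proof
    fix u assume "u \<in> snd c ` (msupport \<mu> \<inter> fst c)"
    then obtain x where x: "u = snd c x" "x \<in> msupport \<mu>" "x \<in> fst c" by auto
    from support_cases[OF x(2,3)] show "u \<in> (\<Union>S\<in>{?C, ?K}. S)"
      using x(1) by (auto intro: rev_image_eqI)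
  qed
  then have "hausdorff_dim (snd c ` (msupport \<mu> \<inter> fst c)) \<le> hausdorff_dim (\<Union>S\<in>{?C, ?K}. S)"
    by (rule hausdorff_dim_mono)
  also have "\<dots> \<le> ?s"
    using C K by (intro hausdorff_dim_countable_UN_le s0) auto
  finally show "hausdorff_dim (snd c ` (msupport \<mu> \<inter> fst c)) \<le> ?s" .
qed

end

theorem corollary4p1p1:
  fixes AX :: "('x::{t2_space, second_countable_topology}, 'n::finite) chart set"
    and AY :: "('y::{t2_space, second_countable_topology}, 'n) chart set"
    and AZ :: "('z::{t2_space, second_countable_topology}, 'n) chart set"
    and X :: "'x set" and Y :: "'y set" and Z :: "'z set"
    and h :: "'x \<Rightarrow> 'z \<Rightarrow> real" and g :: "'y \<Rightarrow> 'z \<Rightarrow> real"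
    and \<mu> :: "'x measure" and \<nu> :: "'y measure" and F :: "'x \<Rightarrow> 'y"
  assumes "smooth_atlas AX" and "smooth_atlas AY" and "smooth_atlas AZ"
    and "open X" and "open Y" and "open Z"
    and "compact (closure X)" and "compact (closure Y)" and "compact (closure Z)"
    and "C2_closure AX AZ X Z h" and "C2_closure AY AZ Y Z g"
    and "\<And>x y. x \<in> closure X \<Longrightarrow> y \<in> closure Y \<Longrightarrow>
           \<exists>!z. z \<in> Z \<and> h x z + g y z = surplus h g Z x y"
    and "\<And>x y d. x \<in> closure X \<Longrightarrow> y \<in> closure Y \<Longrightarrow> d \<in> AZ \<Longrightarrow> contract h g Z x y \<in> fst d \<Longrightarrow>
           invertible (D2_second d X Z h x (contract h g Z x y) +
                       D2_second d Y Z g y (contract h g Z x y))"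
    and "twisted_first_second AX X Z h" and "twisted_second_first AZ Y Z g"
    and "nondegenerate AX AZ X Z h" and "nondegenerate AY AZ Y Z g"
    and "borel_prob_on X \<mu>" and "borel_prob_on Y \<nu>"
    and "unique_monge_solution (surplus h g Z) \<mu> \<nu> F"
    and "\<And>S. S \<in> sets \<mu> \<Longrightarrow> manifold_hausdorff_dim AX S \<le> ereal (real CARD('n) - 1) \<Longrightarrow>
           emeasure \<mu> S = 0"
    and "manifold_hausdorff_dim AX (msupport \<mu>) = ereal (real CARD('n))"
  shows "manifold_hausdorff_dim AZ
           (msupport (distr \<mu> (restrict_space borel Z) (\<lambda>x. contract h g Z x (F x)))) =
         ereal (real CARD('n))"
proof (rule antisym)
  \<comment> \<open>A point has dimension 0, and \<open>CARD('n)\<close> is at least 1; so points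
    fall under the hypothesis on sets of dimension at most n - 1.\<close>
  have atomless: "emeasure \<mu> {x} = 0" if x: "x \<in> X" for x
  proof (rule assms(21))
    have "{x} \<in> sets (restrict_space borel X)"
      using x by (auto simp: sets_restrict_space intro!: image_eqI[of _ _ "{x}"])
    then show "{x} \<in> sets \<mu>" using assms(18) by (simp add: borel_prob_on_def)
    have "hausdorff_dim (snd c ` ({x} \<inter> fst c)) \<le> ereal (real CARD('n) - 1)" for c :: "('x, 'n) chart"
    proof -
      have "hausdorff_dim (snd c ` ({x} \<inter> fst c)) \<le> 0" by (rule hausdorff_dim_singleton_le[of _ "snd c x"]) auto
      also have "0 \<le> ereal (real CARD('n) - 1)" by simp
      finally show ?thesis .
    qed
    then show "manifold_hausdorff_dim AX {x} \<le> ereal (real CARD('n) - 1)"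
      unfolding manifold_hausdorff_dim_def by (intro SUP_least)
  qed
  interpret hedonic_transport AX AY AZ X Y Z h g \<mu> \<nu> F
  proof unfold_locales
    show "monge_solution (surplus h g Z) \<mu> \<nu> F"
      using assms(20) by (simp add: unique_monge_solution_def)
  qed (fact assms | fact atomless)+
  show "manifold_hausdorff_dim AZ (msupport mu_Z) \<le> ereal (real CARD('n))"
    unfolding manifold_hausdorff_dim_def by (intro SUP_least hausdorff_dim_vec_le)
  \<comment> \<open>The kinks contribute n - 1, which is too small to account for dimension n; the
    maximum is therefore reached by the support of \<open>mu_Z\<close>.\<close>
  have "ereal (real CARD('n)) \<le> max (manifold_hausdorff_dim AZ (msupport mu_Z)) (ereal (real CARD('n) - 1))"
    using manifold_hausdorff_dim_support_le[OF assms(14,16)] unfolding assms(22) .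
  moreover have "ereal (real CARD('n) - 1) < ereal (real CARD('n))" by simp
  ultimately show "ereal (real CARD('n)) \<le> manifold_hausdorff_dim AZ (msupport mu_Z)"
    by (auto simp: le_max_iff_disj)
qed

end
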